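(* Let $f$ be the graph function of a scalar curvature flow with a flat side satisfying the assumptions listed in the context, $g=\sqrt{2f}$, and let $0<T<T_c$ be as there. Then there exists a constant $C>0$ such that, for $0\le t\le T$ and at all points near the interface where $g>0$ is sufficiently small, $$C\le f_{11}\le C^{-1},\qquad C\le \frac1g\sum_{i\ne1}f_{ii}\le C^{-1},\qquad \sqrt{\frac1g\sum_{i\neq1}f_{i1}^2}\ \le\ C^{-1},$$ where at each point the derivatives are taken in an orthonormal frame $e_1,\dots,e_n$ of $\mathbb{R}^n$ with $e_1=\nu$ the outer normal to the level set of $g$ through that point.
   Context: Let $n\ge3$. For a hypersurface in $\mathbb{R}^{n+1}$, $\sigma_2=\frac12(H^2-|A|^2)=\sum_{i<j}\kappa_i\kappa_j$. A scalar curvature flow is a family $M_t=X(\Sigma,t)$ with $\partial X/\partial t=-\sigma_2\nu$, $\nu$ the outer unit normal, $X(\cdot,0)=X_0$. For a graph $x_{n+1}=f(x,t)$ this reads $$f_t=\frac{1}{2\sqrt{1+|\nabla f|^2}}\sum_{i,j,k,l=1}^n\Big(\delta_{ik}-\frac{f_if_k}{1+|\nabla f|^2}\Big)\Big(\delta_{jl}-\frac{f_jf_l}{1+|\nabla f|^2}\Big)(f_{ki}f_{lj}-f_{kj}f_{li}).$$ Setting. The initial hypersurface is compact and convex, $\Sigma=\Sigma_0\cup\Sigma_1$, where $\Sigma_0$ is a flat side contained in $\{x_{n+1}=0\}$, $\Sigma_1$ is strictly convex and lies above this hyperplane, and $\Gamma=\Sigma_0\cap\Sigma_1$. A part of $M_t$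 containing the flat side is the graph $x_{n+1}=f(x,t)$ over $\Omega(t)=\{x\in\mathbb{R}^n:|Df(x,t)|<\infty\}$, $f\ge0$ convex in $x$; $\Sigma_0(t)=\{f(\cdot,t)=0\}$ is the flat side and $\Gamma(t)$ its boundary (interface). $T_c$ is the time when the area of the flat side shrinks to zero; $0<T<T_c$ and $D_{\rho_0}=\{|x|\le\rho_0\}\subset\Sigma_0(t)$ for $0\le t\le T$, $\rho_0>0$; the domain of $f$ is contained in a ball $B_R$. Derivatives of $g=\sqrt{2f}$ at interface points are limits from $\{f>0\}$. At $t=0$ there is $\lambda>0$ with $|Dg|\ge\lambda$ and $D^2_{\tau\tau}g\ge\lambda$ on $\Gamma$ for all tangential directions $\tau$. Regularity assumptions: $g$ is smooth up to the interface for a finite amount of time and of class $C^{2+\beta}$ up to the interface (from $\{f>0\}$) for some $0<\beta<1$ for $0\le t\le T$; $\max_{x\in\Omega(t)}f(x,t)\ge2$ for $0\le t\le T$. *)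

theory Defs
  imports "HOL-Analysis.Analysis"
begin

section \<open>Derivatives and regularity classes\<close>

definition dderiv :: "('a::euclidean_space \<Rightarrow> real) \<Rightarrow> 'a \<Rightarrow> 'a \<Rightarrow> real"
  where "dderiv u x v = frechet_derivative u (at x) v"

definition dderiv2 :: "('a::euclidean_space \<Rightarrow> real) \<Rightarrow> 'a \<Rightarrow> 'a \<Rightarrow> 'a \<Rightarrow> real"
  where "dderiv2 u x v w = dderiv (\<lambda>y. dderiv u y v) x w"

definition grad :: "('a::euclidean_space \<Rightarrow> real) \<Rightarrow> 'a \<Rightarrow> 'a"
  where "grad u x = (\<Sum>b\<in>Basis. dderiv u x b *\<^sub>R b)"

text \<open>Time runs in \<open>[0,\<infinity>)\<close>, so that the time derivative at \<open>t = 0\<close> is one-sided.\<close>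

definition tderiv :: "('a \<Rightarrow> real \<Rightarrow> real) \<Rightarrow> 'a \<Rightarrow> real \<Rightarrow> real"
  where "tderiv u x t = vector_derivative (\<lambda>s. u x s) (at t within {0..})"

text \<open>\<open>Ck_upto k F U S\<close>, for open \<open>U\<close> and \<open>U \<subseteq> S \<subseteq> closure U\<close>: \<open>F\<close> is of class \<open>C\<^sup>k\<close> on \<open>U\<close> and
  all its partial derivatives of order at most \<open>k\<close> extend continuously from \<open>U\<close> to \<open>S\<close>.
  For \<open>S = U\<close> this is ordinary \<open>C\<^sup>k\<close> regularity on \<open>U\<close>.\<close>

primrec Ck_upto :: "nat \<Rightarrow> ('a::euclidean_space \<Rightarrow> real) \<Rightarrow> 'a set \<Rightarrow> 'a set \<Rightarrow> bool" where
  "Ck_upto 0 F U S \<longleftrightarrow> (\<exists>h. continuous_on S h \<and> (\<forall>x\<in>U. h x = F x))"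
| "Ck_upto (Suc k) F U S \<longleftrightarrow>
     (\<exists>h. continuous_on S h \<and> (\<forall>x\<in>U. h x = F x)) \<and>
     (\<forall>x\<in>U. F differentiable (at x)) \<and>
     (\<forall>b\<in>Basis. Ck_upto k (\<lambda>x. dderiv F x b) U S)"

definition smooth_upto :: "('a::euclidean_space \<Rightarrow> real) \<Rightarrow> 'a set \<Rightarrow> 'a set \<Rightarrow> bool"
  where "smooth_upto F U S \<longleftrightarrow> (\<forall>k. Ck_upto k F U S)"

text \<open>Hoelder continuity with respect to the parabolic distance \<open>|x - y| + |t - s|\<^sup>1\<^sup>/\<^sup>2\<close>.\<close>

definition parabolic_holder_on ::
    "real \<Rightarrow> real \<Rightarrow> ('a::metric_space \<times> real) set \<Rightarrow> ('a \<Rightarrow> real \<Rightarrow> real) \<Rightarrow> bool"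
  where "parabolic_holder_on \<beta> L A F \<longleftrightarrow>
    (\<forall>(x, t)\<in>A. \<forall>(y, s)\<in>A. \<bar>F x t - F y s\<bar> \<le> L * (dist x y + sqrt \<bar>t - s\<bar>) powr \<beta>)"

text \<open>The parabolic class \<open>C\<^sup>2\<^sup>+\<^sup>\<beta>\<close> on \<open>A\<close>: the function, its spatial derivatives of order one and two
  and its time derivative are Hoelder continuous, uniformly on \<open>A\<close>. (Uniform Hoelder continuity
  provides the continuous extension to the boundary points of \<open>A\<close>.)\<close>

definition C2_holder_on ::
    "real \<Rightarrow> ('a::euclidean_space \<times> real) set \<Rightarrow> ('a \<Rightarrow> real \<Rightarrow> real) \<Rightarrow> bool"
  where "C2_holder_on \<beta> A u \<longleftrightarrow>
    (\<forall>(x, t)\<in>A. (\<lambda>y. u y t) differentiable (at x) \<and>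
       (\<forall>v. (\<lambda>y. dderiv (\<lambda>z. u z t) y v) differentiable (at x)) \<and>
       (\<lambda>s. u x s) differentiable (at t within {0..})) \<and>
    (\<exists>L. parabolic_holder_on \<beta> L A u \<and>
       (\<forall>v. norm v = 1 \<longrightarrow> parabolic_holder_on \<beta> L A (\<lambda>x t. dderiv (\<lambda>y. u y t) x v)) \<and>
       (\<forall>v w. norm v = 1 \<longrightarrow> norm w = 1 \<longrightarrow>
          parabolic_holder_on \<beta> L A (\<lambda>x t. dderiv2 (\<lambda>y. u y t) x v w)) \<and>
       parabolic_holder_on \<beta> L A (tderiv u))"


section \<open>Curvature of closed hypersurfaces\<close>

text \<open>\<open>\<real>\<^sup>n\<^sup>+\<^sup>1\<close> is \<open>real^'n \<times> real\<close>, the second component being \<open>x\<^sub>n\<^sub>+\<^sub>1\<close>.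
  The first limit says that \<open>v\<close> is orthogonal to all tangent directions of \<open>M\<close> at \<open>p\<close>.\<close>

definition outer_unit_normal :: "'a::euclidean_space set \<Rightarrow> 'a \<Rightarrow> 'a \<Rightarrow> bool"
  where "outer_unit_normal M p v \<longleftrightarrow> norm v = 1 \<and>
    ((\<lambda>q. ((q - p) \<bullet> v) / norm (q - p)) \<longlongrightarrow> 0) (at p within M) \<and>
    (\<exists>\<epsilon>>0. \<forall>s. 0 < s \<and> s < \<epsilon> \<longrightarrow> p - s *\<^sub>R v \<in> inside M \<and> p + s *\<^sub>R v \<in> outside M)"

definition outer_normal :: "'a::euclidean_space set \<Rightarrow> 'a \<Rightarrow> 'a"
  where "outer_normal M p = (THE v. outer_unit_normal M p v)"

definition tangent_proj :: "'a::euclidean_space set \<Rightarrow> 'a \<Rightarrow> 'a \<Rightarrow> 'a"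
  where "tangent_proj M p v = v - (v \<bullet> outer_normal M p) *\<^sub>R outer_normal M p"

text \<open>The second fundamental form is the differential of the outer unit normal along \<open>M\<close>
  (so it is positive on round spheres), extended by zero in the normal direction. The projections
  also remove the ambiguity of a derivative within \<open>M\<close> in the normal direction.\<close>

definition second_fundamental_form :: "'a::euclidean_space set \<Rightarrow> 'a \<Rightarrow> 'a \<Rightarrow> 'a \<Rightarrow> real"
  where "second_fundamental_form M p v w =
    frechet_derivative (outer_normal M) (at p within M) (tangent_proj M p v) \<bullet> tangent_proj M p w"

definition mean_curvature :: "'a::euclidean_space set \<Rightarrow> 'a \<Rightarrow> real"
  where "mean_curvature M p = (\<Sum>b\<in>Basis. second_fundamental_form M p b b)"

definition norm_sff_squared :: "'a::euclidean_space set \<Rightarrow> 'a \<Rightarrow> real"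
  where "norm_sff_squared M p = (\<Sum>a\<in>Basis. \<Sum>b\<in>Basis. (second_fundamental_form M p a b)\<^sup>2)"

definition sigma2 :: "'a::euclidean_space set \<Rightarrow> 'a \<Rightarrow> real"
  where "sigma2 M p = ((mean_curvature M p)\<^sup>2 - norm_sff_squared M p) / 2"


section \<open>Scalar curvature flow of a hypersurface with a flat side\<close>

text \<open>The points of \<open>M\<close> on the boundary of the flat side \<open>M \<inter> {x\<^sub>n\<^sub>+\<^sub>1 = 0}\<close>.\<close>

definition hs_interface :: "((real^'n) \<times> real) set \<Rightarrow> ((real^'n) \<times> real) set"
  where "hs_interface M = frontier {x. (x, 0) \<in> M} \<times> {0}"

text \<open>Compact convex initial hypersurface \<open>\<Sigma> = \<Sigma>\<^sub>0 \<union> \<Sigma>\<^sub>1\<close>, with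
  \<open>\<Sigma>\<^sub>0 = \<Sigma> \<inter> {x\<^sub>n\<^sub>+\<^sub>1 = 0}\<close> and \<open>\<Sigma>\<^sub>1\<close> the closure of the rest. Strict convexity means that the
  principal curvatures are positive; they degenerate or are undefined on \<open>\<Gamma> = \<Sigma>\<^sub>0 \<inter> \<Sigma>\<^sub>1\<close>,
  so this is required off \<open>\<Gamma>\<close>.\<close>

definition initial_hypersurface :: "((real^'n) \<times> real) set \<Rightarrow> bool"
  where "initial_hypersurface S \<longleftrightarrow>
    (\<exists>K. compact K \<and> convex K \<and> interior K \<noteq> {} \<and> S = frontier K) \<and>
    (\<forall>p\<in>S. snd p \<ge> 0) \<and>
    interior {x. (x, 0) \<in> S} \<noteq> {} \<and>
    (\<forall>p\<in>S. snd p > 0 \<longrightarrow>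
       (\<forall>v. v \<noteq> 0 \<and> v \<bullet> outer_normal S p = 0 \<longrightarrow> second_fundamental_form S p v v > 0))"

text \<open>A smooth family \<open>M t\<close> of hypersurfaces near \<open>(q, t)\<close>: locally the regular zero set of a
  smooth function on space-time.\<close>

definition smooth_family_at ::
    "(real \<Rightarrow> 'a::euclidean_space set) \<Rightarrow> real \<Rightarrow> 'a \<Rightarrow> real \<Rightarrow> bool"
  where "smooth_family_at M Tc q t \<longleftrightarrow>
    (\<exists>U \<Phi>. open U \<and> (q, t) \<in> U \<and> smooth_upto \<Phi> U U \<and>
       (\<forall>(y, s)\<in>U. grad (\<lambda>z. \<Phi> (z, s)) y \<noteq> 0) \<and>
       (\<forall>(y, s)\<in>U. 0 \<le> s \<and> s < Tc \<longrightarrow> (y \<in> M s \<longleftrightarrow> \<Phi> (y, s) = 0)))"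

text \<open>Scalar curvature flow \<open>M\<^sub>t = X(\<Sigma>, t)\<close> for \<open>0 \<le> t < T\<^sub>c\<close>, starting from the inclusion
  \<open>X\<^sub>0\<close> of the initial hypersurface. The hypersurfaces have a continuous unit normal but are not
  twice differentiable across the interface, so \<open>\<sigma>\<^sub>2\<close> and the equation only make sense off it.\<close>

definition scalar_curvature_flow ::
    "((real^'n) \<times> real) set \<Rightarrow> real \<Rightarrow> ((real^'n) \<times> real \<Rightarrow> real \<Rightarrow> (real^'n) \<times> real) \<Rightarrow>
     (real \<Rightarrow> ((real^'n) \<times> real) set) \<Rightarrow> bool"
  where "scalar_curvature_flow S Tc X M \<longleftrightarrow>
    (\<forall>p\<in>S. X p 0 = p) \<and>
    (\<forall>t. 0 \<le> t \<and> t < Tc \<longrightarrow> M t = (\<lambda>p. X p t) ` S \<and> inj_on (\<lambda>p. X p t) S) \<and>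
    continuous_on (S \<times> {0..<Tc}) (\<lambda>(p, t). X p t) \<and>
    (\<forall>t q. 0 \<le> t \<and> t < Tc \<and> q \<in> M t \<longrightarrow> (\<exists>!v. outer_unit_normal (M t) q v)) \<and>
    continuous_on {(q, t). 0 \<le> t \<and> t < Tc \<and> q \<in> M t} (\<lambda>(q, t). outer_normal (M t) q) \<and>
    (\<forall>t q. 0 \<le> t \<and> t < Tc \<and> q \<in> M t - hs_interface (M t) \<longrightarrow> smooth_family_at M Tc q t) \<and>
    (\<forall>t. \<forall>p\<in>S. 0 \<le> t \<and> t < Tc \<and> X p t \<notin> hs_interface (M t) \<longrightarrow>
       (X p has_vector_derivative - sigma2 (M t) (X p t) *\<^sub>R outer_normal (M t) (X p t))
         (at t within {0..<Tc}))"


section \<open>The graph function\<close>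

text \<open>Right-hand side of the flow equation for graphs; \<open>u\<close> is the graph function at a fixed time.\<close>

definition graph_speed :: "(real^'n \<Rightarrow> real) \<Rightarrow> real^'n \<Rightarrow> real"
  where "graph_speed u x =
   (let D = (\<lambda>i. dderiv u x (axis i 1));
        DD = (\<lambda>i j. dderiv2 u x (axis i 1) (axis j 1));
        q = 1 + (norm (grad u x))\<^sup>2;
        h = (\<lambda>i k. of_bool (i = k) - D i * D k / q)
    in 1 / (2 * sqrt q) *
       (\<Sum>i\<in>UNIV. \<Sum>j\<in>UNIV. \<Sum>k\<in>UNIV. \<Sum>l\<in>UNIV.
          h i k * h j l * (DD k i * DD l j - DD k j * DD l i)))"

definition flat_side :: "(real \<Rightarrow> (real^'n) set) \<Rightarrow> (real^'n \<Rightarrow> real \<Rightarrow> real) \<Rightarrow> real \<Rightarrow> (real^'n) set"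
  where "flat_side \<Omega> f t = {x \<in> \<Omega> t. f x t = 0}"

definition flat_interface ::
    "(real \<Rightarrow> (real^'n) set) \<Rightarrow> (real^'n \<Rightarrow> real \<Rightarrow> real) \<Rightarrow> real \<Rightarrow> (real^'n) set"
  where "flat_interface \<Omega> f t = frontier (flat_side \<Omega> f t)"

definition pressure :: "('a \<Rightarrow> real \<Rightarrow> real) \<Rightarrow> 'a \<Rightarrow> real \<Rightarrow> real"
  where "pressure f x t = sqrt (2 * f x t)"

text \<open>\<open>f(\<cdot>, t)\<close>, a convex nonnegative function on \<open>\<Omega>(t) = {x. |Df(x, t)| < \<infinity>}\<close>, describes a part of
  \<open>M t\<close> that contains the flat side. Values of \<open>f\<close> outside \<open>\<Omega>(t)\<close> are irrelevant; that \<open>\<Omega>(t)\<close> is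
  the full set where the gradient is finite is expressed by differentiability on \<open>\<Omega>(t)\<close> and blow-up
  of the gradient at its boundary. The last two clauses are the smoothness of the flow and its
  equation, read for the graph, off the interface.\<close>

definition flow_graph ::
    "(real \<Rightarrow> ((real^'n) \<times> real) set) \<Rightarrow> real \<Rightarrow> (real \<Rightarrow> (real^'n) set) \<Rightarrow>
     (real^'n \<Rightarrow> real \<Rightarrow> real) \<Rightarrow> bool"
  where "flow_graph M Tc \<Omega> f \<longleftrightarrow>
    openin (top_of_set (UNIV \<times> {0..<Tc})) {(x, t). 0 \<le> t \<and> t < Tc \<and> x \<in> \<Omega> t} \<and>
    continuous_on {(x, t). 0 \<le> t \<and> t < Tc \<and> x \<in> \<Omega> t} (\<lambda>(x, t). f x t) \<and>
    (\<forall>t. 0 \<le> t \<and> t < Tc \<longrightarrow>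
       convex_on (\<Omega> t) (\<lambda>x. f x t) \<and>
       (\<forall>x\<in>\<Omega> t. f x t \<ge> 0 \<and> (x, f x t) \<in> M t) \<and>
       flat_side \<Omega> f t = {x. (x, 0) \<in> M t} \<and>
       (\<forall>x\<in>\<Omega> t. (\<lambda>y. f y t) differentiable (at x)) \<and>
       (\<forall>x\<in>frontier (\<Omega> t).
          filterlim (\<lambda>y. norm (grad (\<lambda>z. f z t) y)) at_top (at x within \<Omega> t))) \<and>
    smooth_upto (\<lambda>(x, t). f x t)
      {(x, t). 0 < t \<and> t < Tc \<and> x \<in> \<Omega> t - flat_interface \<Omega> f t}
      {(x, t). 0 \<le> t \<and> t < Tc \<and> x \<in> \<Omega> t - flat_interface \<Omega> f t} \<and>
    (\<forall>t. 0 \<le> t \<and> t < Tc \<longrightarrow> (\<forall>x\<in>\<Omega> t - flat_interface \<Omega> f t.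
       ((\<lambda>s. f x s) has_real_derivative graph_speed (\<lambda>y. f y t) x) (at t within {0..})))"

definition flat_side_vanishing_time ::
    "real \<Rightarrow> (real \<Rightarrow> (real^'n) set) \<Rightarrow> (real^'n \<Rightarrow> real \<Rightarrow> real) \<Rightarrow> bool"
  where "flat_side_vanishing_time Tc \<Omega> f \<longleftrightarrow>
    (\<forall>t. 0 \<le> t \<and> t < Tc \<longrightarrow> measure lebesgue (flat_side \<Omega> f t) > 0) \<and>
    ((\<lambda>t. measure lebesgue (flat_side \<Omega> f t)) \<longlongrightarrow> 0) (at_left Tc)"

text \<open>\<open>|Dg| \<ge> l0\<close> and \<open>D\<^sup>2\<^sub>\<tau>\<^sub>\<tau> g \<ge> l0\<close> on the interface at time \<open>0\<close>, with derivatives understood as limits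
  from the positivity set. As \<open>G \<noteq> 0\<close> is normal to the interface, the tangential directions are
  those orthogonal to \<open>G\<close>.\<close>

definition initially_nondegenerate ::
    "real \<Rightarrow> (real \<Rightarrow> (real^'n) set) \<Rightarrow> (real^'n \<Rightarrow> real \<Rightarrow> real) \<Rightarrow> bool"
  where "initially_nondegenerate l0 \<Omega> f \<longleftrightarrow>
    (\<forall>x\<in>flat_interface \<Omega> f 0.
       let g = (\<lambda>y. pressure f y 0); F = at x within {y \<in> \<Omega> 0. f y 0 > 0}
       in \<exists>G. (grad g \<longlongrightarrow> G) F \<and> norm G \<ge> l0 \<and>
            (\<forall>\<tau>. norm \<tau> = 1 \<and> \<tau> \<bullet> G = 0 \<longrightarrow>
               (\<exists>l. ((\<lambda>y. dderiv2 g y \<tau> \<tau>) \<longlongrightarrow> l) F \<and> l \<ge> l0)))"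

definition smooth_up_to_interface ::
    "real \<Rightarrow> (real \<Rightarrow> (real^'n) set) \<Rightarrow> (real^'n \<Rightarrow> real \<Rightarrow> real) \<Rightarrow> bool"
  where "smooth_up_to_interface T \<Omega> f \<longleftrightarrow>
    smooth_upto (\<lambda>(x, t). pressure f x t)
      {(x, t). 0 < t \<and> t < T \<and> x \<in> \<Omega> t \<and> f x t > 0}
      {(x, t). 0 \<le> t \<and> t \<le> T \<and> x \<in> \<Omega> t \<and> (f x t > 0 \<or> x \<in> flat_interface \<Omega> f t)}"

definition C2_holder_up_to_interface ::
    "real \<Rightarrow> real \<Rightarrow> (real \<Rightarrow> (real^'n) set) \<Rightarrow> (real^'n \<Rightarrow> real \<Rightarrow> real) \<Rightarrow> bool"
  where "C2_holder_up_to_interface \<beta> T \<Omega> f \<longleftrightarrow>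
    (\<exists>\<delta>>0. C2_holder_on \<beta>
       {(x, t). 0 \<le> t \<and> t \<le> T \<and> x \<in> \<Omega> t \<and> 0 < pressure f x t \<and> pressure f x t < \<delta>}
       (pressure f))"

text \<open>Orthonormal frame whose vector with index \<open>k\<close> (called \<open>e\<^sub>1\<close> in the usual notation) is the
  normal of the level set of \<open>g\<close> through \<open>x\<close> pointing out of the sublevel set. Where
  \<open>g = sqrt (2 f) > 0\<close> and \<open>f\<close> is convex with minimum \<open>0\<close>, the gradient of \<open>g\<close> does not vanish.\<close>

definition adapted_frame ::
    "(real^'n \<Rightarrow> real) \<Rightarrow> real^'n \<Rightarrow> 'n \<Rightarrow> ('n \<Rightarrow> real^'n) \<Rightarrow> bool"
  where "adapted_frame g x k e \<longleftrightarrow>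
    (\<forall>i j. e i \<bullet> e j = of_bool (i = j)) \<and> e k = sgn (grad g x)"

end

(*
The speed u = f_t satisfies the linearised equation u_t = L u, which has no zeroth order term, and
u >= 0 by convexity. The pressure g is itself a solution up to an error O(g), and
exp (-K t) phi(g) with phi(g) = g (delta - g)^2 is a subsolution on {0 < g < delta} that vanishes on both
sides: where phi' < 0 the error is controlled by the tangential trace h = f_22 + ... + f_nn, which is
also the factor of the good term phi''(g) |Dg|^2 h, and |Dg| >= g / (2 R) by convexity.
The minimum principle then propagates the initial bound u >= eps g to all times. As
u <= h (f_11 + h / 2) and h <= C g, this bounds h / g and f_11 from below; the upper bounds are the
C^2 bounds for g.
*)
theory Submission
  imports Defs
begin

section \<open>Second derivatives and convexity\<close>

text \<open>Nondegeneracy of Dg and of the level sets is given only at t = 0. At later times no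
  parabolicity constant is available, so each error in the barrier inequality must be paid by K or
  by a term with the same factor h. The barrier vanishes on both sides because u >= 0 is the only
  lateral information: at g = 0 the speed u = g g_t tends to 0 itself, and at g = \<delta> nothing
  better is known for t > 0. The simple zero at 0 gives the linear bound in g that is wanted; the
  zero at \<delta> is double so that \<phi>' tends to 0 there while \<phi>'' stays positive. The
  bound |Dg| >= g / (2 R) degenerates at the interface, but quantitatively it is used only near g =
  \<delta>. That g almost solves the linearised equation rests on homogeneity: for a fixed gradient
  the speed is quadratic in the Hessian, so its second order linearisation L satisfies L f = 2 u,
  and D^2 f = g D^2 g + Dg Dg^T turns this into a formula for g L g. At a contact point Du is
  parallel to Df, which makes the first order terms explicit.\<close>

text \<open>Continuity of the second derivatives is deliberately left out: this is what
  \<open>C2_holder_on\<close> supplies pointwise, and it is enough for a symmetric Hessian. Openness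
  of \<open>V\<close> is included so that derivatives depend only on values in
  \<open>V\<close>.\<close>

definition twice_diff_on :: "('a::euclidean_space \<Rightarrow> real) \<Rightarrow> 'a set \<Rightarrow> bool"
  where "twice_diff_on u V \<longleftrightarrow> open V \<and>
    (\<forall>x\<in>V. u differentiable (at x) \<and> (\<forall>v. (\<lambda>y. dderiv u y v) differentiable (at x)))"

lemma dderiv_has_derivative:
  "u differentiable (at x) \<Longrightarrow> (u has_derivative dderiv u x) (at x)"
  unfolding dderiv_def by (simp add: frechet_derivative_works[symmetric] eta_contract_eq)

lemma dderiv_eqI: "(u has_derivative D) (at x) \<Longrightarrow> dderiv u x = D"
  unfolding dderiv_def using frechet_derivative_at by (metis ext)

lemma linear_dderiv: "u differentiable (at x) \<Longrightarrow> linear (dderiv u x)"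
  using dderiv_has_derivative has_derivative_linear by blast

lemma dderiv_cong:
  assumes "open V" "x \<in> V" "\<And>y. y \<in> V \<Longrightarrow> u y = w y"
  shows "dderiv u x = dderiv w x"
proof -
  have *: "(u has_derivative D) (at x) \<longleftrightarrow> (w has_derivative D) (at x)" for D
    using has_derivative_transform_within_open[of u D x UNIV V w]
      has_derivative_transform_within_open[of w D x UNIV V u] assms by auto
  show ?thesis unfolding dderiv_def frechet_derivative_def by (simp add: *)
qed

lemma dderiv2_cong:
  assumes "open V" "x \<in> V" "\<And>y. y \<in> V \<Longrightarrow> u y = w y"
  shows "dderiv2 u x v = dderiv2 w x v"
proof
  fix z
  have "dderiv u y v = dderiv w y v" if "y \<in> V" for y
    using dderiv_cong[OF assms(1) that, of u w] assms(3) by simp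
  then show "dderiv2 u x v z = dderiv2 w x v z"
    unfolding dderiv2_def using dderiv_cong[OF assms(1,2), of "\<lambda>y. dderiv u y v" "\<lambda>y. dderiv w y v"] by simp
qed

lemma dderiv2_has_derivative:
  assumes "twice_diff_on u V" "x \<in> V"
  shows "((\<lambda>y. dderiv u y v) has_derivative dderiv2 u x v) (at x)"
proof -
  have "dderiv2 u x v = dderiv (\<lambda>y. dderiv u y v) x"
    unfolding dderiv2_def by auto
  then show ?thesis
    using assms dderiv_has_derivative[of "\<lambda>y. dderiv u y v" x] unfolding twice_diff_on_def by auto
qed

lemma twice_diff_onD:
  assumes "twice_diff_on u V"
  shows "open V" "x \<in> V \<Longrightarrow> (u has_derivative dderiv u x) (at x)" "x \<in> V \<Longrightarrow> u differentiable (at x)"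
  using assms dderiv_has_derivative unfolding twice_diff_on_def by auto

lemma twice_diff_onI:
  assumes "open V" "\<And>x. x \<in> V \<Longrightarrow> (u has_derivative D x) (at x)"
    "\<And>x v. x \<in> V \<Longrightarrow> ((\<lambda>y. D y v) has_derivative DD x v) (at x)"
  shows "twice_diff_on u V" "x \<in> V \<Longrightarrow> dderiv u x = D x" "x \<in> V \<Longrightarrow> dderiv2 u x v = DD x v"
proof -
  have 1: "dderiv u x = D x" if "x \<in> V" for x using assms(2)[OF that] by (rule dderiv_eqI)
  have 2: "((\<lambda>y. dderiv u y v) has_derivative DD x v) (at x)" if "x \<in> V" for x v
    by (rule has_derivative_transform_within_open[OF assms(3)[OF that] assms(1) that]) (simp add: 1)
  show "twice_diff_on u V" unfolding twice_diff_on_def differentiable_def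
    using assms(1,2) 2 by blast
  show "x \<in> V \<Longrightarrow> dderiv u x = D x" by (rule 1)
  show "x \<in> V \<Longrightarrow> dderiv2 u x v = DD x v"
    using dderiv_eqI[OF 2] by (simp add: dderiv2_def[abs_def])
qed

text \<open>Linearity in the inner direction does not come from the outer derivative: it holds
  because \<open>dderiv u y\<close> is linear at every \<open>y\<close> of the open set
  \<open>V\<close>, and a derivative is unique.\<close>

lemma linear_dderiv2:
  assumes "twice_diff_on u V" "x \<in> V"
  shows "linear (dderiv2 u x v)" "linear (\<lambda>v. dderiv2 u x v w)"
proof -
  show "linear (dderiv2 u x v)"
    using dderiv2_has_derivative[OF assms] has_derivative_linear by blast
  have V: "open V" and lin: "\<And>y. y \<in> V \<Longrightarrow> linear (dderiv u y)"
    using assms linear_dderiv unfolding twice_diff_on_def by auto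
  note h = dderiv2_has_derivative[OF assms]
  show "linear (\<lambda>v. dderiv2 u x v w)"
  proof (rule linearI)
    fix a b :: 'a and r :: real
    have "((\<lambda>y. dderiv u y (a + b)) has_derivative (\<lambda>w. dderiv2 u x a w + dderiv2 u x b w)) (at x)"
      by (rule has_derivative_transform_within_open[OF has_derivative_add[OF h[of a] h[of b]] V assms(2)])
         (simp add: lin linear_add)
    from has_derivative_unique[OF this h] show "dderiv2 u x (a + b) w = dderiv2 u x a w + dderiv2 u x b w"
      by metis
    have "((\<lambda>y. dderiv u y (r *\<^sub>R a)) has_derivative (\<lambda>w. r *\<^sub>R dderiv2 u x a w)) (at x)"
      by (rule has_derivative_transform_within_open[OF has_derivative_scaleR_right[OF h[of a]] V assms(2)])
         (simp add: lin linear_cmul)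
    from has_derivative_unique[OF this h] show "dderiv2 u x (r *\<^sub>R a) w = r *\<^sub>R dderiv2 u x a w"
      by metis
  qed
qed

section \<open>Symmetry of the Hessian and conditions at a local minimum\<close>

lemma line_has_real_derivative:
  assumes "(u has_derivative D) (at (a + s *\<^sub>R v))"
  shows "((\<lambda>r. u (a + r *\<^sub>R v)) has_real_derivative D v) (at s)"
proof -
  have "((\<lambda>r. a + r *\<^sub>R v) has_derivative (\<lambda>h. h *\<^sub>R v)) (at s)"
    by (auto intro!: derivative_eq_intros)
  from has_derivative_compose[OF this assms]
  have "((\<lambda>r. u (a + r *\<^sub>R v)) has_derivative (\<lambda>h. D (h *\<^sub>R v))) (at s)" .
  moreover have "D (h *\<^sub>R v) = D v * h" for h
    using linear_cmul[OF has_derivative_linear[OF assms]] by (simp add: mult.commute)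
  ultimately show ?thesis by (simp add: has_field_derivative_def)
qed

text \<open>The mean value theorem is applied in direction \<open>v\<close> to the increment of
  \<open>u\<close> by \<open>h w\<close>; the resulting difference of first derivatives is expanded
  at \<open>x\<close>, which needs only differentiability of \<open>dderiv u _ v\<close> at that
  point.\<close>

lemma second_difference:
  assumes tw: "twice_diff_on u V" and x: "x \<in> V" and e: "e > 0"
  shows "\<exists>d>0. \<forall>h. 0 < h \<and> h < d \<longrightarrow>
    \<bar>u (x + h *\<^sub>R v + h *\<^sub>R w) - u (x + h *\<^sub>R v) - u (x + h *\<^sub>R w) + u x - h\<^sup>2 * dderiv2 u x v w\<bar> \<le> e * h\<^sup>2"
proof -
  \<comment> \<open>\<open>h * N\<close> bounds every displacement inside the parallelogram spanned
    by \<open>h v\<close> and \<open>h w\<close>; with \<open>e'\<close> = e / (2 N) the two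
    expansion errors add up to e h.\<close>
  define N where "N = norm v + norm w + 1"
  have N: "N > 0" "norm v \<le> N" "norm w \<le> N" and N1: "norm v + norm w < N" unfolding N_def by (auto intro: add_nonneg_pos)
  define e' where "e' = e / (2 * N)"
  have e': "e' > 0" unfolding e'_def using e N by simp
  obtain r where r: "r > 0" "ball x r \<subseteq> V"
    using twice_diff_onD(1)[OF tw] x open_contains_ball by blast
  note H = dderiv2_has_derivative[OF tw x, of v]
  note lin = linear_dderiv2(1)[OF tw x, of v]
  from H e' obtain d0 where d0: "d0 > 0" and
    d0': "\<And>y. norm (y - x) < d0 \<Longrightarrow> \<bar>dderiv u y v - dderiv u x v - dderiv2 u x v (y - x)\<bar> \<le> e' * norm (y - x)"
    unfolding has_derivative_at_alt by (metis real_norm_def)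
  define d where "d = min d0 r / N"
  have dpos: "d > 0" unfolding d_def using d0 r N by simp
  show ?thesis
  proof (intro exI[of _ d] conjI allI impI dpos)
    fix h :: real assume h: "0 < h \<and> h < d"
    have hN: "h * N < d0" "h * N < r" using h N unfolding d_def by (auto simp: field_simps)
    have small: "norm (s *\<^sub>R v + t *\<^sub>R w) \<le> h * N" if "0 \<le> s" "s \<le> h" "0 \<le> t" "t \<le> h" for s t
    proof -
      have "norm (s *\<^sub>R v + t *\<^sub>R w) \<le> s * norm v + t * norm w"
        using norm_triangle_ineq[of "s *\<^sub>R v" "t *\<^sub>R w"] that by simp
      also have "\<dots> \<le> h * norm v + h * norm w" using that by (intro add_mono mult_right_mono) auto
      also have "\<dots> \<le> h * N" unfolding N_def using h by (simp add: algebra_simps)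
      finally show ?thesis .
    qed
    have inV: "x + s *\<^sub>R v + t *\<^sub>R w \<in> V" if "0 \<le> s" "s \<le> h" "0 \<le> t" "t \<le> h" for s t
    proof -
      have "dist (x + (s *\<^sub>R v + t *\<^sub>R w)) x < r"
        using small[OF that] hN by (simp add: dist_norm)
      then have "x + (s *\<^sub>R v + t *\<^sub>R w) \<in> V" using r(2) by (auto simp: dist_commute)
      then show ?thesis by (simp add: add.assoc)
    qed
    define p where "p s = u (x + h *\<^sub>R w + s *\<^sub>R v) - u (x + s *\<^sub>R v)" for s
    have dp: "(p has_real_derivative (dderiv u (x + h *\<^sub>R w + s *\<^sub>R v) v - dderiv u (x + s *\<^sub>R v) v)) (at s)"
      if "0 \<le> s" "s \<le> h" for s
      unfolding p_def using inV[OF that, of h] inV[OF that, of 0] h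
      by (intro DERIV_diff line_has_real_derivative twice_diff_onD(2)[OF tw]) (auto simp: add_ac)
    obtain s where s: "0 < s" "s < h" and
      ps: "p h - p 0 = h * (dderiv u (x + h *\<^sub>R w + s *\<^sub>R v) v - dderiv u (x + s *\<^sub>R v) v)"
      using MVT2[of 0 h p "\<lambda>s. dderiv u (x + h *\<^sub>R w + s *\<^sub>R v) v - dderiv u (x + s *\<^sub>R v) v"] h dp by auto
    have b1: "\<bar>dderiv u (x + h *\<^sub>R w + s *\<^sub>R v) v - dderiv u x v - dderiv2 u x v (s *\<^sub>R v + h *\<^sub>R w)\<bar> \<le> e' * (h * N)"
      using d0'[of "x + h *\<^sub>R w + s *\<^sub>R v"] small[of s h] s h hN e'
      by (smt (verit, best) add.assoc add.commute add_diff_cancel_left' mult_left_mono)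
    have b2: "\<bar>dderiv u (x + s *\<^sub>R v) v - dderiv u x v - dderiv2 u x v (s *\<^sub>R v)\<bar> \<le> e' * (h * N)"
      using d0'[of "x + s *\<^sub>R v"] small[of s 0] s h hN e'
      by (smt (verit, best) add.right_neutral scaleR_zero_left add_diff_cancel_left' mult_left_mono)
    have l: "dderiv2 u x v (s *\<^sub>R v + h *\<^sub>R w) = dderiv2 u x v (s *\<^sub>R v) + h * dderiv2 u x v w"
      using lin by (simp add: linear_add linear_cmul)
    have "\<bar>dderiv u (x + h *\<^sub>R w + s *\<^sub>R v) v - dderiv u (x + s *\<^sub>R v) v - h * dderiv2 u x v w\<bar> \<le> 2 * (e' * (h * N))"
      using b1 b2 l by linarith
    also have "2 * (e' * (h * N)) = e * h" unfolding e'_def using N by simp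
    finally have "h * \<bar>dderiv u (x + h *\<^sub>R w + s *\<^sub>R v) v - dderiv u (x + s *\<^sub>R v) v - h * dderiv2 u x v w\<bar> \<le> h * (e * h)"
      using h by simp
    then have "\<bar>h * (dderiv u (x + h *\<^sub>R w + s *\<^sub>R v) v - dderiv u (x + s *\<^sub>R v) v - h * dderiv2 u x v w)\<bar> \<le> e * h\<^sup>2"
      using h by (simp add: abs_mult power2_eq_square mult_ac)
    then have "\<bar>(p h - p 0) - h\<^sup>2 * dderiv2 u x v w\<bar> \<le> e * h\<^sup>2"
      unfolding ps by (simp add: algebra_simps power2_eq_square)
    then show "\<bar>u (x + h *\<^sub>R v + h *\<^sub>R w) - u (x + h *\<^sub>R v) - u (x + h *\<^sub>R w) + u x - h\<^sup>2 * dderiv2 u x v w\<bar> \<le> e * h\<^sup>2"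
      unfolding p_def by (simp add: algebra_simps)
  qed
qed

text \<open>The second difference is symmetric in \<open>v\<close> and \<open>w\<close>, and divided
  by h^2 it approximates both sides.\<close>

lemma dderiv2_commute:
  assumes tw: "twice_diff_on u V" and x: "x \<in> V"
  shows "dderiv2 u x v w = dderiv2 u x w v"
proof (rule ccontr)
  assume ne: "dderiv2 u x v w \<noteq> dderiv2 u x w v"
  define e where "e = \<bar>dderiv2 u x v w - dderiv2 u x w v\<bar> / 4"
  have e: "e > 0" unfolding e_def using ne by simp
  obtain d1 where d1: "d1 > 0" "\<And>h. 0 < h \<and> h < d1 \<longrightarrow>
    \<bar>u (x + h *\<^sub>R v + h *\<^sub>R w) - u (x + h *\<^sub>R v) - u (x + h *\<^sub>R w) + u x - h\<^sup>2 * dderiv2 u x v w\<bar> \<le> e * h\<^sup>2"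
    using second_difference[OF tw x e] by blast
  obtain d2 where d2: "d2 > 0" "\<And>h. 0 < h \<and> h < d2 \<longrightarrow>
    \<bar>u (x + h *\<^sub>R w + h *\<^sub>R v) - u (x + h *\<^sub>R w) - u (x + h *\<^sub>R v) + u x - h\<^sup>2 * dderiv2 u x w v\<bar> \<le> e * h\<^sup>2"
    using second_difference[OF tw x e] by blast
  define h where "h = min d1 d2 / 2"
  have h: "0 < h" "h < d1" "h < d2" unfolding h_def using d1(1) d2(1) by auto
  have c: "x + h *\<^sub>R w + h *\<^sub>R v = x + h *\<^sub>R v + h *\<^sub>R w" by (simp add: add_ac)
  have "\<bar>h\<^sup>2 * dderiv2 u x v w - h\<^sup>2 * dderiv2 u x w v\<bar> \<le> 2 * (e * h\<^sup>2)"
    using d1(2)[of h] d2(2)[of h] h unfolding c by linarith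
  then have "h\<^sup>2 * \<bar>dderiv2 u x v w - dderiv2 u x w v\<bar> \<le> h\<^sup>2 * (2 * e)"
    unfolding right_diff_distrib[symmetric] abs_mult by (simp add: mult_ac)
  then have "\<bar>dderiv2 u x v w - dderiv2 u x w v\<bar> \<le> 2 * e" using h by simp
  then show False using e unfolding e_def by simp
qed

text \<open>If the second derivative along \<open>v\<close> were negative, the first derivative
  along the line, which starts at 0, would be negative just after 0, and the mean value theorem
  would give a smaller value of \<open>u\<close>.\<close>

lemma local_min_derivatives:
  assumes tw: "twice_diff_on u V" and x: "x \<in> V" and le: "\<And>y. y \<in> V \<Longrightarrow> u x \<le> u y"
  shows "dderiv u x v = 0" "dderiv2 u x v v \<ge> 0"
proof -
  have V: "open V" using tw unfolding twice_diff_on_def by simp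
  show z: "dderiv u x v = 0" for v
    using differential_zero_maxmin[OF x V twice_diff_onD(2)[OF tw x]] le by metis
  show "dderiv2 u x v v \<ge> 0"
  proof (rule ccontr)
    assume neg: "\<not> dderiv2 u x v v \<ge> 0"
    obtain r where r: "r > 0" "ball x r \<subseteq> V" using V x open_contains_ball by blast
    have inV: "x + s *\<^sub>R v \<in> V" if "0 \<le> s" "s < r / (norm v + 1)" for s
    proof -
      have "s * norm v \<le> s * (norm v + 1)" using that by (intro mult_left_mono) auto
      also have "\<dots> < r" using that by (simp add: pos_less_divide_eq add_nonneg_pos)
      finally have "dist x (x + s *\<^sub>R v) < r" using that by (simp add: dist_norm)
      then show ?thesis using r by auto
    qed
    define p where "p s = dderiv u (x + s *\<^sub>R v) v" for s
    have "(p has_real_derivative dderiv2 u x v v) (at 0)"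
      unfolding p_def using dderiv2_has_derivative[OF tw x] by (intro line_has_real_derivative) simp
    then obtain d where d: "d > 0" "\<And>h. 0 < h \<Longrightarrow> h < d \<Longrightarrow> p h < p 0"
      using DERIV_neg_dec_right[of p "dderiv2 u x v v" 0] neg by auto
    have r': "r / (norm v + 1) > 0" using r by (simp add: add_nonneg_pos)
    obtain h where h: "0 < h" "h < d" "h < r / (norm v + 1)"
      using dense[of 0 "min d (r / (norm v + 1))"] d(1) r' by auto
    have dp: "((\<lambda>s. u (x + s *\<^sub>R v)) has_real_derivative p s) (at s)" if "0 \<le> s" "s \<le> h" for s
      unfolding p_def using that h by (intro line_has_real_derivative twice_diff_onD(2)[OF tw] inV) auto
    obtain s where s: "0 < s" "s < h" "u (x + h *\<^sub>R v) - u (x + 0 *\<^sub>R v) = (h - 0) * p s"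
      using MVT2[OF h(1), of "\<lambda>s. u (x + s *\<^sub>R v)" p] dp by blast
    have "p s < 0" using d(2)[of s] s h z[of v] unfolding p_def by simp
    then have "h * p s < 0" using h(1) by (simp add: mult_pos_neg)
    then have "u (x + h *\<^sub>R v) < u x" using s by simp
    with le[OF inV, of h] h show False by simp
  qed
qed

lemma twice_diff_on_diff:
  assumes "twice_diff_on u V" "twice_diff_on w V"
  shows "twice_diff_on (\<lambda>y. u y - w y) V"
    "x \<in> V \<Longrightarrow> dderiv (\<lambda>y. u y - w y) x = (\<lambda>v. dderiv u x v - dderiv w x v)"
    "x \<in> V \<Longrightarrow> dderiv2 (\<lambda>y. u y - w y) x v = (\<lambda>z. dderiv2 u x v z - dderiv2 w x v z)"
  by (rule twice_diff_onI[where D = "\<lambda>x v. dderiv u x v - dderiv w x v" and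
      DD = "\<lambda>x v z. dderiv2 u x v z - dderiv2 w x v z"];
      use assms in \<open>auto intro!: has_derivative_diff twice_diff_onD dderiv2_has_derivative\<close>)+

lemma twice_diff_on_compose:
  fixes \<phi> :: "real \<Rightarrow> real"
  assumes tw: "twice_diff_on u V" and
    d: "\<And>y. y \<in> V \<Longrightarrow> (\<phi> has_real_derivative \<phi>' (u y)) (at (u y))"
      "\<And>y. y \<in> V \<Longrightarrow> (\<phi>' has_real_derivative \<phi>'' (u y)) (at (u y))"
  shows "twice_diff_on (\<lambda>y. \<phi> (u y)) V"
    "x \<in> V \<Longrightarrow> dderiv (\<lambda>y. \<phi> (u y)) x = (\<lambda>v. \<phi>' (u x) * dderiv u x v)"
    "x \<in> V \<Longrightarrow> dderiv2 (\<lambda>y. \<phi> (u y)) x v =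
      (\<lambda>z. \<phi>' (u x) * dderiv2 u x v z + \<phi>'' (u x) * dderiv u x z * dderiv u x v)"
proof -
  have 1: "((\<lambda>y. \<phi> (u y)) has_derivative (\<lambda>v. \<phi>' (u x) * dderiv u x v)) (at x)" if "x \<in> V" for x
    using has_derivative_compose[OF twice_diff_onD(2)[OF tw that]
      d(1)[OF that, unfolded has_field_derivative_def]] by simp
  have 2: "((\<lambda>y. \<phi>' (u y) * dderiv u y v) has_derivative
      (\<lambda>z. \<phi>' (u x) * dderiv2 u x v z + \<phi>'' (u x) * dderiv u x z * dderiv u x v)) (at x)" if "x \<in> V" for x v
  proof -
    have "((\<lambda>y. \<phi>' (u y)) has_derivative (\<lambda>z. \<phi>'' (u x) * dderiv u x z)) (at x)"
      using has_derivative_compose[OF twice_diff_onD(2)[OF tw that]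
        d(2)[OF that, unfolded has_field_derivative_def]] by simp
    from has_derivative_mult[OF this dderiv2_has_derivative[OF tw that]] show ?thesis by simp
  qed
  show "twice_diff_on (\<lambda>y. \<phi> (u y)) V"
    "x \<in> V \<Longrightarrow> dderiv (\<lambda>y. \<phi> (u y)) x = (\<lambda>v. \<phi>' (u x) * dderiv u x v)"
    "x \<in> V \<Longrightarrow> dderiv2 (\<lambda>y. \<phi> (u y)) x v =
      (\<lambda>z. \<phi>' (u x) * dderiv2 u x v z + \<phi>'' (u x) * dderiv u x z * dderiv u x v)"
    using twice_diff_onI[of V "\<lambda>y. \<phi> (u y)" "\<lambda>x v. \<phi>' (u x) * dderiv u x v",
      OF twice_diff_onD(1)[OF tw] 1 2] by auto
qed

lemma twice_diff_on_cong:
  assumes tw: "twice_diff_on u V" and eq: "\<And>y. y \<in> V \<Longrightarrow> w y = u y"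
  shows "twice_diff_on w V"
proof -
  have V: "open V" using tw unfolding twice_diff_on_def by simp
  show ?thesis
    by (rule twice_diff_onI[OF V, of _ "dderiv u" "dderiv2 u"])
       (auto intro!: dderiv2_has_derivative[OF tw] has_derivative_transform_within_open[OF twice_diff_onD(2)[OF tw] V] simp: eq)
qed

text \<open>Convexity bounds each difference quotient along the segment from \<open>x\<close> by
  \<open>u y - u x\<close>; the right-hand limit at 0 is the directional derivative.\<close>

lemma convex_tangent:
  assumes c: "convex_on A u" and A: "open A" "x \<in> A" "y \<in> A" and u: "u differentiable (at x)"
  shows "u x + dderiv u x (y - x) \<le> u y"
proof -
  have cA: "convex A" using c convex_on_imp_convex by blast
  define p where "p s = u (x + s *\<^sub>R (y - x))" for s
  have d: "(p has_real_derivative dderiv u x (y - x)) (at 0)"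
    unfolding p_def using dderiv_has_derivative[OF u] by (intro line_has_real_derivative) simp
  have le: "p s \<le> (1 - s) * u x + s * u y" if "0 < s" "s < 1" for s
  proof -
    have e: "x + s *\<^sub>R (y - x) = (1 - s) *\<^sub>R x + s *\<^sub>R y" by (simp add: algebra_simps)
    show ?thesis unfolding p_def e using convex_onD[OF c, of s x y] that A by simp
  qed
  have lim: "((\<lambda>s. (p s - p 0) / s) \<longlongrightarrow> dderiv u x (y - x)) (at_right 0)"
    using d unfolding DERIV_def by (auto intro: tendsto_within_subset)
  have "eventually (\<lambda>s. (p s - p 0) / s \<le> u y - u x) (at_right 0)"
    unfolding eventually_at_right_field
  proof (intro exI[of _ 1] conjI allI impI)
    fix s :: real assume s: "0 < s" "s < 1"
    have "p s - p 0 \<le> (u y - u x) * s" using le[OF s] unfolding p_def by (simp add: algebra_simps)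
    then show "(p s - p 0) / s \<le> u y - u x" using s by (simp add: pos_divide_le_eq)
  qed simp
  from tendsto_upperbound[OF lim this] show ?thesis by simp
qed

text \<open>\<open>u\<close> minus its tangent function \<open>l\<close> at \<open>x\<close> has a
  minimum there, and subtracting an affine function does not change the Hessian.\<close>

lemma convex_dderiv2_nonneg:
  assumes c: "convex_on A u" and A: "open A" and V: "V \<subseteq> A" and tw: "twice_diff_on u V" and x: "x \<in> V"
  shows "dderiv2 u x v v \<ge> 0"
proof -
  define l where "l y = u x + dderiv u x (y - x)" for y
  have ud: "u differentiable (at x)" using twice_diff_onD(3)[OF tw x] .
  have bl: "bounded_linear (dderiv u x)" using dderiv_has_derivative[OF ud] has_derivative_bounded_linear by blast
  have l1: "(l has_derivative dderiv u x) (at y)" for y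
    unfolding l_def by (rule derivative_eq_intros bounded_linear.has_derivative[OF bl] refl | simp)+
  have l2: "twice_diff_on l V" "dderiv2 l x v = (\<lambda>z. 0)"
    using twice_diff_onI[OF twice_diff_onD(1)[OF tw] l1, of "\<lambda>x v z. 0"] x by auto
  have "0 \<le> dderiv2 (\<lambda>y. u y - l y) x v v"
  proof (rule local_min_derivatives(2)[OF twice_diff_on_diff(1)[OF tw l2(1)] x])
    fix y assume "y \<in> V"
    then show "u x - l x \<le> u y - l y" unfolding l_def
      using convex_tangent[OF c A _ _ ud, of y] V x linear_0[OF linear_dderiv[OF ud]] by auto
  qed
  then show ?thesis using twice_diff_on_diff(3)[OF tw l2(1) x, of v] l2(2) by simp
qed

section \<open>The graph speed in an adapted frame\<close>

lemma orthonormal_expansion: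
  fixes e :: "'n::finite \<Rightarrow> real^'n"
  assumes e: "\<And>i j. e i \<bullet> e j = of_bool (i = j)"
  shows "(\<Sum>i\<in>UNIV. (v \<bullet> e i) *\<^sub>R e i) = v"
proof -
  \<comment> \<open>The frame vectors are the rows of \<open>A\<close>. For a square matrix a right
    inverse is a left inverse, and this turns orthonormality into the expansion.\<close>
  define A where "A = (\<chi> i. e i)"
  have "A ** transpose A = mat 1"
    by (simp add: vec_eq_iff A_def matrix_matrix_mult_def transpose_def mat_def e[unfolded inner_vec_def inner_real_def])
  then have AA: "transpose A ** A = mat 1" by (simp add: matrix_left_right_inverse)
  have "(\<Sum>i\<in>UNIV. (v \<bullet> e i) *\<^sub>R e i) = transpose A *v (A *v v)"
    by (simp add: vec_eq_iff A_def matrix_vector_mult_def transpose_def inner_vec_def mult.commute)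
  also have "\<dots> = v" unfolding matrix_vector_mul_assoc AA by simp
  finally show ?thesis .
qed

lemma axis_orthonormal: "axis i (1::real) \<bullet> axis j 1 = of_bool (i = j)"
  by (simp add: inner_axis_axis)

text \<open>Each frame vector is expanded in the standard basis, and after exchanging the sums the
  expansion of a basis vector in the frame is recognised. It is also applied to products of linear
  forms, where it says that sums of squares do not depend on the frame.\<close>

lemma bilinear_trace_frame:
  fixes e :: "'n::finite \<Rightarrow> real^'n" and B :: "real^'n \<Rightarrow> real^'n \<Rightarrow> real"
  assumes e: "\<And>i j. e i \<bullet> e j = of_bool (i = j)" and B: "bilinear B"
  shows "(\<Sum>i\<in>UNIV. B (e i) (e i)) = (\<Sum>i\<in>UNIV. B (axis i 1) (axis i 1))"
proof -
  have l: "linear (B v)" "linear (\<lambda>v. B v w)" for v w using B unfolding bilinear_def by auto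
  have "B (e i) (e i) = (\<Sum>a\<in>UNIV. (e i \<bullet> axis a 1) * B (axis a 1) (e i))" for i
    using arg_cong[OF orthonormal_expansion[OF axis_orthonormal, of "e i", symmetric], of "\<lambda>z. B z (e i)"]
    by (simp add: linear_sum[OF l(2)] linear_cmul[OF l(2)])
  then have "(\<Sum>i\<in>UNIV. B (e i) (e i)) = (\<Sum>a\<in>UNIV. \<Sum>i\<in>UNIV. (axis a 1 \<bullet> e i) * B (axis a 1) (e i))"
    by (simp add: inner_commute) (rule sum.swap)
  also have "\<dots> = (\<Sum>a\<in>UNIV. B (axis a 1) (\<Sum>i\<in>UNIV. (axis a 1 \<bullet> e i) *\<^sub>R e i))"
    by (simp add: linear_sum[OF l(1)] linear_cmul[OF l(1)])
  finally show ?thesis unfolding orthonormal_expansion[OF e] .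
qed

text \<open>The quadratic polynomial r -> B (v + r w) (v + r w) is nonnegative. As \<open>B\<close>
  is only semidefinite, a vector with \<open>B w w = 0\<close> needs its own case.\<close>

lemma bilinear_cauchy_schwarz:
  fixes B :: "'a::real_vector \<Rightarrow> 'a \<Rightarrow> real"
  assumes B: "bilinear B" and sym: "\<And>v w. B v w = B w v" and pos: "\<And>v. B v v \<ge> 0"
  shows "(B v w)\<^sup>2 \<le> B v v * B w w"
proof -
  have ex: "0 \<le> B v v + 2 * r * B v w + r\<^sup>2 * B w w" for r
    using pos[of "v + r *\<^sub>R w"] B sym[of w v]
    by (simp add: bilinear_ladd bilinear_radd bilinear_lmul bilinear_rmul algebra_simps power2_eq_square)
  show ?thesis
  proof (cases "B w w = 0")
    case True
    have "B v w = 0"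
    proof (rule ccontr)
      assume "B v w \<noteq> 0"
      \<comment> \<open>At this \<open>r\<close> the polynomial, here of degree one, takes the value
        -1.\<close>
      then show False using ex[of "- (B v v + 1) / (2 * B v w)"] True by (simp add: field_simps)
    qed
    then show ?thesis using True by simp
  next
    case False
    then have w: "B w w > 0" using pos[of w] by simp
    have "0 \<le> B w w * (B v v + 2 * (- B v w / B w w) * B v w + (- B v w / B w w)\<^sup>2 * B w w)"
      using ex[of "- B v w / B w w"] w by (intro mult_nonneg_nonneg) auto
    also have "\<dots> = B v v * B w w - (B v w)\<^sup>2"
      using w by (simp add: field_simps power2_eq_square)
    finally show ?thesis by simp
  qed
qed

lemma orthonormal_frame_exists:
  fixes a :: "real^'n"
  assumes "norm a = 1"
  obtains e :: "'n \<Rightarrow> real^'n" where "\<And>i j. e i \<bullet> e j = of_bool (i = j)" "e k = a"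
proof -
  obtain A where A: "orthogonal_matrix A" "A *v axis k 1 = a"
    using orthogonal_matrix_exists_basis[OF assms] by blast
  have "orthogonal_transformation (\<lambda>v. A *v v)"
    using A(1) by (simp add: orthogonal_transformation_matrix)
  then have "(A *v axis i 1) \<bullet> (A *v axis j 1) = of_bool (i = j)" for i j
    unfolding orthogonal_transformation_def by (simp add: axis_orthonormal)
  with A(2) show ?thesis using that[of "\<lambda>i. A *v axis i 1"] by blast
qed

lemma adapted_frame_exists:
  fixes u :: "real^'n \<Rightarrow> real"
  assumes "grad u x \<noteq> 0"
  obtains e where "adapted_frame u x k e"
proof -
  have "norm (sgn (grad u x)) = 1" using assms by (simp add: norm_sgn)
  then obtain e :: "'n \<Rightarrow> real^'n" where "\<And>i j. e i \<bullet> e j = of_bool (i = j)" "e k = sgn (grad u x)"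
    using orthonormal_frame_exists[of "sgn (grad u x)" k] by blast
  then show ?thesis using that[of e] by (simp add: adapted_frame_def)
qed

lemma dderiv_eq_grad_inner:
  assumes "u differentiable (at x)"
  shows "dderiv u x v = grad u x \<bullet> v"
proof -
  note l = linear_dderiv[OF assms]
  have "dderiv u x v = dderiv u x (\<Sum>b\<in>Basis. (v \<bullet> b) *\<^sub>R b)" by (simp add: euclidean_representation)
  also have "\<dots> = (\<Sum>b\<in>Basis. dderiv u x b * (b \<bullet> v))"
    by (simp add: linear_sum[OF l] linear_cmul[OF l] inner_commute mult.commute)
  also have "\<dots> = grad u x \<bullet> v" unfolding grad_def by (simp add: inner_sum_left)
  finally show ?thesis .
qed

lemma adapted_frame_dderiv:
  assumes "adapted_frame u x k e" "u differentiable (at x)"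
  shows "dderiv u x (e i) = (if i = k then norm (grad u x) else 0)"
proof -
  have "grad u x = norm (grad u x) *\<^sub>R e k"
    using assms(1) unfolding adapted_frame_def by (cases "grad u x = 0") (auto simp: sgn_div_norm)
  then have "dderiv u x (e i) = norm (grad u x) * (e k \<bullet> e i)"
    unfolding dderiv_eq_grad_inner[OF assms(2)] by (metis inner_scaleR_left)
  moreover have "e k \<bullet> e i = of_bool (k = i)" using assms(1) unfolding adapted_frame_def by blast
  ultimately show ?thesis by auto
qed

text \<open>The graph speed with both projections \<open>\<delta>\<^sub>i\<^sub>k - f\<^sub>i f\<^sub>k / q\<close> multiplied out; in this form it
  is invariant under a change of the orthonormal frame.\<close>

definition frame_speed :: "('n::finite \<Rightarrow> real) \<Rightarrow> ('n \<Rightarrow> 'n \<Rightarrow> real) \<Rightarrow> real"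
  where "frame_speed p F =
    (((\<Sum>i\<in>UNIV. F i i)\<^sup>2 - (\<Sum>i\<in>UNIV. \<Sum>j\<in>UNIV. (F i j)\<^sup>2)) / 2 -
      ((\<Sum>i\<in>UNIV. F i i) * (\<Sum>i\<in>UNIV. \<Sum>j\<in>UNIV. F i j * p i * p j) - (\<Sum>i\<in>UNIV. (\<Sum>j\<in>UNIV. F i j * p j)\<^sup>2))
        / (1 + (\<Sum>i\<in>UNIV. (p i)\<^sup>2))) / sqrt (1 + (\<Sum>i\<in>UNIV. (p i)\<^sup>2))"

text \<open>With \<open>hF\<close> the projected Hessian the fourfold sum is (tr hF)^2 - tr (hF^2).
  As \<open>hF\<close> differs from \<open>F\<close> by the rank one matrix p c^T / q with c = F p,
  both squares produce S^2 / q^2, and these terms cancel.\<close>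

lemma projected_sum_identity:
  fixes p :: "'n::finite \<Rightarrow> real"
  assumes sym: "\<And>i j. F i j = F j i" and h: "\<And>i k. h i k = of_bool (i = k) - p i * p k / q"
  shows "(\<Sum>i\<in>UNIV. \<Sum>j\<in>UNIV. \<Sum>k\<in>UNIV. \<Sum>l\<in>UNIV. h i k * h j l * (F k i * F l j - F k j * F l i)) =
    (\<Sum>i\<in>UNIV. F i i)\<^sup>2 - (\<Sum>i\<in>UNIV. \<Sum>j\<in>UNIV. (F i j)\<^sup>2)
    - 2 * ((\<Sum>i\<in>UNIV. F i i) * (\<Sum>i\<in>UNIV. \<Sum>j\<in>UNIV. F i j * p i * p j) - (\<Sum>i\<in>UNIV. (\<Sum>j\<in>UNIV. F i j * p j)\<^sup>2)) / q"
proof -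
  define c where "c i = (\<Sum>j\<in>UNIV. F i j * p j)" for i
  define S where "S = (\<Sum>i\<in>UNIV. p i * c i)"
  define t where "t = (\<Sum>i\<in>UNIV. F i i)"
  define hF where "hF i j = (\<Sum>k\<in>UNIV. h i k * F k j)" for i j
  have hF: "hF i j = F i j - p i * c j / q" for i j
  proof -
    have "hF i j = (\<Sum>k\<in>UNIV. (if k = i then F k j else 0)) - (\<Sum>k\<in>UNIV. p i / q * (F j k * p k))"
      unfolding hF_def sum_subtractf[symmetric]
      by (intro sum.cong) (auto simp: h sym[of _ j] algebra_simps)
    also have "(\<Sum>k\<in>UNIV. p i / q * (F j k * p k)) = p i / q * c j"
      unfolding c_def by (rule sum_distrib_left[symmetric])
    finally show ?thesis by simp
  qed
  have tr: "(\<Sum>i\<in>UNIV. hF i i) = t - S / q"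
    unfolding hF t_def S_def sum_divide_distrib sum_subtractf ..
  have FS: "(\<Sum>i\<in>UNIV. \<Sum>j\<in>UNIV. F i j * p i * p j) = S"
    unfolding S_def c_def sum_distrib_left by (simp add: mult_ac)
  have "(\<Sum>i\<in>UNIV. \<Sum>j\<in>UNIV. \<Sum>k\<in>UNIV. \<Sum>l\<in>UNIV. h i k * h j l * (F k i * F l j - F k j * F l i)) =
    (\<Sum>i\<in>UNIV. \<Sum>j\<in>UNIV. hF i i * hF j j - hF i j * hF j i)"
    unfolding hF_def sum_product sum_subtractf[symmetric]
    by (intro sum.cong refl) (simp only: right_diff_distrib mult_ac)
  also have "\<dots> = (\<Sum>i\<in>UNIV. hF i i)\<^sup>2 - (\<Sum>i\<in>UNIV. \<Sum>j\<in>UNIV. hF i j * hF j i)"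
    unfolding power2_eq_square sum_product sum_subtractf ..
  also have "(\<Sum>i\<in>UNIV. \<Sum>j\<in>UNIV. hF i j * hF j i) =
    (\<Sum>i\<in>UNIV. \<Sum>j\<in>UNIV. (F i j)\<^sup>2 - c i * (F i j * p j) / q - c j * (F j i * p i) / q + (p i * c i) * (p j * c j) / q\<^sup>2)"
  proof (intro sum.cong refl)
    fix i j
    have s: "F j i = F i j" by (rule sym)
    show "hF i j * hF j i =
      (F i j)\<^sup>2 - c i * (F i j * p j) / q - c j * (F j i * p i) / q + (p i * c i) * (p j * c j) / q\<^sup>2"
      unfolding hF s by (simp add: divide_inverse algebra_simps power2_eq_square)
  qed
  also have "\<dots> = (\<Sum>i\<in>UNIV. \<Sum>j\<in>UNIV. (F i j)\<^sup>2) - (\<Sum>i\<in>UNIV. (c i)\<^sup>2) / q - (\<Sum>i\<in>UNIV. (c i)\<^sup>2) / q + S\<^sup>2 / q\<^sup>2"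
  proof -
    have 1: "(\<Sum>i\<in>UNIV. \<Sum>j\<in>UNIV. c i * (F i j * p j) / q) = (\<Sum>i\<in>UNIV. (c i)\<^sup>2) / q"
      unfolding sum_divide_distrib[symmetric] sum_distrib_left[symmetric] c_def[symmetric] power2_eq_square ..
    have 2: "(\<Sum>i\<in>UNIV. \<Sum>j\<in>UNIV. c j * (F j i * p i) / q) = (\<Sum>i\<in>UNIV. (c i)\<^sup>2) / q"
      using 1 by (subst sum.swap)
    have 3: "(\<Sum>i\<in>UNIV. \<Sum>j\<in>UNIV. (p i * c i) * (p j * c j) / q\<^sup>2) = S\<^sup>2 / q\<^sup>2"
      unfolding S_def power2_eq_square[of "\<Sum>i\<in>UNIV. p i * c i"] sum_product by (simp only: sum_divide_distrib)
    show ?thesis by (simp add: sum.distrib sum_subtractf 1 2 3)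
  qed
  also have "(\<Sum>i\<in>UNIV. hF i i)\<^sup>2 - \<dots> = t\<^sup>2 - (\<Sum>i\<in>UNIV. \<Sum>j\<in>UNIV. (F i j)\<^sup>2) - 2 * (t * S - (\<Sum>i\<in>UNIV. (c i)\<^sup>2)) / q"
    unfolding tr by (simp add: divide_inverse algebra_simps power2_eq_square)
  finally show ?thesis unfolding FS t_def c_def .
qed

lemma norm_grad_sum:
  fixes u :: "real^'n \<Rightarrow> real"
  assumes "u differentiable (at x)"
  shows "(norm (grad u x))\<^sup>2 = (\<Sum>i\<in>UNIV. (dderiv u x (axis i 1))\<^sup>2)"
proof -
  have "(norm (grad u x))\<^sup>2 = (\<Sum>i\<in>UNIV. (grad u x $ i)\<^sup>2)"
    unfolding power2_norm_eq_inner by (simp add: inner_vec_def power2_eq_square)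
  then show ?thesis by (simp add: dderiv_eq_grad_inner[OF assms] inner_axis)
qed

lemma graph_speed_axis:
  fixes u :: "real^'n \<Rightarrow> real"
  assumes tw: "twice_diff_on u V" and x: "x \<in> V"
  shows "graph_speed u x = frame_speed (\<lambda>i. dderiv u x (axis i 1)) (\<lambda>i j. dderiv2 u x (axis i 1) (axis j 1))"
proof -
  define q where "q = 1 + (\<Sum>i\<in>UNIV. (dderiv u x (axis i 1))\<^sup>2)"
  have "q > 0" unfolding q_def by (intro add_pos_nonneg sum_nonneg) auto
  note s4 = projected_sum_identity[of "\<lambda>i j. dderiv2 u x (axis i 1) (axis j 1)", OF dderiv2_commute[OF tw x] refl,
     of "\<lambda>i. dderiv u x (axis i 1)" q]
  show ?thesis
    unfolding graph_speed_def Let_def norm_grad_sum[OF twice_diff_onD(3)[OF tw x]] q_def[symmetric] s4 frame_speed_def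
    using \<open>q > 0\<close> by (simp add: field_simps)
qed

text \<open>Every sum in \<open>frame_speed\<close> is either a trace or collapses to an evaluation
  of \<open>B\<close> at \<open>p\<close>; the gradient enters through its components
  \<open>p \<bullet> e i\<close>.\<close>

lemma frame_speed_frame_invariant:
  fixes e :: "'n::finite \<Rightarrow> real^'n" and B :: "real^'n \<Rightarrow> real^'n \<Rightarrow> real"
  assumes e: "\<And>i j. e i \<bullet> e j = of_bool (i = j)" and B: "bilinear B"
  shows "frame_speed (\<lambda>i. p \<bullet> e i) (\<lambda>i j. B (e i) (e j)) =
    frame_speed (\<lambda>i. p \<bullet> axis i 1) (\<lambda>i j. B (axis i 1) (axis j 1))"
proof -
  have l: "linear (B v)" "linear (\<lambda>v. B v w)" for v w using B unfolding bilinear_def by auto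
  \<comment> \<open>The squared norm of the Hessian is a trace in each index separately, so one
    index at a time is moved to the standard basis.\<close>
  have a1: "bilinear (\<lambda>v w. B z v * B z w)" "bilinear (\<lambda>v w. B v z * B w z)" for z
    unfolding bilinear_def
    by (auto intro!: linearI simp: linear_add[OF l(1)] linear_add[OF l(2)] linear_cmul[OF l(1)] linear_cmul[OF l(2)] algebra_simps)
  have a2: "bilinear (\<lambda>v w. (p \<bullet> v) * (p \<bullet> w))"
    unfolding bilinear_def by (auto intro!: linearI simp: algebra_simps)
  have ex: "(\<Sum>j\<in>UNIV. B v (f j) * (w \<bullet> f j)) = B v w" "(\<Sum>j\<in>UNIV. B (f j) v * (w \<bullet> f j)) = B w v"
    if "\<And>i j. f i \<bullet> f j = of_bool (i = j)" for v w and f :: "'n \<Rightarrow> real^'n"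
    using arg_cong[OF orthonormal_expansion[of f w, OF that], of "\<lambda>z. B v z"]
      arg_cong[OF orthonormal_expansion[of f w, OF that], of "\<lambda>z. B z v"]
    by (simp_all add: linear_sum[OF l(1)] linear_cmul[OF l(1)] linear_sum[OF l(2)] linear_cmul[OF l(2)] mult.commute)
  have q: "(\<Sum>i\<in>UNIV. \<Sum>j\<in>UNIV. B (f i) (f j) * (p \<bullet> f i) * (p \<bullet> f j)) = B p p"
    if f: "\<And>i j. f i \<bullet> f j = of_bool (i = j)" for f :: "'n \<Rightarrow> real^'n"
  proof -
    have "(\<Sum>j\<in>UNIV. B (f i) (f j) * (p \<bullet> f i) * (p \<bullet> f j)) = B (f i) p * (p \<bullet> f i)" for i
      using arg_cong[OF ex(1)[OF f, of "f i" p], of "\<lambda>z. z * (p \<bullet> f i)"]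
      unfolding sum_distrib_right by (simp add: mult_ac)
    then show ?thesis by (simp add: ex(2)[OF f])
  qed
  have "(\<Sum>i\<in>UNIV. \<Sum>j\<in>UNIV. (B (e i) (e j))\<^sup>2) = (\<Sum>i\<in>UNIV. \<Sum>j\<in>UNIV. (B (e i) (axis j 1))\<^sup>2)"
    using bilinear_trace_frame[OF e a1(1)] by (simp add: power2_eq_square)
  also have "\<dots> = (\<Sum>j\<in>UNIV. \<Sum>i\<in>UNIV. (B (e i) (axis j 1))\<^sup>2)" by (rule sum.swap)
  also have "\<dots> = (\<Sum>j\<in>UNIV. \<Sum>i\<in>UNIV. (B (axis i 1) (axis j 1))\<^sup>2)"
    using bilinear_trace_frame[OF e a1(2)] by (simp add: power2_eq_square)
  also have "\<dots> = (\<Sum>i\<in>UNIV. \<Sum>j\<in>UNIV. (B (axis i 1) (axis j 1))\<^sup>2)" by (rule sum.swap)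
  finally have 1: "(\<Sum>i\<in>UNIV. \<Sum>j\<in>UNIV. (B (e i) (e j))\<^sup>2) = (\<Sum>i\<in>UNIV. \<Sum>j\<in>UNIV. (B (axis i 1) (axis j 1))\<^sup>2)" .
  have 2: "(\<Sum>i\<in>UNIV. (p \<bullet> e i)\<^sup>2) = (\<Sum>i\<in>UNIV. (p \<bullet> axis i 1)\<^sup>2)"
    using bilinear_trace_frame[OF e a2] by (simp add: power2_eq_square)
  have 3: "(\<Sum>i\<in>UNIV. (B (e i) p)\<^sup>2) = (\<Sum>i\<in>UNIV. (B (axis i 1) p)\<^sup>2)"
    using bilinear_trace_frame[OF e a1(2)] by (simp add: power2_eq_square)
  show ?thesis
    unfolding frame_speed_def q[OF e] q[OF axis_orthonormal] ex(1)[OF e] ex(1)[OF axis_orthonormal] 1 2 3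
      bilinear_trace_frame[OF e B] by simp
qed

lemma bilinear_dderiv2: "twice_diff_on u V \<Longrightarrow> x \<in> V \<Longrightarrow> bilinear (dderiv2 u x)"
  unfolding bilinear_def using linear_dderiv2 by blast

lemma graph_speed_frame:
  fixes u :: "real^'n \<Rightarrow> real" and e :: "'n \<Rightarrow> real^'n"
  assumes tw: "twice_diff_on u V" and x: "x \<in> V" and e: "\<And>i j. e i \<bullet> e j = of_bool (i = j)"
  shows "graph_speed u x = frame_speed (\<lambda>i. dderiv u x (e i)) (\<lambda>i j. dderiv2 u x (e i) (e j))"
  using graph_speed_axis[OF tw x] frame_speed_frame_invariant[OF e bilinear_dderiv2[OF tw x], of "grad u x"]
  by (simp add: dderiv_eq_grad_inner[OF twice_diff_onD(3)[OF tw x]])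

lemma sum_delta_mult:
  fixes F :: "'n::finite \<Rightarrow> real"
  shows "(\<Sum>j\<in>UNIV. F j * (if j = k then P else 0)) = F k * P"
  by (simp add: if_distrib[of "(*) _"] cong: if_cong)

lemma sum_delta_square:
  fixes P :: real and k :: "'n::finite"
  shows "(\<Sum>i\<in>UNIV. (if i = k then P else 0)\<^sup>2) = P\<^sup>2"
  using sum_delta_mult[of "\<lambda>i. if i = k then P else 0" k P] by (simp add: power2_eq_square)

lemma sum_delta_quadratic:
  fixes F :: "'n::finite \<Rightarrow> 'n \<Rightarrow> real"
  shows "(\<Sum>i\<in>UNIV. \<Sum>j\<in>UNIV. F i j * (if i = k then P else 0) * (if j = k then P else 0)) = F k k * P\<^sup>2"
proof -
  have "(\<Sum>j\<in>UNIV. F i j * (if i = k then P else 0) * (if j = k then P else 0)) =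
      F i k * P * (if i = k then P else 0)" for i
    using sum_delta_mult[of "\<lambda>j. F i j * (if i = k then P else 0)" k P] by simp
  then have "(\<Sum>i\<in>UNIV. \<Sum>j\<in>UNIV. F i j * (if i = k then P else 0) * (if j = k then P else 0)) =
      (\<Sum>i\<in>UNIV. F i k * P * (if i = k then P else 0))" by (rule sum.cong[OF refl])
  also have "\<dots> = F k k * P * P" by (rule sum_delta_mult)
  finally show ?thesis by (simp add: power2_eq_square)
qed

text \<open>\<open>(T\<^sup>2 - R2) / 2\<close> is the second elementary symmetric function of the
  tangential block, and \<open>F k k * T - c2\<close> is the sum of the 2 x 2 minors that contain
  the normal index. Only the latter feel the projection, through the factor 1 / q.\<close>

lemma frame_speed_adapted:
  fixes F :: "'n::finite \<Rightarrow> 'n \<Rightarrow> real" and k :: 'n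
  assumes sym: "\<And>i j. F i j = F j i"
  defines "T \<equiv> (\<Sum>i\<in>UNIV-{k}. F i i)" and "c2 \<equiv> (\<Sum>i\<in>UNIV-{k}. (F i k)\<^sup>2)"
    and "R2 \<equiv> (\<Sum>i\<in>UNIV-{k}. \<Sum>j\<in>UNIV-{k}. (F i j)\<^sup>2)"
  shows "frame_speed (\<lambda>i. if i = k then P else 0) F =
      ((T\<^sup>2 - R2) / 2 + (F k k * T - c2) / (1 + P\<^sup>2)) / sqrt (1 + P\<^sup>2)"
proof -
  have split: "(\<Sum>i\<in>UNIV. a i) = a k + (\<Sum>i\<in>UNIV-{k}. a i)" for a :: "'n \<Rightarrow> real"
    by (rule sum.remove) auto
  have t: "(\<Sum>i\<in>UNIV. F i i) = F k k + T" unfolding T_def by (rule split)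
  have c: "(\<Sum>i\<in>UNIV. (F i k)\<^sup>2) = (F k k)\<^sup>2 + c2" unfolding c2_def by (rule split)
  have n: "(\<Sum>i\<in>UNIV. \<Sum>j\<in>UNIV. (F i j)\<^sup>2) = (F k k)\<^sup>2 + 2 * c2 + R2"
  proof -
    have k: "(\<Sum>j\<in>UNIV. (F k j)\<^sup>2) = (F k k)\<^sup>2 + c2"
      unfolding c[symmetric] by (intro sum.cong refl arg_cong[where f = "\<lambda>z. z\<^sup>2"] sym)
    have "(\<Sum>i\<in>UNIV. \<Sum>j\<in>UNIV. (F i j)\<^sup>2) =
        (\<Sum>j\<in>UNIV. (F k j)\<^sup>2) + (\<Sum>i\<in>UNIV-{k}. \<Sum>j\<in>UNIV. (F i j)\<^sup>2)"
      by (rule split)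
    also have "(\<Sum>i\<in>UNIV-{k}. \<Sum>j\<in>UNIV. (F i j)\<^sup>2) =
        (\<Sum>i\<in>UNIV-{k}. (F i k)\<^sup>2 + (\<Sum>j\<in>UNIV-{k}. (F i j)\<^sup>2))"
      by (intro sum.cong refl split)
    also have "\<dots> = c2 + R2" unfolding c2_def R2_def by (rule sum.distrib)
    finally show ?thesis unfolding k by simp
  qed
  have Fp: "(\<Sum>i\<in>UNIV. (\<Sum>j\<in>UNIV. F i j * (if j = k then P else 0))\<^sup>2) = P\<^sup>2 * ((F k k)\<^sup>2 + c2)"
    unfolding sum_delta_mult c[symmetric] sum_distrib_left by (simp add: power_mult_distrib mult.commute)
  define q where "q = 1 + P\<^sup>2"
  have q: "q > 0" and P2: "P\<^sup>2 = q - 1" unfolding q_def by (auto intro: add_pos_nonneg)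
  define X where "X = F k k * T - c2"
  have A: "((F k k + T)\<^sup>2 - ((F k k)\<^sup>2 + 2 * c2 + R2)) / 2 = (T\<^sup>2 - R2) / 2 + X"
    unfolding X_def by (simp add: field_simps power2_eq_square)
  have N: "(F k k + T) * (F k k * P\<^sup>2) - P\<^sup>2 * ((F k k)\<^sup>2 + c2) = (q - 1) * X"
    unfolding X_def P2 by (simp add: algebra_simps power2_eq_square)
  have "X - (q - 1) * X / q = X / q" using q by (simp add: field_simps)
  then show ?thesis
    unfolding frame_speed_def t n sum_delta_square sum_delta_quadratic Fp q_def[symmetric] A N X_def[symmetric]
    by (simp add: add_diff_eq[symmetric])
qed

section \<open>Linearisation of the graph speed\<close>

text \<open>The speed is V / sqrt q with V = M - N / q, where \<open>dM\<close>, \<open>dN\<close>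
  and \<open>dq\<close> are the derivatives of the three parts. The summand containing the speed
  itself comes from differentiating 1 / sqrt q.\<close>

lemma frame_speed_has_derivative:
  fixes p :: "real \<Rightarrow> 'n::finite \<Rightarrow> real"
  assumes p: "\<And>i. ((\<lambda>s. p s i) has_real_derivative \<pi> i) (at t)"
    and F: "\<And>i j. ((\<lambda>s. F s i j) has_real_derivative \<Phi> i j) (at t)"
    and q: "q = 1 + (\<Sum>i\<in>UNIV. (p t i)\<^sup>2)"
    and tr: "tr = (\<Sum>i\<in>UNIV. F t i i)"
    and N: "N = tr * (\<Sum>i\<in>UNIV. \<Sum>j\<in>UNIV. F t i j * p t i * p t j) - (\<Sum>i\<in>UNIV. (\<Sum>j\<in>UNIV. F t i j * p t j)\<^sup>2)"
    and dq: "dq = 2 * (\<Sum>i\<in>UNIV. p t i * \<pi> i)"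
    and dM: "dM = tr * (\<Sum>i\<in>UNIV. \<Phi> i i) - (\<Sum>i\<in>UNIV. \<Sum>j\<in>UNIV. F t i j * \<Phi> i j)"
    and dN: "dN = (\<Sum>i\<in>UNIV. \<Phi> i i) * (\<Sum>i\<in>UNIV. \<Sum>j\<in>UNIV. F t i j * p t i * p t j)
      + tr * (\<Sum>i\<in>UNIV. \<Sum>j\<in>UNIV. \<Phi> i j * p t i * p t j + F t i j * \<pi> i * p t j + F t i j * p t i * \<pi> j)
      - 2 * (\<Sum>i\<in>UNIV. (\<Sum>j\<in>UNIV. F t i j * p t j) * (\<Sum>j\<in>UNIV. \<Phi> i j * p t j + F t i j * \<pi> j))"
  shows "((\<lambda>s. frame_speed (p s) (F s)) has_real_derivative
    (dM - dN / q + N * dq / q\<^sup>2) / sqrt q - frame_speed (p t) (F t) * dq / (2 * q)) (at t)"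
proof -
  define Q where "Q s = 1 + (\<Sum>i\<in>UNIV. (p s i)\<^sup>2)" for s
  define tt where "tt s = (\<Sum>i\<in>UNIV. F s i i)" for s
  define sq where "sq s = (\<Sum>i\<in>UNIV. \<Sum>j\<in>UNIV. (F s i j)\<^sup>2)" for s
  define Fpp where "Fpp s = (\<Sum>i\<in>UNIV. \<Sum>j\<in>UNIV. F s i j * p s i * p s j)" for s
  define Fp where "Fp s i = (\<Sum>j\<in>UNIV. F s i j * p s j)" for s i
  define dFp where "dFp i = (\<Sum>j\<in>UNIV. \<Phi> i j * p t j + F t i j * \<pi> j)" for i
  have Qt: "Q t = q" unfolding Q_def q ..
  have q0: "q > 0" unfolding q by (intro add_pos_nonneg sum_nonneg) auto
  have dQ: "(Q has_real_derivative dq) (at t)"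
    unfolding Q_def dq by (auto intro!: derivative_eq_intros p sum.cong simp: sum_distrib_left)
  have dtt: "(tt has_real_derivative (\<Sum>i\<in>UNIV. \<Phi> i i)) (at t)"
    unfolding tt_def by (intro DERIV_sum F)
  have dsq: "(sq has_real_derivative 2 * (\<Sum>i\<in>UNIV. \<Sum>j\<in>UNIV. F t i j * \<Phi> i j)) (at t)"
    unfolding sq_def by (auto intro!: derivative_eq_intros F sum.cong simp: sum_distrib_left)
  have dFpp: "(Fpp has_real_derivative
      (\<Sum>i\<in>UNIV. \<Sum>j\<in>UNIV. \<Phi> i j * p t i * p t j + F t i j * \<pi> i * p t j + F t i j * p t i * \<pi> j)) (at t)"
    unfolding Fpp_def by (auto intro!: derivative_eq_intros F p sum.cong simp: algebra_simps)
  have dFp1: "((\<lambda>s. Fp s i) has_real_derivative dFp i) (at t)" for i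
    unfolding Fp_def dFp_def by (auto intro!: derivative_eq_intros F p sum.cong simp: algebra_simps)
  have dFp2: "((\<lambda>s. \<Sum>i\<in>UNIV. (Fp s i)\<^sup>2) has_real_derivative 2 * (\<Sum>i\<in>UNIV. Fp t i * dFp i)) (at t)"
    by (auto intro!: derivative_eq_intros dFp1 sum.cong simp: sum_distrib_left)
  define NN where "NN s = tt s * Fpp s - (\<Sum>i\<in>UNIV. (Fp s i)\<^sup>2)" for s
  have NNt: "NN t = N" unfolding NN_def N tr tt_def Fpp_def Fp_def ..
  have dNN: "(NN has_real_derivative dN) (at t)"
    unfolding NN_def dN tr tt_def[symmetric] Fpp_def[symmetric] Fp_def[symmetric] dFp_def[symmetric]
    by (rule derivative_eq_intros dtt dFpp dFp2 refl)+ (simp add: algebra_simps)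
  define MM where "MM s = ((tt s)\<^sup>2 - sq s) / 2" for s
  have dMM: "(MM has_real_derivative dM) (at t)"
    unfolding MM_def dM tr tt_def[symmetric]
    by (rule DERIV_cong[OF DERIV_cdivide[OF DERIV_diff[OF DERIV_power[OF dtt, of 2] dsq], of 2]])
       (simp add: field_simps)
  define V where "V s = MM s - NN s / Q s" for s
  have fs: "frame_speed (p s) (F s) = V s / sqrt (Q s)" for s
    unfolding frame_speed_def V_def MM_def NN_def tt_def sq_def Fpp_def Fp_def Q_def by (rule refl)
  have dV: "(V has_real_derivative (dM - dN / q + N * dq / q\<^sup>2)) (at t)"
    unfolding V_def
    by (rule DERIV_cong[OF DERIV_diff[OF dMM DERIV_divide[OF dNN dQ]]])
       (use q0 in \<open>simp_all add: Qt NNt diff_divide_distrib power2_eq_square\<close>)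
  have dS: "((\<lambda>s. sqrt (Q s)) has_real_derivative dq / (2 * sqrt q)) (at t)"
    using DERIV_chain2[OF DERIV_real_sqrt dQ] Qt q0 by (simp add: field_simps)
  have "((\<lambda>s. V s / sqrt (Q s)) has_real_derivative
      ((dM - dN / q + N * dq / q\<^sup>2) * sqrt q - V t * (dq / (2 * sqrt q))) / (sqrt q * sqrt q)) (at t)"
    using DERIV_divide[OF dV dS] Qt q0 by simp
  moreover have "((dM - dN / q + N * dq / q\<^sup>2) * sqrt q - V t * (dq / (2 * sqrt q))) / (sqrt q * sqrt q)
     = (dM - dN / q + N * dq / q\<^sup>2) / sqrt q - V t / sqrt q * dq / (2 * q)"
  proof -
    have "(A * s - v * (dq / (2 * s))) / (s * s) = A / s - v / s * dq / (2 * (s * s))" if "s > 0" for A s v :: real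
      using that by (simp add: field_simps)
    from this[of "sqrt q"] show ?thesis using q0 by simp
  qed
  ultimately show ?thesis unfolding fs Qt by simp
qed

text \<open>The derivative of \<^const>\<open>frame_speed\<close> in the direction \<open>\<Phi>\<close> of the Hessian, at the gradient
  \<open>P e\<^sub>k\<close>.\<close>

definition speed_lin :: "real \<Rightarrow> 'n::finite \<Rightarrow> ('n \<Rightarrow> 'n \<Rightarrow> real) \<Rightarrow> ('n \<Rightarrow> 'n \<Rightarrow> real) \<Rightarrow> real"
  where "speed_lin P k F \<Phi> =
    ((\<Sum>i\<in>UNIV. F i i) * (\<Sum>i\<in>UNIV. \<Phi> i i) - (\<Sum>i\<in>UNIV. \<Sum>j\<in>UNIV. F i j * \<Phi> i j)
     - P\<^sup>2 / (1 + P\<^sup>2) * ((\<Sum>i\<in>UNIV. \<Phi> i i) * F k k + (\<Sum>i\<in>UNIV. F i i) * \<Phi> k k - 2 * (\<Sum>i\<in>UNIV. F i k * \<Phi> i k)))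
    / sqrt (1 + P\<^sup>2)"

lemma speed_lin_add: "speed_lin P k F (\<lambda>i j. a * \<Phi> i j + b * \<Psi> i j) = a * speed_lin P k F \<Phi> + b * speed_lin P k F \<Psi>"
proof -
  have s: "(\<Sum>i\<in>UNIV. a * \<Phi> i i + b * \<Psi> i i) = a * (\<Sum>i\<in>UNIV. \<Phi> i i) + b * (\<Sum>i\<in>UNIV. \<Psi> i i)"
    "(\<Sum>i\<in>UNIV. \<Sum>j\<in>UNIV. F i j * (a * \<Phi> i j + b * \<Psi> i j)) =
       a * (\<Sum>i\<in>UNIV. \<Sum>j\<in>UNIV. F i j * \<Phi> i j) + b * (\<Sum>i\<in>UNIV. \<Sum>j\<in>UNIV. F i j * \<Psi> i j)"
    "(\<Sum>i\<in>UNIV. F i k * (a * \<Phi> i k + b * \<Psi> i k)) = a * (\<Sum>i\<in>UNIV. F i k * \<Phi> i k) + b * (\<Sum>i\<in>UNIV. F i k * \<Psi> i k)"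
    by (simp_all only: sum_distrib_left sum.distrib[symmetric]) (auto intro!: sum.cong simp: algebra_simps)
  show ?thesis unfolding speed_lin_def s by (simp add: divide_inverse algebra_simps)
qed

text \<open>This is ellipticity of the linearisation at a convex function. With the weights
  \<open>r\<close> the operator is tr_r F tr_r \<Theta> minus a weighted product of \<open>F\<close>
  and \<Theta>. The 2 x 2 minor inequalities bound that product by (sum a_i b_i)^2, and the
  Cauchy-Schwarz inequality bounds this by the product of the traces.\<close>

lemma speed_lin_nonneg:
  fixes F \<Theta> :: "'n::finite \<Rightarrow> 'n \<Rightarrow> real"
  assumes symF: "\<And>i j. F i j = F j i" and symT: "\<And>i j. \<Theta> i j = \<Theta> j i"
    and F0: "\<And>i. F i i \<ge> 0" and F1: "\<And>i j. (F i j)\<^sup>2 \<le> F i i * F j j"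
    and T0: "\<And>i. \<Theta> i i \<ge> 0" and T1: "\<And>i j. (\<Theta> i j)\<^sup>2 \<le> \<Theta> i i * \<Theta> j j"
  shows "speed_lin P k F \<Theta> \<ge> 0"
proof -
  define q where "q = 1 + P\<^sup>2"
  have q: "q > 0" unfolding q_def by (intro add_pos_nonneg) auto
  \<comment> \<open>These are the diagonal entries of the inverse induced metric in the adapted
    frame: 1 - P^2 / q = 1 / q in the normal direction, 1 in the others.\<close>
  define r where "r i = (if i = k then 1 / q else 1)" for i
  have r: "r i > 0" for i unfolding r_def using q by simp
  define a where "a i = sqrt (r i * F i i)" for i
  define b where "b i = sqrt (r i * \<Theta> i i)" for i
  have ab: "0 \<le> a i" "0 \<le> b i" "(a i)\<^sup>2 = r i * F i i" "(b i)\<^sup>2 = r i * \<Theta> i i" for i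
    unfolding a_def b_def using r[of i] F0[of i] T0[of i] by auto
  have le: "r i * r j * (F i j * \<Theta> i j) \<le> (a i * b i) * (a j * b j)" for i j
  proof (rule power2_le_imp_le)
    show "0 \<le> (a i * b i) * (a j * b j)" using ab by (intro mult_nonneg_nonneg)
    have "(F i j)\<^sup>2 * (\<Theta> i j)\<^sup>2 \<le> (F i i * F j j) * (\<Theta> i i * \<Theta> j j)"
      using F1 T1 F0 T0 by (intro mult_mono) auto
    then have "(r i * r j)\<^sup>2 * ((F i j)\<^sup>2 * (\<Theta> i j)\<^sup>2) \<le> (r i * r j)\<^sup>2 * ((F i i * F j j) * (\<Theta> i i * \<Theta> j j))"
      by (intro mult_left_mono) auto
    then show "(r i * r j * (F i j * \<Theta> i j))\<^sup>2 \<le> ((a i * b i) * (a j * b j))\<^sup>2"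
      unfolding power_mult_distrib ab by (simp add: mult_ac power2_eq_square)
  qed
  have "(\<Sum>i\<in>UNIV. \<Sum>j\<in>UNIV. r i * r j * (F i j * \<Theta> i j)) \<le> (\<Sum>i\<in>UNIV. \<Sum>j\<in>UNIV. (a i * b i) * (a j * b j))"
    by (intro sum_mono le)
  also have "\<dots> = (\<Sum>i\<in>UNIV. a i * b i)\<^sup>2" by (simp add: power2_eq_square sum_product)
  also have "\<dots> \<le> (\<Sum>i\<in>UNIV. (a i)\<^sup>2) * (\<Sum>i\<in>UNIV. (b i)\<^sup>2)" by (rule Cauchy_Schwarz_ineq_sum)
  finally have main: "(\<Sum>i\<in>UNIV. \<Sum>j\<in>UNIV. r i * r j * (F i j * \<Theta> i j))
      \<le> (\<Sum>i\<in>UNIV. r i * F i i) * (\<Sum>i\<in>UNIV. r i * \<Theta> i i)" unfolding ab .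
  define c where "c = P\<^sup>2 / q"
  have rc: "r i = 1 - (if i = k then c else 0)" for i
    unfolding r_def c_def q_def using q unfolding q_def by (simp add: field_simps)
  have d1: "(\<Sum>i\<in>UNIV. r i * X i) = (\<Sum>i\<in>UNIV. X i) - c * X k" for X :: "'n \<Rightarrow> real"
    unfolding rc using sum_delta_mult[of X k c] by (simp add: algebra_simps sum_subtractf)
  have "(\<Sum>i\<in>UNIV. \<Sum>j\<in>UNIV. r i * r j * (F i j * \<Theta> i j)) = (\<Sum>i\<in>UNIV. r i * (\<Sum>j\<in>UNIV. r j * (F i j * \<Theta> i j)))"
    by (simp add: sum_distrib_left mult.assoc)
  also have "\<dots> = (\<Sum>i\<in>UNIV. \<Sum>j\<in>UNIV. F i j * \<Theta> i j) - c * (\<Sum>i\<in>UNIV. F i k * \<Theta> i k)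
      - c * ((\<Sum>i\<in>UNIV. F i k * \<Theta> i k) - c * (F k k * \<Theta> k k))"
  proof -
    have "(\<Sum>j\<in>UNIV. F k j * \<Theta> k j) = (\<Sum>i\<in>UNIV. F i k * \<Theta> i k)"
      by (intro sum.cong refl) (metis symF symT)
    then show ?thesis unfolding d1 by (simp add: sum_subtractf sum_distrib_left)
  qed
  finally have "0 \<le> (\<Sum>i\<in>UNIV. F i i) * (\<Sum>i\<in>UNIV. \<Theta> i i) - (\<Sum>i\<in>UNIV. \<Sum>j\<in>UNIV. F i j * \<Theta> i j)
     - c * ((\<Sum>i\<in>UNIV. \<Theta> i i) * F k k + (\<Sum>i\<in>UNIV. F i i) * \<Theta> k k - 2 * (\<Sum>i\<in>UNIV. F i k * \<Theta> i k))"
    using main unfolding d1 by (simp add: algebra_simps)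
  then show ?thesis unfolding speed_lin_def q_def[symmetric] c_def[symmetric] using q by simp
qed

text \<open>This is Euler's relation: for a fixed gradient the speed is homogeneous of degree two in
  the Hessian.\<close>

lemma speed_lin_self:
  fixes F :: "'n::finite \<Rightarrow> 'n \<Rightarrow> real"
  assumes sym: "\<And>i j. F i j = F j i"
  shows "speed_lin P k F F = 2 * frame_speed (\<lambda>i. if i = k then P else 0) F"
proof -
  have Fp: "(\<Sum>i\<in>UNIV. (\<Sum>j\<in>UNIV. F i j * (if j = k then P else 0))\<^sup>2) = P\<^sup>2 * (\<Sum>i\<in>UNIV. (F i k)\<^sup>2)"
    unfolding sum_delta_mult sum_distrib_left by (simp add: power_mult_distrib mult.commute)
  define t n Y where "t = (\<Sum>i\<in>UNIV. F i i)" and "n = (\<Sum>i\<in>UNIV. \<Sum>j\<in>UNIV. F i j * F i j)"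
    and "Y = (\<Sum>i\<in>UNIV. F i k * F i k)"
  define q where "q = 1 + P\<^sup>2"
  have "t * t - n - P\<^sup>2 / q * (t * F k k + t * F k k - 2 * Y) =
      2 * ((t * t - n) / 2 - (t * (F k k * P\<^sup>2) - P\<^sup>2 * Y) / q)"
  proof -
    define c where "c = P\<^sup>2 / q"
    have K: "(t * (F k k * P\<^sup>2) - P\<^sup>2 * Y) / q = P\<^sup>2 / q * (t * F k k - Y)"
      unfolding right_diff_distrib by (simp add: diff_divide_distrib)
    show ?thesis unfolding K c_def[symmetric] by (simp add: field_simps)
  qed
  then show ?thesis unfolding speed_lin_def frame_speed_def sum_delta_square sum_delta_quadratic Fp
    power2_eq_square[of "F _ _"] power2_eq_square[of "\<Sum>i\<in>UNIV. F i i"]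
    t_def[symmetric] n_def[symmetric] Y_def[symmetric] q_def[symmetric] by (simp add: power2_eq_square)
qed

text \<open>In the direction Dg Dg^T the entry (k,k) pairs only with the tangential trace, since its
  product with \<open>F k k\<close> cancels. This is the source of the good term |Dg|^2 h.\<close>

lemma speed_lin_rank_one:
  fixes F :: "'n::finite \<Rightarrow> 'n \<Rightarrow> real"
  shows "speed_lin P k F (\<lambda>i j. (if j = k then c else 0) * (if i = k then c else 0)) =
    c\<^sup>2 * (\<Sum>i\<in>UNIV-{k}. F i i) / (1 + P\<^sup>2) / sqrt (1 + P\<^sup>2)"
proof -
  define T where "T = (\<Sum>i\<in>UNIV-{k}. F i i)"
  have t: "(\<Sum>i\<in>UNIV. F i i) = F k k + T" unfolding T_def by (rule sum.remove) auto
  have 1: "(\<Sum>i\<in>UNIV. (if i = k then c else 0) * (if i = k then c else 0)) = c\<^sup>2"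
    unfolding sum_delta_mult by (simp add: power2_eq_square)
  have 2: "(\<Sum>i\<in>UNIV. \<Sum>j\<in>UNIV. F i j * ((if j = k then c else 0) * (if i = k then c else 0))) = F k k * c\<^sup>2"
  proof -
    have "(\<Sum>j\<in>UNIV. F i j * ((if j = k then c else 0) * (if i = k then c else 0))) =
        F i k * c * (if i = k then c else 0)" for i
      using sum_delta_mult[of "\<lambda>j. F i j * (if i = k then c else 0)" k c] by (simp add: mult_ac)
    then show ?thesis unfolding sum_delta_mult by (simp add: sum_delta_mult power2_eq_square)
  qed
  have 3: "(\<Sum>i\<in>UNIV. F i k * ((if k = k then c else 0) * (if i = k then c else 0))) = F k k * c\<^sup>2"
    using sum_delta_mult[of "\<lambda>i. F i k * c" k c] by (simp add: power2_eq_square mult_ac)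
  define q where "q = 1 + P\<^sup>2"
  have q: "q > 0" and P2: "P\<^sup>2 = q - 1" unfolding q_def by (auto intro: add_pos_nonneg)
  show ?thesis unfolding speed_lin_def 1 2 3 t T_def[symmetric] q_def[symmetric] unfolding P2
    using q by (simp add: field_simps power2_eq_square)
qed

text \<open>The gradient moves proportionally to itself, with rate \<mu>. That is the situation at a
  contact point with the barrier, where Du = \<mu> Df, and it reduces all first order terms to
  \<open>N\<close> and the speed.\<close>

lemma frame_speed_has_derivative_adapted:
  fixes p :: "real \<Rightarrow> 'n::finite \<Rightarrow> real"
  assumes p: "\<And>i. ((\<lambda>s. p s i) has_real_derivative \<mu> * p t i) (at t)"
    and F: "\<And>i j. ((\<lambda>s. F s i j) has_real_derivative \<Phi> i j) (at t)"
    and pt: "p t = (\<lambda>i. if i = k then P else 0)"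
    and q: "q = 1 + P\<^sup>2"
    and N: "N = P\<^sup>2 * ((\<Sum>i\<in>UNIV - {k}. F t i i) * F t k k - (\<Sum>i\<in>UNIV - {k}. (F t i k)\<^sup>2))"
  shows "((\<lambda>s. frame_speed (p s) (F s)) has_real_derivative
    speed_lin P k (F t) \<Phi> - \<mu> * (2 * N / (q\<^sup>2 * sqrt q) + frame_speed (p t) (F t) * P\<^sup>2 / q)) (at t)"
proof -
  have q0: "q > 0" and P2: "P\<^sup>2 = q - 1" unfolding q by (auto intro: add_pos_nonneg)
  have split: "(\<Sum>i\<in>UNIV. a i) = a k + (\<Sum>i\<in>UNIV-{k}. a i)" for a :: "'n \<Rightarrow> real"
    by (rule sum.remove) auto
  have p2: "(\<Sum>i\<in>UNIV. (p t i)\<^sup>2) = P\<^sup>2"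
    unfolding pt by (rule sum_delta_square)
  have Xpp: "(\<Sum>i\<in>UNIV. \<Sum>j\<in>UNIV. X i j * p t i * p t j) = X k k * P\<^sup>2" for X :: "'n \<Rightarrow> 'n \<Rightarrow> real"
    unfolding pt by (rule sum_delta_quadratic)
  have Xp: "(\<Sum>j\<in>UNIV. X j * p t j) = X k * P" for X :: "'n \<Rightarrow> real"
    unfolding pt by (rule sum_delta_mult)
  define tr where "tr = (\<Sum>i\<in>UNIV. F t i i)"
  define dtr where "dtr = (\<Sum>i\<in>UNIV. \<Phi> i i)"
  define X where "X = (\<Sum>i\<in>UNIV. F t i k * \<Phi> i k)"
  define Y where "Y = (\<Sum>i\<in>UNIV. (F t i k)\<^sup>2)"
  have NY: "N = P\<^sup>2 * (tr * F t k k - Y)"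
    unfolding N tr_def Y_def split[of "\<lambda>i. F t i i"] split[of "\<lambda>i. (F t i k)\<^sup>2"] by (simp add: algebra_simps power2_eq_square)
  have e1: "(\<Sum>i\<in>UNIV. (\<Sum>j\<in>UNIV. F t i j * p t j)\<^sup>2) = P\<^sup>2 * Y"
    unfolding Xp Y_def sum_distrib_left by (simp add: power_mult_distrib mult.commute)
  have e2: "(\<Sum>i\<in>UNIV. p t i * (\<mu> * p t i)) = \<mu> * P\<^sup>2"
    unfolding p2[symmetric] sum_distrib_left by (simp add: power2_eq_square mult_ac)
  have e3: "(\<Sum>i\<in>UNIV. \<Sum>j\<in>UNIV. \<Phi> i j * p t i * p t j + F t i j * (\<mu> * p t i) * p t j + F t i j * p t i * (\<mu> * p t j))
     = P\<^sup>2 * (\<Phi> k k + 2 * \<mu> * F t k k)"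
  proof -
    have "(\<Sum>i\<in>UNIV. \<Sum>j\<in>UNIV. \<Phi> i j * p t i * p t j + F t i j * (\<mu> * p t i) * p t j + F t i j * p t i * (\<mu> * p t j))
      = (\<Sum>i\<in>UNIV. \<Sum>j\<in>UNIV. (\<Phi> i j + 2 * \<mu> * F t i j) * p t i * p t j)"
      by (simp add: algebra_simps)
    then show ?thesis unfolding Xpp by simp
  qed
  have e4: "(\<Sum>i\<in>UNIV. (\<Sum>j\<in>UNIV. F t i j * p t j) * (\<Sum>j\<in>UNIV. \<Phi> i j * p t j + F t i j * (\<mu> * p t j)))
     = P\<^sup>2 * (X + \<mu> * Y)"
  proof -
    have "(\<Sum>j\<in>UNIV. \<Phi> i j * p t j + F t i j * (\<mu> * p t j)) = (\<Phi> i k + \<mu> * F t i k) * P" for i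
      using Xp[of "\<lambda>j. \<Phi> i j + \<mu> * F t i j"] by (simp add: algebra_simps)
    then have "(\<Sum>i\<in>UNIV. (\<Sum>j\<in>UNIV. F t i j * p t j) * (\<Sum>j\<in>UNIV. \<Phi> i j * p t j + F t i j * (\<mu> * p t j)))
      = (\<Sum>i\<in>UNIV. P\<^sup>2 * (F t i k * \<Phi> i k + \<mu> * (F t i k)\<^sup>2))"
      unfolding Xp by (simp add: algebra_simps power2_eq_square)
    then show ?thesis unfolding X_def Y_def by (simp only: sum_distrib_left[symmetric] sum.distrib)
  qed
  let ?dM = "tr * dtr - (\<Sum>i\<in>UNIV. \<Sum>j\<in>UNIV. F t i j * \<Phi> i j)"
  let ?dN = "dtr * (F t k k * P\<^sup>2) + tr * (P\<^sup>2 * (\<Phi> k k + 2 * \<mu> * F t k k)) - 2 * (P\<^sup>2 * (X + \<mu> * Y))"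
  have "((\<lambda>s. frame_speed (p s) (F s)) has_real_derivative
    (?dM - ?dN / q + N * (2 * (\<mu> * P\<^sup>2)) / q\<^sup>2) / sqrt q - frame_speed (p t) (F t) * (2 * (\<mu> * P\<^sup>2)) / (2 * q)) (at t)"
    by (rule frame_speed_has_derivative[OF p F]) (simp_all only: p2 q Xpp e1 e2 e3 e4 tr_def dtr_def NY, simp add: algebra_simps tr_def)
  moreover have "(?dM - ?dN / q + N * (2 * (\<mu> * P\<^sup>2)) / q\<^sup>2) / sqrt q - frame_speed (p t) (F t) * (2 * (\<mu> * P\<^sup>2)) / (2 * q)
    = speed_lin P k (F t) \<Phi> - \<mu> * (2 * N / (q\<^sup>2 * sqrt q) + frame_speed (p t) (F t) * P\<^sup>2 / q)"
  proof -
    define Z where "Z = ?dM"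
    define W where "W = dtr * F t k k + tr * \<Phi> k k - 2 * X"
    have dN: "?dN = P\<^sup>2 * W + 2 * \<mu> * N" unfolding W_def NY by (simp add: algebra_simps)
    have "(P\<^sup>2 * W + 2 * \<mu> * N) / q - N * (2 * (\<mu> * P\<^sup>2)) / q\<^sup>2 = P\<^sup>2 / q * W + 2 * \<mu> * N / q\<^sup>2"
      unfolding P2 using q0 by (simp add: field_simps power2_eq_square)
    then have A: "Z - ?dN / q + N * (2 * (\<mu> * P\<^sup>2)) / q\<^sup>2 = Z - P\<^sup>2 / q * W - 2 * \<mu> * N / q\<^sup>2"
      unfolding dN by linarith
    have B: "speed_lin P k (F t) \<Phi> = (Z - P\<^sup>2 / q * W) / sqrt q"
      unfolding speed_lin_def q[symmetric] tr_def[symmetric] dtr_def[symmetric] X_def[symmetric] Z_def W_def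
      by (simp add: mult.commute)
    show ?thesis unfolding Z_def[symmetric] A B
      by (simp add: diff_divide_distrib add_divide_distrib algebra_simps)
  qed
  ultimately show ?thesis by simp
qed

section \<open>The barrier inequality\<close>

text \<open>At a point where \<open>f\<^sub>t\<close> touches \<open>\<epsilon> e\<^sup>-\<^sup>K\<^sup>t \<phi>(g)\<close>, \<open>\<phi>(g) = g (\<delta> - g)\<^sup>2\<close>, from above, the evolution
  equation of \<open>f\<^sub>t\<close> implies the reverse of the final inequality. In the adapted frame \<open>\<gamma> = |Dg|\<close>, \<open>g11\<close>
  and \<open>F11\<close> are the normal second derivatives of \<open>g\<close> and \<open>f\<close>, \<open>T\<close> is the trace and \<open>S\<close> the second
  elementary symmetric function of the tangential Hessian of \<open>f\<close>, \<open>c2\<close> is the sum of the squared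
  mixed derivatives, \<open>G = f\<^sub>t\<close>, \<open>\<phi>1 = \<phi>'(g)\<close> and \<open>\<phi>2 = \<phi>''(g)\<close>.\<close>

definition barrier_rate :: "real \<Rightarrow> real \<Rightarrow> real \<Rightarrow> real \<Rightarrow> real \<Rightarrow> bool"
  where "barrier_rate C0 C1 \<omega> \<delta> K \<longleftrightarrow>
    (\<forall>g \<gamma> P q F11 T c2 S G N g11 s \<phi>1 \<phi>2.
      0 < g \<longrightarrow> g < \<delta> \<longrightarrow> \<omega> * g \<le> \<gamma> \<longrightarrow> \<gamma> \<le> C0 \<longrightarrow> \<bar>g11\<bar> \<le> C0 \<longrightarrow>
      P = g * \<gamma> \<longrightarrow> q = 1 + P\<^sup>2 \<longrightarrow> F11 = g * g11 + \<gamma>\<^sup>2 \<longrightarrow> 0 \<le> T \<longrightarrow> T \<le> C1 * g \<longrightarrow>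
      0 \<le> c2 \<longrightarrow> c2 \<le> C1 * g\<^sup>2 \<longrightarrow> c2 \<le> F11 * T \<longrightarrow> 0 \<le> S \<longrightarrow> S \<le> T\<^sup>2 / 2 \<longrightarrow>
      G = (S + (F11 * T - c2) / q) / sqrt q \<longrightarrow> N = P\<^sup>2 * (T * F11 - c2) \<longrightarrow>
      s = \<delta> - g \<longrightarrow> \<phi>1 = s * (s - 2 * g) \<longrightarrow> \<phi>2 = 2 * g - 4 * s \<longrightarrow>
      \<phi>1 * G - K * g * (g * s\<^sup>2) <
      \<phi>1 * (2 * G - \<gamma>\<^sup>2 * T / q / sqrt q) + g * \<phi>2 * (\<gamma>\<^sup>2 * T / q / sqrt q)
        - \<phi>1 * (2 * N / (q\<^sup>2 * sqrt q) + G * P\<^sup>2 / q))"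

text \<open>After division by \<open>sqrt q\<close> everything reduces to one error \<open>X\<close>
  multiplying \<phi>'. It is O(g^2), but its lower bound also carries the factor \<open>T\<close>.
  Where s = \<delta> - g is small, \<phi>' is negative, so only the lower bound matters and the
  \<phi>'' term, also proportional to \<open>T\<close>, absorbs it; elsewhere s^2 is bounded below
  and a large \<open>K\<close> suffices.\<close>

lemma barrier_rate_exists:
  fixes C0 C1 \<omega> \<delta> :: real
  assumes C0: "C0 > 0" and C1: "C1 > 0" and w: "\<omega> > 0" and d: "0 < \<delta>" "\<delta> \<le> 1"
  obtains K where "K > 0" "barrier_rate C0 C1 \<omega> \<delta> K"
proof -
  \<comment> \<open>\<open>C2\<close> bounds \<open>F11\<close>, \<open>CH\<close> bounds the speed
    times \<open>sqrt q\<close>, and \<open>A1\<close>, \<open>A2\<close> are the constants in X <=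
    A1 g^2 and X >= - A2 g T; \<open>A3\<close> then bounds |X| / g^2.\<close>
  define C2 where "C2 = C0 + C0\<^sup>2"
  define CH where "CH = C1\<^sup>2 / 2 + C2 * C1"
  define A1 where "A1 = C0 * C1 + C1 + C0\<^sup>2 * (2 * (C2 * C1) + CH)"
  define A2 where "A2 = C0 + C1 / 2"
  define A3 where "A3 = A1 + A2 * C1"
  define Q where "Q = 1 + C0\<^sup>2"
  have C2: "C2 > 0" unfolding C2_def using C0 by (simp add: add_pos_pos)
  have CH: "CH > 0" unfolding CH_def using C1 C2 by (simp add: add_pos_pos)
  have A1: "A1 > 0" unfolding A1_def using C0 C1 C2 CH by (simp add: add_pos_pos)
  have A2: "A2 > 0" unfolding A2_def using C0 C1 by simp
  have A3: "A3 > 0" unfolding A3_def using A1 A2 C1 by (simp add: add_pos_pos)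
  have Q: "Q > 0" unfolding Q_def using C0 by (simp add: add_pos_pos)
  \<comment> \<open>The first entry forces 4 s <= g and g >= \<delta> / 2, hence \<phi>'' >= g. The
    second gives 2 A2 s <= \<gamma>^2 / q from \<gamma> >= \<omega> g and q <= Q.\<close>
  define s0 where "s0 = min (\<delta> / 8) (\<omega>\<^sup>2 * (\<delta> / 2)\<^sup>2 / (2 * A2 * Q))"
  have s0: "s0 > 0" unfolding s0_def using d w A2 Q by simp
  \<comment> \<open>For s >= s0 this makes K s^2 exceed the sum of the two error constants; the
    added 1 makes the inequality strict.\<close>
  define K where "K = (2 * A3 + 4 * C0\<^sup>2 * C1) / s0\<^sup>2 + 1"
  have K0: "K > 0" unfolding K_def using A3 C1 s0 by (simp add: add_nonneg_pos)
  show thesis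
  proof (rule that[OF K0], unfold barrier_rate_def, intro allI impI)
    fix g \<gamma> P q F11 T c2 S G N g11 s \<phi>1 \<phi>2 :: real
    assume g: "0 < g" "g < \<delta>" and g1: "\<omega> * g \<le> \<gamma>" "\<gamma> \<le> C0" and g11: "\<bar>g11\<bar> \<le> C0"
      and P: "P = g * \<gamma>" and q: "q = 1 + P\<^sup>2" and F11: "F11 = g * g11 + \<gamma>\<^sup>2" and T: "0 \<le> T" "T \<le> C1 * g"
      and c2: "0 \<le> c2" "c2 \<le> C1 * g\<^sup>2" "c2 \<le> F11 * T" and S: "0 \<le> S" "S \<le> T\<^sup>2 / 2"
      and G: "G = (S + (F11 * T - c2) / q) / sqrt q" and N: "N = P\<^sup>2 * (T * F11 - c2)"
      and s: "s = \<delta> - g" and f1: "\<phi>1 = s * (s - 2 * g)" and f2: "\<phi>2 = 2 * g - 4 * s"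
    have g_le1: "g \<le> 1" using g d by simp
    have gam: "0 < \<gamma>" using g1 w g by (meson less_le_trans mult_pos_pos)
    have gam2: "\<gamma>\<^sup>2 \<le> C0\<^sup>2" using g1 gam by (intro power_mono) auto
    have gamlow: "\<omega>\<^sup>2 * g\<^sup>2 \<le> \<gamma>\<^sup>2" using power_mono[OF g1(1), of 2] w g by (simp add: power_mult_distrib)
    have s_pos: "0 < s" "s < 1" using s g d by auto
    have q1: "1 \<le> q" unfolding q by simp
    have q0: "0 < q" using q1 by simp
    have P2: "P\<^sup>2 \<le> C0\<^sup>2 * g\<^sup>2" "0 \<le> P\<^sup>2" unfolding P power_mult_distrib using mult_left_mono[OF gam2, of "g\<^sup>2"] by (auto simp: mult.commute)
    have g2: "g\<^sup>2 \<le> 1" "g\<^sup>2 \<le> g" using g g_le1 power_decreasing[of 1 2 g] by (auto simp: power_le_one)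
    have qQ: "q \<le> Q" unfolding q Q_def using P2 g2 mult_left_le[of "g\<^sup>2" "C0\<^sup>2"] by simp
    have F11u: "F11 \<le> C2"
    proof -
      have "g * g11 \<le> g * C0" using g11 g by (intro mult_left_mono) auto
      also have "\<dots> \<le> C0" using g_le1 C0 by simp
      finally show ?thesis unfolding F11 C2_def using gam2 by simp
    qed
    have T1: "T \<le> C1" using order_trans[OF T(2) mult_left_mono[OF g_le1, of C1]] C1 by simp
    define H where "H = S + (F11 * T - c2) / q"
    have div_q: "x / q \<le> x" if "0 \<le> x" for x using divide_left_mono[of 1 q x] that q1 by simp
    have D0: "0 \<le> F11 * T - c2" using c2 by simp
    have D1: "F11 * T - c2 \<le> C2 * C1"
      using mult_mono[OF F11u T1] T C2 c2 by simp
    have Dq: "(F11 * T - c2) / q \<le> F11 * T - c2" using div_q[OF D0] .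
    have H0: "0 \<le> H" unfolding H_def using S D0 q0 by simp
    have H1: "H \<le> CH"
    proof -
      have "T\<^sup>2 \<le> C1\<^sup>2" using T T1 by (intro power_mono)
      then show ?thesis unfolding H_def CH_def using S D1 Dq by simp
    qed
    \<comment> \<open>Up to the factor 1 / sqrt q, \<open>X\<close> collects everything that \<phi>'
      multiplies in the claimed inequality.\<close>
    define X where "X = \<gamma>\<^sup>2 * T / q - H + 2 * N / q\<^sup>2 + H * P\<^sup>2 / q"
    \<comment> \<open>Substituting F11 = g g11 + \<gamma>^2 cancels \<gamma>^2 T / q, the only term
      that is not small compared with \<open>T\<close>.\<close>
    have Xe: "X = (c2 - g * g11 * T) / q - S + P\<^sup>2 * (2 * (F11 * T - c2) / q\<^sup>2 + H / q)"
    proof -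
      define D where "D = F11 * T - c2"
      have a: "\<gamma>\<^sup>2 * T / q - D / q = (c2 - g * g11 * T) / q"
        unfolding diff_divide_distrib[symmetric] D_def F11 by (simp add: algebra_simps)
      have b: "2 * N / q\<^sup>2 = P\<^sup>2 * (2 * D / q\<^sup>2)" "H * P\<^sup>2 / q = P\<^sup>2 * (H / q)"
        unfolding N D_def by (simp_all add: mult_ac)
      have "H = S + D / q" unfolding H_def D_def ..
      then show ?thesis unfolding X_def b a[symmetric] D_def[symmetric] by (simp add: distrib_left)
    qed
    have gT: "\<bar>g * g11 * T\<bar> \<le> C0 * (g * T)"
    proof -
      have "\<bar>g * g11 * T\<bar> = \<bar>g11\<bar> * (g * T)" using g T by (simp add: abs_mult)
      also have "\<dots> \<le> C0 * (g * T)" using g11 g T by (intro mult_right_mono) auto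
      finally show ?thesis .
    qed
    have gTC: "g * T \<le> C1 * g\<^sup>2" using mult_left_mono[OF T(2), of g] g by (simp add: power2_eq_square mult_ac)
    have div_q2: "x / q\<^sup>2 \<le> x" if "0 \<le> x" for x
      using divide_left_mono[of 1 "q\<^sup>2" x] that q1 by (simp add: one_le_power)
    have Xup: "X \<le> A1 * g\<^sup>2"
    proof -
      have a: "(c2 - g * g11 * T) / q \<le> c2 + C0 * (g * T)"
      proof -
        have "c2 - g * g11 * T \<le> c2 + C0 * (g * T)" using gT by linarith
        also have "\<dots> \<le> (c2 + C0 * (g * T)) * q" using mult_left_mono[OF q1, of "c2 + C0 * (g * T)"] c2 C0 g T
          by simp
        finally show ?thesis using q0 by (simp add: divide_le_eq)
      qed
      have "2 * (F11 * T - c2) / q\<^sup>2 \<le> 2 * (F11 * T - c2)"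
        using div_q2[of "2 * (F11 * T - c2)"] D0 by simp
      moreover have "H / q \<le> H" using div_q[OF H0] .
      ultimately have "2 * (F11 * T - c2) / q\<^sup>2 + H / q \<le> 2 * (F11 * T - c2) + H" by (rule add_mono)
      also have "\<dots> \<le> 2 * (C2 * C1) + CH" by (intro add_mono mult_left_mono D1 H1) simp
      finally have b0: "2 * (F11 * T - c2) / q\<^sup>2 + H / q \<le> 2 * (C2 * C1) + CH" .
      have b: "P\<^sup>2 * (2 * (F11 * T - c2) / q\<^sup>2 + H / q) \<le> (C0\<^sup>2 * g\<^sup>2) * (2 * (C2 * C1) + CH)"
        using P2 b0 D0 H0 q0 by (intro mult_mono) auto
      have "C0 * (g * T) \<le> C0 * (C1 * g\<^sup>2)" using gTC C0 by simp
      then show ?thesis unfolding Xe A1_def using a b c2 S by (simp add: algebra_simps)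
    qed
    have Xlow: "- (A2 * (g * T)) \<le> X"
    proof -
      have "- (C0 * (g * T)) \<le> (c2 - g * g11 * T) / q"
      proof -
        have "(- (C0 * (g * T))) * q \<le> - (C0 * (g * T))" using mult_left_mono[OF q1, of "C0 * (g * T)"] C0 g T
          by simp
        also have "\<dots> \<le> c2 - g * g11 * T" using gT c2 by linarith
        finally show ?thesis using q0 by (simp add: le_divide_eq)
      qed
      moreover have "S \<le> C1 / 2 * (g * T)"
      proof -
        have "T\<^sup>2 \<le> C1 * g * T" using mult_right_mono[OF T(2) T(1)] by (simp add: power2_eq_square)
        then show ?thesis using S by simp
      qed
      moreover have "0 \<le> P\<^sup>2 * (2 * (F11 * T - c2) / q\<^sup>2 + H / q)"
        using P2 D0 H0 q0 by (intro mult_nonneg_nonneg add_nonneg_nonneg) auto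
      ultimately show ?thesis unfolding Xe A2_def by (simp add: algebra_simps)
    qed
    \<comment> \<open>Near \<open>g = \<delta>\<close> the convexity of \<open>\<phi>\<close> absorbs \<open>\<phi>1 * X\<close>; elsewhere \<open>K\<close> does.\<close>
    have main: "\<phi>1 * X < K * g * (g * s\<^sup>2) * sqrt q + g * \<phi>2 * (\<gamma>\<^sup>2 * T / q)"
    proof (cases "s \<le> s0")
      case True
      then have s8: "s \<le> \<delta> / 8" and sw: "s \<le> \<omega>\<^sup>2 * (\<delta> / 2)\<^sup>2 / (2 * A2 * Q)" unfolding s0_def by auto
      have gs: "4 * s \<le> g" "\<delta> / 2 \<le> g" using s8 s d by auto
      have f1n: "\<phi>1 \<le> 0" unfolding f1 using gs s_pos by (intro mult_nonneg_nonpos) auto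
      have f1l: "- \<phi>1 \<le> 2 * g * s" unfolding f1 using s_pos by (simp add: algebra_simps)
      have f2l: "g \<le> \<phi>2" unfolding f2 using gs by simp
      have "\<phi>1 * X \<le> \<phi>1 * (- (A2 * (g * T)))" using Xlow f1n by (intro mult_left_mono_neg)
      also have "\<dots> = (- \<phi>1) * (A2 * (g * T))" by simp
      also have "\<dots> \<le> (2 * g * s) * (A2 * (g * T))" using f1l A2 g T by (intro mult_right_mono) auto
      also have "\<dots> = g\<^sup>2 * T * (2 * A2 * s)" by (simp add: power2_eq_square)
      also have "\<dots> \<le> g\<^sup>2 * T * (\<gamma>\<^sup>2 / q)"
      proof -
        have "(2 * A2 * Q) * s \<le> \<omega>\<^sup>2 * (\<delta> / 2)\<^sup>2" using sw A2 Q by (simp add: field_simps)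
        also have "\<dots> \<le> \<omega>\<^sup>2 * g\<^sup>2" using gs d by (intro mult_left_mono power_mono) auto
        also have "\<dots> \<le> \<gamma>\<^sup>2" by (rule gamlow)
        finally have "2 * A2 * s \<le> \<gamma>\<^sup>2 / Q" using Q by (simp add: field_simps)
        also have "\<dots> \<le> \<gamma>\<^sup>2 / q" using qQ q0 by (intro divide_left_mono) auto
        finally show ?thesis using T by (intro mult_left_mono) auto
      qed
      also have "\<dots> = g * g * (\<gamma>\<^sup>2 * T / q)" by (simp add: power2_eq_square)
      also have "\<dots> \<le> g * \<phi>2 * (\<gamma>\<^sup>2 * T / q)" using f2l g T q0 by (intro mult_right_mono mult_left_mono) auto
      also have "\<dots> < K * g * (g * s\<^sup>2) * sqrt q + g * \<phi>2 * (\<gamma>\<^sup>2 * T / q)" using K0 g s_pos q0 by simp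
      finally show ?thesis .
    next
      case False
      have f1b: "\<bar>\<phi>1\<bar> \<le> 2"
      proof -
        have "\<bar>s - 2 * g\<bar> \<le> 2" using s_pos g d s by auto
        then have "\<bar>s\<bar> * \<bar>s - 2 * g\<bar> \<le> 1 * 2" using s_pos by (intro mult_mono) auto
        then show ?thesis unfolding f1 by (simp add: abs_mult)
      qed
      have f2b: "- 4 \<le> \<phi>2" unfolding f2 using s_pos g by simp
      have "A2 * (g * T) \<le> A2 * (C1 * g\<^sup>2)" using gTC A2 by simp
      then have "- X \<le> (A2 * C1) * g\<^sup>2" using Xlow by (simp add: mult.assoc)
      moreover have "0 \<le> A1 * g\<^sup>2" "0 \<le> (A2 * C1) * g\<^sup>2" using A1 A2 C1 by auto
      ultimately have "\<bar>X\<bar> \<le> A3 * g\<^sup>2" unfolding A3_def distrib_right using Xup by linarith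
      then have "\<bar>\<phi>1\<bar> * \<bar>X\<bar> \<le> 2 * (A3 * g\<^sup>2)" using f1b by (intro mult_mono) auto
      then have 1: "\<phi>1 * X \<le> 2 * A3 * g\<^sup>2" using abs_ge_self[of "\<phi>1 * X"] by (simp add: abs_mult)
      have "\<gamma>\<^sup>2 * T / q \<le> \<gamma>\<^sup>2 * T" using div_q[of "\<gamma>\<^sup>2 * T"] T by simp
      also have "\<dots> \<le> C0\<^sup>2 * (C1 * g)" using gam2 T by (intro mult_mono) auto
      finally have 20: "\<gamma>\<^sup>2 * T / q \<le> C0\<^sup>2 * (C1 * g)" .
      have "(-4) * (C0\<^sup>2 * (C1 * g)) \<le> (-4) * (\<gamma>\<^sup>2 * T / q)" using 20 by simp
      also have "\<dots> \<le> \<phi>2 * (\<gamma>\<^sup>2 * T / q)" using f2b T q0 by (intro mult_right_mono) auto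
      finally have "g * ((-4) * (C0\<^sup>2 * (C1 * g))) \<le> g * (\<phi>2 * (\<gamma>\<^sup>2 * T / q))"
        by (rule mult_left_mono) (use g in simp)
      then have 2: "- ((4 * C0\<^sup>2 * C1) * g\<^sup>2) \<le> g * \<phi>2 * (\<gamma>\<^sup>2 * T / q)"
        by (simp only: power2_eq_square mult.assoc mult.left_commute mult.commute mult_minus_left mult_minus_right)
      have "s0\<^sup>2 \<le> s\<^sup>2" using False s0 by (intro power_mono) auto
      then have "(2 * A3 + 4 * C0\<^sup>2 * C1) < K * s\<^sup>2"
      proof -
        have "(2 * A3 + 4 * C0\<^sup>2 * C1) = (2 * A3 + 4 * C0\<^sup>2 * C1) / s0\<^sup>2 * s0\<^sup>2" using s0 by simp
        also have "\<dots> < K * s0\<^sup>2" unfolding K_def using s0 by (intro mult_strict_right_mono) auto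
        also have "\<dots> \<le> K * s\<^sup>2" using \<open>s0\<^sup>2 \<le> s\<^sup>2\<close> K0 by simp
        finally show ?thesis .
      qed
      then have "(2 * A3 + 4 * C0\<^sup>2 * C1) * g\<^sup>2 < K * s\<^sup>2 * g\<^sup>2" using g by (intro mult_strict_right_mono) auto
      also have "K * s\<^sup>2 * g\<^sup>2 \<le> K * s\<^sup>2 * g\<^sup>2 * sqrt q" using mult_left_mono[of 1 "sqrt q" "K * s\<^sup>2 * g\<^sup>2"] q1 K0 by simp
      also have "\<dots> = K * g * (g * s\<^sup>2) * sqrt q" by (simp add: power2_eq_square)
      finally have "2 * A3 * g\<^sup>2 + (4 * C0\<^sup>2 * C1) * g\<^sup>2 < K * g * (g * s\<^sup>2) * sqrt q" by (simp add: algebra_simps)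
      then have "2 * A3 * g\<^sup>2 < K * g * (g * s\<^sup>2) * sqrt q + - ((4 * C0\<^sup>2 * C1) * g\<^sup>2)" by simp
      also have "\<dots> \<le> K * g * (g * s\<^sup>2) * sqrt q + g * \<phi>2 * (\<gamma>\<^sup>2 * T / q)"
        using 2 by (rule add_left_mono)
      finally have "2 * A3 * g\<^sup>2 < K * g * (g * s\<^sup>2) * sqrt q + g * \<phi>2 * (\<gamma>\<^sup>2 * T / q)" .
      with 1 show ?thesis by (rule le_less_trans)
    qed
    define r where "r = sqrt q"
    have r: "r > 0" unfolding r_def using q0 by simp
    have Gr: "G = H / r" unfolding G H_def r_def ..
    define h a b c where "h = H / r" and "a = \<gamma>\<^sup>2 * T / q / r" and "b = 2 * N / (q\<^sup>2 * r)" and "c = H / r * P\<^sup>2 / q"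
    have Xr: "X / r = a - h + b + c"
      unfolding X_def h_def a_def b_def c_def by (simp add: add_divide_distrib diff_divide_distrib mult.commute)
    have "(K * g * (g * s\<^sup>2) * r + g * \<phi>2 * (\<gamma>\<^sup>2 * T / q) - \<phi>1 * X) / r =
        K * g * (g * s\<^sup>2) + g * \<phi>2 * a - \<phi>1 * (X / r)"
      unfolding a_def using r by (simp add: add_divide_distrib diff_divide_distrib)
    also have "\<dots> = \<phi>1 * (2 * h - a) + g * \<phi>2 * a - \<phi>1 * (b + c) - (\<phi>1 * h - K * g * (g * s\<^sup>2))"
      unfolding Xr by (simp add: algebra_simps)
    finally have "\<phi>1 * (2 * h - a) + g * \<phi>2 * a - \<phi>1 * (b + c) - (\<phi>1 * h - K * g * (g * s\<^sup>2)) =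
      (K * g * (g * s\<^sup>2) * r + g * \<phi>2 * (\<gamma>\<^sup>2 * T / q) - \<phi>1 * X) / r" by simp
    also have "\<dots> > 0" using main r unfolding r_def by simp
    finally show "\<phi>1 * G - K * g * (g * s\<^sup>2) <
      \<phi>1 * (2 * G - \<gamma>\<^sup>2 * T / q / sqrt q) + g * \<phi>2 * (\<gamma>\<^sup>2 * T / q / sqrt q)
        - \<phi>1 * (2 * N / (q\<^sup>2 * sqrt q) + G * P\<^sup>2 / q)"
      unfolding h_def a_def b_def c_def Gr[symmetric] by (simp add: r_def)
  qed
qed

section \<open>Space-time regularity\<close>

lemma Ck_upto_mono: "Ck_upto k F U S \<Longrightarrow> U' \<subseteq> U \<Longrightarrow> S' \<subseteq> S \<Longrightarrow> Ck_upto k F U' S'"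
proof (induction k arbitrary: F)
  case 0
  then show ?case by (auto intro: continuous_on_subset)
next
  case (Suc k)
  then show ?case by (auto 0 4 intro: continuous_on_subset)
qed

lemma Ck_upto_continuous: "Ck_upto k F U U \<Longrightarrow> continuous_on U F"
  by (cases k) (auto cong: continuous_on_cong)

lemma Ck_upto_self:
  "Ck_upto (Suc k) F U U \<longleftrightarrow> continuous_on U F \<and> (\<forall>x\<in>U. F differentiable (at x)) \<and>
     (\<forall>b\<in>Basis. Ck_upto k (\<lambda>x. dderiv F x b) U U)"
  using Ck_upto_continuous[of "Suc k" F U] by auto

lemma Ck_upto_cong:
  assumes "open U"
  shows "Ck_upto k F U U \<Longrightarrow> (\<And>x. x \<in> U \<Longrightarrow> F x = F' x) \<Longrightarrow> Ck_upto k F' U U"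
proof (induction k arbitrary: F F')
  case 0
  then show ?case by auto
next
  case (Suc k)
  have d: "dderiv F x = dderiv F' x" if "x \<in> U" for x
    using dderiv_cong[OF assms that, of F F'] Suc.prems(2) by blast
  have "F' differentiable (at x)" if "x \<in> U" for x
  proof -
    have "(F has_derivative dderiv F x) (at x)"
      using Suc.prems(1) that dderiv_has_derivative by auto
    then have "(F' has_derivative dderiv F x) (at x)"
      using has_derivative_transform_within_open[OF _ assms that] Suc.prems(2) by blast
    then show ?thesis unfolding differentiable_def by blast
  qed
  moreover have "Ck_upto k (\<lambda>x. dderiv F' x b) U U" if "b \<in> Basis" for b
    by (rule Suc.IH[of "\<lambda>x. dderiv F x b"]) (use Suc.prems(1) that d in auto)
  moreover have "continuous_on U F'"
    using Ck_upto_continuous[OF Suc.prems(1)] Suc.prems(2) by (simp cong: continuous_on_cong)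
  ultimately show ?case unfolding Ck_upto_self by blast
qed

lemma Ck_upto_add_scale:
  assumes U: "open U"
  shows "Ck_upto k F U U \<Longrightarrow> Ck_upto k F' U U \<Longrightarrow> Ck_upto k (\<lambda>x. F x + c * F' x) U U"
proof (induction k arbitrary: F F')
  case 0
  then show ?case using Ck_upto_continuous[of 0 F U] Ck_upto_continuous[of 0 F' U]
    by (auto intro!: exI[of _ "\<lambda>x. F x + c * F' x"] continuous_intros)
next
  case (Suc k)
  have h: "((\<lambda>x. F x + c * F' x) has_derivative (\<lambda>v. dderiv F x v + c * dderiv F' x v)) (at x)" if "x \<in> U" for x
    using Suc.prems that by (intro has_derivative_add has_derivative_mult_right dderiv_has_derivative) auto
  have "Ck_upto k (\<lambda>x. dderiv (\<lambda>x. F x + c * F' x) x b) U U" if "b \<in> Basis" for b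
    by (rule Ck_upto_cong[OF U Suc.IH[of "\<lambda>x. dderiv F x b" "\<lambda>x. dderiv F' x b"]])
       (use Suc.prems that in \<open>auto simp: dderiv_eqI[OF h]\<close>)
  moreover have "continuous_on U (\<lambda>x. F x + c * F' x)"
    using Suc.prems Ck_upto_continuous by (intro continuous_intros) blast+
  ultimately show ?case unfolding Ck_upto_self using h unfolding differentiable_def by blast
qed

lemma Ck_upto_zero: "Ck_upto k (\<lambda>x. 0) U U"
proof (induction k)
  case 0
  show ?case by (auto intro!: exI[of _ "\<lambda>x. 0"])
next
  case (Suc k)
  have "dderiv (\<lambda>x. 0) x = (\<lambda>v. 0)" for x :: 'a by (rule dderiv_eqI) simp
  then show ?case unfolding Ck_upto_self using Suc by (auto simp: fun_eq_iff)
qed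

text \<open>The definition of \<open>Ck_upto\<close> controls only derivatives along basis vectors;
  an arbitrary direction is a finite linear combination of them.\<close>

lemma Ck_upto_dderiv:
  assumes U: "open U" and F: "Ck_upto (Suc k) F U U"
  shows "Ck_upto k (\<lambda>x. dderiv F x v) U U"
proof -
  have s: "Ck_upto k (\<lambda>x. \<Sum>b\<in>B. dderiv F x b * (v \<bullet> b)) U U" if "finite B" "B \<subseteq> Basis" for B
    using that
  proof (induction B rule: finite_induct)
    case empty
    show ?case by (simp add: Ck_upto_zero)
  next
    case (insert b B)
    have "Ck_upto k (\<lambda>x. (\<Sum>b\<in>B. dderiv F x b * (v \<bullet> b)) + (v \<bullet> b) * dderiv F x b) U U"
      using insert F by (intro Ck_upto_add_scale[OF U]) auto
    then show ?case using insert by (simp add: add.commute mult.commute)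
  qed
  show ?thesis
  proof (rule Ck_upto_cong[OF U s[of Basis]])
    fix x assume "x \<in> U"
    then have "F differentiable (at x)" using F by auto
    from dderiv_eq_grad_inner[OF this, of v] show "(\<Sum>b\<in>Basis. dderiv F x b * (v \<bullet> b)) = dderiv F x v"
      by (simp add: grad_def inner_sum_left inner_commute[of v])
  qed auto
qed

lemma Ck_upto_twice_diff_on:
  assumes U: "open U" and F: "Ck_upto (Suc (Suc k)) F U U"
  shows "twice_diff_on F U"
  unfolding twice_diff_on_def
proof (intro conjI ballI allI U)
  fix x v assume x: "x \<in> U"
  show "F differentiable (at x)" using F x by auto
  show "(\<lambda>y. dderiv F y v) differentiable (at x)"
    using Ck_upto_dderiv[OF U F, of v] x by auto
qed

section \<open>Space slices, time slices and the exchange of their derivatives\<close>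

lemma space_slice_has_derivative:
  assumes "(F has_derivative D) (at (x, t))"
  shows "((\<lambda>y. F (y, t)) has_derivative (\<lambda>v. D (v, 0))) (at x)"
proof -
  have "((\<lambda>y. (y, t)) has_derivative (\<lambda>v. (v, 0))) (at x)"
    by (auto intro!: derivative_eq_intros)
  from has_derivative_compose[OF this assms] show ?thesis .
qed

lemma time_slice_has_real_derivative:
  assumes "(F has_derivative D) (at (x, t))"
  shows "((\<lambda>s. F (x, s)) has_real_derivative D (0, 1)) (at t)"
proof -
  have "((\<lambda>r. F ((x, 0) + r *\<^sub>R (0, 1))) has_real_derivative D (0, 1)) (at t)"
    by (rule line_has_real_derivative) (use assms in simp)
  then show ?thesis by simp
qed

lemma open_slice: 
  assumes "open V"
  shows "open {y. (y, t) \<in> V}"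
proof -
  have "open ((\<lambda>y. (y, t)) -` V)" by (intro open_vimage assms continuous_intros)
  then show ?thesis by (simp add: vimage_def)
qed

lemma open_time_slice: 
  assumes "open V"
  shows "open {s. (x, s) \<in> V}"
proof -
  have "open ((\<lambda>s. (x, s)) -` V)" by (intro open_vimage assms continuous_intros)
  then show ?thesis by (simp add: vimage_def)
qed

lemma twice_diff_on_slice:
  assumes tw: "twice_diff_on F V"
  shows "twice_diff_on (\<lambda>y. F (y, t)) {y. (y, t) \<in> V}"
    "(x, t) \<in> V \<Longrightarrow> dderiv (\<lambda>y. F (y, t)) x = (\<lambda>v. dderiv F (x, t) (v, 0))"
    "(x, t) \<in> V \<Longrightarrow> dderiv2 (\<lambda>y. F (y, t)) x v = (\<lambda>w. dderiv2 F (x, t) (v, 0) (w, 0))"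
proof -
  note I = twice_diff_onI[OF open_slice[OF twice_diff_onD(1)[OF tw]], of t "\<lambda>y. F (y, t)" "\<lambda>x v. dderiv F (x, t) (v, 0)"
    "\<lambda>x v w. dderiv2 F (x, t) (v, 0) (w, 0)"]
  have 1: "((\<lambda>y. F (y, t)) has_derivative (\<lambda>v. dderiv F (x, t) (v, 0))) (at x)" if "x \<in> {y. (y, t) \<in> V}" for x
    using space_slice_has_derivative[OF twice_diff_onD(2)[OF tw]] that by simp
  have 2: "((\<lambda>y. dderiv F (y, t) (v, 0)) has_derivative (\<lambda>w. dderiv2 F (x, t) (v, 0) (w, 0))) (at x)"
    if "x \<in> {y. (y, t) \<in> V}" for x v
    using space_slice_has_derivative[OF dderiv2_has_derivative[OF tw]] that by simp
  show "twice_diff_on (\<lambda>y. F (y, t)) {y. (y, t) \<in> V}" using I(1)[OF 1 2] by blast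
  show "(x, t) \<in> V \<Longrightarrow> dderiv (\<lambda>y. F (y, t)) x = (\<lambda>v. dderiv F (x, t) (v, 0))"
    using I(2)[OF 1 2, of x] by simp
  show "(x, t) \<in> V \<Longrightarrow> dderiv2 (\<lambda>y. F (y, t)) x v = (\<lambda>w. dderiv2 F (x, t) (v, 0) (w, 0))"
    using I(3)[OF 1 2, of x v] by simp
qed

text \<open>Symmetry of second derivatives in space-time, applied to \<open>F\<close> for the
  gradient and to its derivative along \<open>(v, 0)\<close> for the Hessian. It allows the flow
  equation to be differentiated in time.\<close>

lemma time_derivative_of_space_derivatives:
  fixes F :: "'a::euclidean_space \<times> real \<Rightarrow> real"
  assumes V: "open V" and C: "Ck_upto 4 F V V" and x: "(x, t) \<in> V"
  defines "u \<equiv> \<lambda>z. dderiv F z (0, 1)"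
  shows "twice_diff_on u V"
    "((\<lambda>s. dderiv (\<lambda>y. F (y, s)) x v) has_real_derivative dderiv (\<lambda>y. u (y, t)) x v) (at t)"
    "((\<lambda>s. dderiv2 (\<lambda>y. F (y, s)) x v w) has_real_derivative dderiv2 (\<lambda>y. u (y, t)) x v w) (at t)"
proof -
  have C': "Ck_upto (Suc (Suc (Suc (Suc 0)))) F V V" using C by (simp add: eval_nat_numeral)
  have twF: "twice_diff_on F V" using Ck_upto_twice_diff_on[OF V C'] .
  have twd: "twice_diff_on (\<lambda>z. dderiv F z v) V" for v
    using Ck_upto_twice_diff_on[OF V Ck_upto_dderiv[OF V C']] .
  show u: "twice_diff_on u V" unfolding u_def by (rule twd)
  have ts: "open {s. (x, s) \<in> V}" "t \<in> {s. (x, s) \<in> V}" using open_time_slice[OF V] x by auto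
  have comm: "dderiv (\<lambda>z. dderiv F z a) z b = dderiv (\<lambda>z. dderiv F z b) z a" if "z \<in> V" for z a b
    using dderiv2_commute[OF twF that, of a b] unfolding dderiv2_def .
  have 1: "((\<lambda>s. dderiv F (x, s) (v, 0)) has_real_derivative dderiv2 F (x, t) (v, 0) (0, 1)) (at t)"
    by (rule time_slice_has_real_derivative[OF dderiv2_has_derivative[OF twF x]])
  have e1: "dderiv2 F (x, t) (v, 0) (0, 1) = dderiv (\<lambda>y. u (y, t)) x v"
    unfolding twice_diff_on_slice(2)[OF u x] unfolding dderiv2_def u_def by (rule comm[OF x])
  show "((\<lambda>s. dderiv (\<lambda>y. F (y, s)) x v) has_real_derivative dderiv (\<lambda>y. u (y, t)) x v) (at t)"
    unfolding e1[symmetric]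
    by (rule has_field_derivative_transform_within_open[OF 1 ts]) (simp add: twice_diff_on_slice(2)[OF twF])
  let ?Fv = "\<lambda>z. dderiv F z (v, 0)"
  have 2: "((\<lambda>s. dderiv ?Fv (x, s) (w, 0)) has_real_derivative dderiv2 ?Fv (x, t) (w, 0) (0, 1)) (at t)"
    by (rule time_slice_has_real_derivative[OF dderiv2_has_derivative[OF twd x]])
  have "dderiv2 ?Fv (x, t) (w, 0) (0, 1) = dderiv (\<lambda>z. dderiv ?Fv z (0, 1)) (x, t) (w, 0)"
  proof -
    have "dderiv2 ?Fv (x, t) (w, 0) (0, 1) = dderiv2 ?Fv (x, t) (0, 1) (w, 0)"
      by (rule dderiv2_commute[OF twd x])
    also have "\<dots> = dderiv (\<lambda>z. dderiv ?Fv z (0, 1)) (x, t) (w, 0)" by (simp add: dderiv2_def)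
    finally show ?thesis .
  qed
  also have "dderiv (\<lambda>z. dderiv ?Fv z (0, 1)) (x, t) = dderiv (\<lambda>z. dderiv u z (v, 0)) (x, t)"
    by (rule dderiv_cong[OF V x]) (simp add: u_def comm)
  also have "\<dots> (w, 0) = dderiv2 (\<lambda>y. u (y, t)) x v w"
    unfolding twice_diff_on_slice(3)[OF u x] dderiv2_def ..
  finally have e2: "dderiv2 ?Fv (x, t) (w, 0) (0, 1) = dderiv2 (\<lambda>y. u (y, t)) x v w" .
  show "((\<lambda>s. dderiv2 (\<lambda>y. F (y, s)) x v w) has_real_derivative dderiv2 (\<lambda>y. u (y, t)) x v w) (at t)"
    unfolding e2[symmetric]
    by (rule has_field_derivative_transform_within_open[OF 2 ts]) (simp add: twice_diff_on_slice(3)[OF twF], simp add: dderiv2_def)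
qed

section \<open>No interior contact with the barrier\<close>

text \<open>Only earlier times are compared, as usual for a parabolic minimum principle, so the
  conclusion is an inequality and not a vanishing derivative.\<close>

lemma local_min_time_derivative:
  fixes w :: "real \<Rightarrow> real"
  assumes d: "(w has_real_derivative D) (at t)" and V: "open V" "t \<in> V"
    and le: "\<And>s. s \<in> V \<Longrightarrow> s \<le> t \<Longrightarrow> w t \<le> w s"
  shows "D \<le> 0"
proof (rule ccontr)
  assume "\<not> D \<le> 0"
  then obtain d where d: "d > 0" "\<And>h. 0 < h \<Longrightarrow> h < d \<Longrightarrow> w (t - h) < w t"
    using DERIV_pos_inc_left[OF d] by auto
  obtain r where r: "r > 0" "ball t r \<subseteq> V" using V open_contains_ball by blast
  define h where "h = min d r / 2"
  have h: "0 < h" "h < d" "h < r" unfolding h_def using d(1) r(1) by auto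
  have "t - h \<in> V" using r h by (auto simp: dist_real_def)
  from le[OF this] d(2)[OF h(1,2)] h show False by simp
qed

text \<open>Leibniz rule for f = g^2 / 2. The splitting of D^2 f into g D^2 g and the rank one part
  Dg Dg^T is the source of every power of g in the estimates.\<close>

lemma pressure_identities:
  fixes f :: "'a::euclidean_space \<Rightarrow> real"
  assumes tw: "twice_diff_on f V" and pos: "\<forall>y\<in>V. f y > 0"
  defines "g \<equiv> \<lambda>y. sqrt (2 * f y)"
  shows "twice_diff_on g V"
    "x \<in> V \<Longrightarrow> dderiv f x v = g x * dderiv g x v"
    "x \<in> V \<Longrightarrow> dderiv2 f x v w = g x * dderiv2 g x v w + dderiv g x v * dderiv g x w"
proof -
  define r1 r2 where "r1 z = inverse (sqrt (2 * z))" and "r2 z = - (r1 z * r1 z * r1 z)" for z :: real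
  have d1: "((\<lambda>z. sqrt (2 * z)) has_real_derivative r1 z) (at z)" if "z > 0" for z
    by (rule DERIV_cong[OF DERIV_chain2[OF DERIV_real_sqrt DERIV_cmult_Id]]) (use that in \<open>auto simp: r1_def\<close>)
  have d2: "(r1 has_real_derivative r2 z) (at z)" if "z > 0" for z
    unfolding r1_def[abs_def] by (rule DERIV_cong[OF DERIV_inverse'[OF d1[OF that]]]) (use that in \<open>auto simp: r1_def r2_def\<close>)
  have g: "twice_diff_on g V"
    unfolding g_def
    by (rule twice_diff_on_compose(1)[OF tw, where \<phi> = "\<lambda>z. sqrt (2 * z)" and \<phi>' = r1 and \<phi>'' = r2])
       (use d1 d2 pos in auto)
  then show "twice_diff_on g V" .
  have fg: "f y = (g y)\<^sup>2 / 2" if "y \<in> V" for y unfolding g_def using bspec[OF pos that] by simp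
  have s: "((\<lambda>z. z\<^sup>2 / 2) has_real_derivative z) (at z)" "((\<lambda>z. z) has_real_derivative 1) (at z)" for z :: real
    by (auto intro!: derivative_eq_intros)
  note V = twice_diff_onD(1)[OF tw]
  show "x \<in> V \<Longrightarrow> dderiv f x v = g x * dderiv g x v"
    using dderiv_cong[OF V _ fg, of x] twice_diff_on_compose(2)[OF g s, of x] by simp
  show "x \<in> V \<Longrightarrow> dderiv2 f x v w = g x * dderiv2 g x v w + dderiv g x v * dderiv g x w"
    using dderiv2_cong[OF V _ fg, of x] twice_diff_on_compose(3)[OF g s, of x] by simp
qed

text \<open>All bounds are sums of the 2 x 2 minor inequalities of a positive semidefinite
  form.\<close>

lemma tangential_hessian_bounds:
  fixes B :: "real^'n \<Rightarrow> real^'n \<Rightarrow> real" and e :: "'n \<Rightarrow> real^'n" and k :: 'n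
  assumes B: "bilinear B" and sym: "\<And>v w. B v w = B w v" and pos: "\<And>v. B v v \<ge> 0"
  defines "F \<equiv> \<lambda>i j. B (e i) (e j)"
  defines "T \<equiv> (\<Sum>i\<in>UNIV-{k}. F i i)" and "c2 \<equiv> (\<Sum>i\<in>UNIV-{k}. (F i k)\<^sup>2)"
    and "R2 \<equiv> (\<Sum>i\<in>UNIV-{k}. \<Sum>j\<in>UNIV-{k}. (F i j)\<^sup>2)"
  shows "0 \<le> T" "0 \<le> c2" "c2 \<le> F k k * T" "0 \<le> R2" "R2 \<le> T\<^sup>2"
proof -
  have cs: "(F i j)\<^sup>2 \<le> F i i * F j j" for i j
    unfolding F_def by (rule bilinear_cauchy_schwarz[OF B sym pos])
  show "0 \<le> T" unfolding T_def F_def by (intro sum_nonneg pos)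
  show "0 \<le> c2" unfolding c2_def by (intro sum_nonneg) simp
  show "0 \<le> R2" unfolding R2_def by (intro sum_nonneg) simp
  have "c2 \<le> (\<Sum>i\<in>UNIV-{k}. F i i * F k k)" unfolding c2_def by (intro sum_mono cs)
  then show "c2 \<le> F k k * T" unfolding T_def by (simp add: sum_distrib_left mult.commute)
  have "R2 \<le> (\<Sum>i\<in>UNIV-{k}. \<Sum>j\<in>UNIV-{k}. F i i * F j j)" unfolding R2_def by (intro sum_mono cs)
  then show "R2 \<le> T\<^sup>2" unfolding T_def by (simp add: power2_eq_square sum_product)
qed

text \<open>Off the entry (k,k) the rank one part drops out, so tangential and mixed entries of D^2
  f carry a factor g. \<open>C1\<close> serves both the linear and the quadratic sum.\<close>

lemma pressure_hessian_bounds: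
  fixes F g1 :: "'n::finite \<Rightarrow> 'n \<Rightarrow> real" and k :: 'n
  assumes F: "\<And>i j. F i j = g * g1 i j + (if i = k then \<gamma> else 0) * (if j = k then \<gamma> else 0)"
    and b: "\<And>i j. \<bar>g1 i j\<bar> \<le> C0" and g: "g > 0" and C1: "C1 = real CARD('n) * (C0 + C0\<^sup>2)"
  shows "(\<Sum>i\<in>UNIV-{k}. F i i) \<le> C1 * g" "(\<Sum>i\<in>UNIV-{k}. (F i k)\<^sup>2) \<le> C1 * g\<^sup>2"
    "F k k = g * g1 k k + \<gamma>\<^sup>2"
proof -
  have C0: "0 \<le> C0" using b[of k k] by simp
  have n: "(\<Sum>i\<in>UNIV-{k}. a i) \<le> real CARD('n) * M" if "\<And>i. a i \<le> M" "0 \<le> M" for a :: "'n \<Rightarrow> real" and M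
  proof -
    have "(\<Sum>i\<in>UNIV-{k}. a i) \<le> real (card (UNIV - {k})) * M" using that by (intro sum_bounded_above) auto
    also have "\<dots> \<le> real CARD('n) * M" using that by (intro mult_right_mono) (auto simp: card_mono)
    finally show ?thesis .
  qed
  have "(\<Sum>i\<in>UNIV-{k}. F i i) = (\<Sum>i\<in>UNIV-{k}. g * g1 i i)" by (intro sum.cong) (auto simp: F)
  also have "\<dots> \<le> real CARD('n) * (g * C0)"
    using b g C0 by (intro n mult_left_mono) (auto simp: abs_le_iff)
  also have "\<dots> \<le> C1 * g" unfolding C1 using g by (simp add: algebra_simps)
  finally show "(\<Sum>i\<in>UNIV-{k}. F i i) \<le> C1 * g" .
  have "(\<Sum>i\<in>UNIV-{k}. (F i k)\<^sup>2) = (\<Sum>i\<in>UNIV-{k}. g\<^sup>2 * (g1 i k)\<^sup>2)"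
    by (intro sum.cong) (auto simp: F power_mult_distrib)
  also have "\<dots> \<le> real CARD('n) * (g\<^sup>2 * C0\<^sup>2)"
    using b C0 by (intro n mult_left_mono) (auto simp: abs_le_square_iff[symmetric])
  also have "\<dots> \<le> C1 * g\<^sup>2" unfolding C1 using C0 by (simp add: algebra_simps)
  finally show "(\<Sum>i\<in>UNIV-{k}. (F i k)\<^sup>2) \<le> C1 * g\<^sup>2" .
  show "F k k = g * g1 k k + \<gamma>\<^sup>2" by (simp add: F power2_eq_square)
qed

definition barrier :: "real \<Rightarrow> real \<Rightarrow> real"
  where "barrier \<delta> z = z * (\<delta> - z)\<^sup>2"

lemma barrier_derivatives:
  "((\<lambda>z. c * barrier \<delta> z) has_real_derivative c * ((\<delta> - z) * ((\<delta> - z) - 2 * z))) (at z)"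
  "((\<lambda>z. c * ((\<delta> - z) * ((\<delta> - z) - 2 * z))) has_real_derivative c * (2 * z - 4 * (\<delta> - z))) (at z)"
  unfolding barrier_def by (auto intro!: derivative_eq_intros simp: algebra_simps power2_eq_square)

text \<open>The minimum principle at one point. The spatial minimum of u minus the barrier makes its
  gradient vanish and its Hessian \<Theta> nonnegative, ellipticity discards \<Theta>, and the time
  derivative of the difference is at most 0. What remains is the reverse of the inequality in
  \<open>barrier_rate\<close>.\<close>

lemma no_barrier_contact:
  fixes F :: "(real^'n) \<times> real \<Rightarrow> real"
  assumes V: "open V" and C4: "Ck_upto 4 F V V" and z0: "(x, t) \<in> V"
    and pos: "\<And>z. z \<in> V \<Longrightarrow> F z > 0"
    and pde: "\<And>y s. (y, s) \<in> V \<Longrightarrow> dderiv F (y, s) (0, 1) = graph_speed (\<lambda>y. F (y, s)) y"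
    and conv: "\<And>v. dderiv2 (\<lambda>y. F (y, t)) x v v \<ge> 0"
    and lt: "sqrt (2 * F (x, t)) < \<delta>"
    and lower: "\<omega> * sqrt (2 * F (x, t)) \<le> norm (grad (\<lambda>y. sqrt (2 * F (y, t))) x)"
    and upper: "norm (grad (\<lambda>y. sqrt (2 * F (y, t))) x) \<le> C0"
    and bnd: "\<And>v w. norm v = 1 \<Longrightarrow> norm w = 1 \<Longrightarrow> \<bar>dderiv2 (\<lambda>y. sqrt (2 * F (y, t))) x v w\<bar> \<le> C0"
    and C1: "C1 = real CARD('n) * (C0 + C0\<^sup>2)" and w: "\<omega> > 0"
    and barr: "barrier_rate C0 C1 \<omega> \<delta> K"
    and eps: "\<epsilon> > 0"
    and minimum: "\<And>y s. (y, s) \<in> V \<Longrightarrow> s \<le> t \<Longrightarrow>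
      dderiv F (x, t) (0, 1) - \<epsilon> * exp (- K * t) * barrier \<delta> (sqrt (2 * F (x, t)))
      \<le> dderiv F (y, s) (0, 1) - \<epsilon> * exp (- K * s) * barrier \<delta> (sqrt (2 * F (y, s)))"
  shows False
proof -
  define u where "u z = dderiv F z (0, 1)" for z
  define f where "f y = F (y, t)" for y
  define gs where "gs y = sqrt (2 * f y)" for y
  define g where "g = gs x"
  define V0 where "V0 = {y. (y, t) \<in> V}"
  define c where "c = \<epsilon> * exp (- K * t)"
  define s where "s = \<delta> - g"
  define \<phi>1 where "\<phi>1 = s * (s - 2 * g)"
  define \<phi>2 where "\<phi>2 = 2 * g - 4 * s"
  have x0: "x \<in> V0" unfolding V0_def using z0 by simp
  have g0: "g > 0" unfolding g_def gs_def f_def using pos[OF z0] by simp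
  have cpos: "c > 0" unfolding c_def using eps by simp
  have twF: "twice_diff_on F V"
    using Ck_upto_twice_diff_on[OF V, of 2 F] C4 by (simp add: eval_nat_numeral)
  note TD = time_derivative_of_space_derivatives[OF V C4 z0, folded u_def]
  have twf: "twice_diff_on f V0" unfolding f_def V0_def by (rule twice_diff_on_slice(1)[OF twF])
  have fpos: "\<forall>y\<in>V0. f y > 0" using pos unfolding f_def V0_def by simp
  note PI = pressure_identities[OF twf fpos, folded gs_def]
  have twu: "twice_diff_on (\<lambda>y. u (y, t)) V0" unfolding V0_def by (rule twice_diff_on_slice(1)[OF TD(1)])
  have gd: "gs differentiable (at x)" using twice_diff_onD(3)[OF PI(1) x0] .
  have gse: "(\<lambda>y. sqrt (2 * F (y, t))) = gs" unfolding gs_def f_def by (rule refl)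
  have gx: "sqrt (2 * F (x, t)) = g" unfolding g_def gs_def f_def by (rule refl)
  define \<gamma> where "\<gamma> = norm (grad gs x)"
  have gam: "\<omega> * g \<le> \<gamma>" "\<gamma> \<le> C0"
    using lower upper unfolding gse gx \<gamma>_def by simp_all
  have "grad gs x \<noteq> 0" using gam(1) w g0 unfolding \<gamma>_def by (auto simp: mult_le_0_iff)
  \<comment> \<open>Any index can serve as the label of the normal direction.\<close>
  fix k :: 'n
  obtain e where e: "adapted_frame gs x k e" using adapted_frame_exists[OF \<open>grad gs x \<noteq> 0\<close>] by blast
  have on: "e i \<bullet> e j = of_bool (i = j)" for i j using e unfolding adapted_frame_def by blast
  have ne: "norm (e i) = 1" for i using on[of i i] by (simp add: norm_eq_1)
  have De: "dderiv gs x (e i) = (if i = k then \<gamma> else 0)" for i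
    unfolding \<gamma>_def by (rule adapted_frame_dderiv[OF e gd])
  define g1 where "g1 i j = dderiv2 gs x (e i) (e j)" for i j
  define FF where "FF i j = dderiv2 f x (e i) (e j)" for i j
  define \<Phi> where "\<Phi> i j = dderiv2 (\<lambda>y. u (y, t)) x (e i) (e j)" for i j
  have FFe: "FF i j = g * g1 i j + (if i = k then \<gamma> else 0) * (if j = k then \<gamma> else 0)" for i j
    unfolding FF_def PI(3)[OF x0] De g_def g1_def by simp
  have g1b: "\<bar>g1 i j\<bar> \<le> C0" for i j unfolding g1_def using bnd[OF ne ne] unfolding gse .
  define P where "P = g * \<gamma>"
  define q where "q = 1 + P\<^sup>2"
  define T where "T = (\<Sum>i\<in>UNIV-{k}. FF i i)"
  define c2 where "c2 = (\<Sum>i\<in>UNIV-{k}. (FF i k)\<^sup>2)"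
  define S where "S = (T\<^sup>2 - (\<Sum>i\<in>UNIV-{k}. \<Sum>j\<in>UNIV-{k}. (FF i j)\<^sup>2)) / 2"
  define G where "G = (S + (FF k k * T - c2) / q) / sqrt q"
  define N where "N = P\<^sup>2 * (T * FF k k - c2)"
  have symF: "FF i j = FF j i" for i j unfolding FF_def by (rule dderiv2_commute[OF twf x0])
  have convf: "dderiv2 f x v v \<ge> 0" for v using conv unfolding f_def .
  note TH = tangential_hessian_bounds[OF bilinear_dderiv2[OF twf x0] dderiv2_commute[OF twf x0] convf,
    of e k, folded FF_def, folded T_def c2_def]
  note PH = pressure_hessian_bounds[OF FFe g1b g0 C1, folded T_def c2_def]
  have S0: "0 \<le> S" "S \<le> T\<^sup>2 / 2" unfolding S_def using TH(4,5) by auto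
  have ineq: "\<phi>1 * G - K * g * (g * s\<^sup>2) <
      \<phi>1 * (2 * G - \<gamma>\<^sup>2 * T / q / sqrt q) + g * \<phi>2 * (\<gamma>\<^sup>2 * T / q / sqrt q)
        - \<phi>1 * (2 * N / (q\<^sup>2 * sqrt q) + G * P\<^sup>2 / q)"
    by (rule barr[unfolded barrier_rate_def, rule_format, OF g0 _ gam g1b P_def q_def PH(3) TH(1) PH(1) TH(2) PH(2) TH(3) S0 G_def N_def s_def \<phi>1_def \<phi>2_def])
       (use lt gx in simp)
  have pe: "dderiv f x (e i) = (if i = k then P else 0)" for i
    unfolding PI(2)[OF x0] De P_def g_def by simp
  have Gf: "frame_speed (\<lambda>i. dderiv f x (e i)) FF = G"
    unfolding pe frame_speed_adapted[OF symF] G_def S_def T_def c2_def q_def ..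
  have Gu: "u (x, t) = G"
    using pde[OF z0] graph_speed_frame[OF twf x0 on] Gf unfolding u_def f_def[symmetric] FF_def by simp
  have twb: "twice_diff_on (\<lambda>y. c * barrier \<delta> (gs y)) V0"
    by (rule twice_diff_on_compose(1)[OF PI(1) barrier_derivatives, of c \<delta>])
  have b1: "dderiv (\<lambda>y. c * barrier \<delta> (gs y)) x v = c * \<phi>1 * dderiv gs x v" for v
    using twice_diff_on_compose(2)[OF PI(1) barrier_derivatives x0, of c \<delta>]
    unfolding \<phi>1_def s_def g_def by simp
  have b2: "dderiv2 (\<lambda>y. c * barrier \<delta> (gs y)) x v w =
      c * \<phi>1 * dderiv2 gs x v w + c * \<phi>2 * (dderiv gs x w * dderiv gs x v)" for v w
    using twice_diff_on_compose(3)[OF PI(1) barrier_derivatives x0, of c \<delta> v]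
    unfolding \<phi>1_def \<phi>2_def s_def g_def by simp
  define W where "W y = u (y, t) - c * barrier \<delta> (gs y)" for y
  note dW = twice_diff_on_diff[OF twu twb, folded W_def]
  have Wmin: "W x \<le> W y" if "y \<in> V0" for y
    using minimum[of y t] that unfolding W_def u_def V0_def c_def gs_def f_def by simp
  note LM = local_min_derivatives[OF dW(1) x0 Wmin]
  \<comment> \<open>First order condition at the minimum: Du is a multiple of Dg, hence of Df = g
    Dg.\<close>
  have du: "dderiv (\<lambda>y. u (y, t)) x v = c * \<phi>1 * dderiv gs x v" for v
    using LM(1)[of v] unfolding dW(2)[OF x0] b1 by simp
  define \<Theta> where "\<Theta> i j = dderiv2 W x (e i) (e j)" for i j
  have T1: "(\<Theta> i j)\<^sup>2 \<le> \<Theta> i i * \<Theta> j j" for i j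
    unfolding \<Theta>_def by (rule bilinear_cauchy_schwarz[OF bilinear_dderiv2[OF dW(1) x0] dderiv2_commute[OF dW(1) x0] LM(2)])
  have F1: "(FF i j)\<^sup>2 \<le> FF i i * FF j j" for i j
    unfolding FF_def by (rule bilinear_cauchy_schwarz[OF bilinear_dderiv2[OF twf x0] dderiv2_commute[OF twf x0] convf])
  have mono: "speed_lin P k FF \<Theta> \<ge> 0"
    by (rule speed_lin_nonneg[OF symF _ _ F1 _ T1])
       (auto simp: \<Theta>_def FF_def LM(2) convf intro: dderiv2_commute[OF dW(1) x0])
  define rk where "rk i j = (if j = k then \<gamma> else 0) * (if i = k then \<gamma> else 0)" for i j :: 'n
  \<comment> \<open>D^2 u is the Hessian of the difference plus that of the barrier, and the latter
    consists of \<phi>' D^2 g and \<phi>'' Dg Dg^T.\<close>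
  have \<Phi>e: "\<Phi> = (\<lambda>i j. 1 * \<Theta> i j + c * (\<phi>1 * g1 i j + \<phi>2 * rk i j))"
    unfolding \<Phi>_def \<Theta>_def dW(3)[OF x0] b2 g1_def De rk_def by (intro ext) (simp add: algebra_simps)
  have rkv: "speed_lin P k FF rk = \<gamma>\<^sup>2 * T / q / sqrt q"
    unfolding rk_def speed_lin_rank_one T_def q_def ..
  \<comment> \<open>Homogeneity evaluates the linearisation on D^2 f, and D^2 f = g D^2 g + Dg Dg^T
    then gives its exact value on g D^2 g.\<close>
  have "speed_lin P k FF FF = 2 * G"
    using speed_lin_self[OF symF, of P k] Gf unfolding pe by simp
  moreover have "FF = (\<lambda>i j. g * g1 i j + 1 * rk i j)"
    unfolding rk_def by (intro ext) (simp add: FFe mult.commute)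
  ultimately have g1v: "g * speed_lin P k FF g1 = 2 * G - \<gamma>\<^sup>2 * T / q / sqrt q"
    using speed_lin_add[of P k FF g g1 1 rk] rkv by simp
  have sl: "speed_lin P k FF \<Phi> = speed_lin P k FF \<Theta> + c * (\<phi>1 * speed_lin P k FF g1 + \<phi>2 * speed_lin P k FF rk)"
    unfolding \<Phi>e speed_lin_add by simp
  \<comment> \<open>The rate in Du = \<mu> Df, since Du = c \<phi>' Dg and Df = g Dg.\<close>
  define \<mu> where "\<mu> = c * \<phi>1 / g"
  have tsV: "open {s. (x, s) \<in> V}" "t \<in> {s. (x, s) \<in> V}" using open_time_slice[OF V] z0 by auto
  have D1: "((\<lambda>s. frame_speed (\<lambda>i. dderiv (\<lambda>y. F (y, s)) x (e i)) (\<lambda>i j. dderiv2 (\<lambda>y. F (y, s)) x (e i) (e j)))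
     has_real_derivative speed_lin P k FF \<Phi> - \<mu> * (2 * N / (q\<^sup>2 * sqrt q) + G * P\<^sup>2 / q)) (at t)"
  proof -
    have fe: "(\<lambda>y. F (y, t)) = f" by (simp add: f_def fun_eq_iff)
    have a1: "((\<lambda>s. dderiv (\<lambda>y. F (y, s)) x (e i)) has_real_derivative \<mu> * dderiv (\<lambda>y. F (y, t)) x (e i)) (at t)" for i
    proof -
      have "dderiv (\<lambda>y. u (y, t)) x (e i) = \<mu> * dderiv (\<lambda>y. F (y, t)) x (e i)"
        using du[of "e i"] PI(2)[OF x0, of "e i"] g0 unfolding fe \<mu>_def g_def by simp
      then show ?thesis using TD(2)[of "e i"] by simp
    qed
    have a2: "((\<lambda>s. dderiv2 (\<lambda>y. F (y, s)) x (e i) (e j)) has_real_derivative \<Phi> i j) (at t)" for i j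
      unfolding \<Phi>_def by (rule TD(3))
    have a3: "(\<lambda>i. dderiv (\<lambda>y. F (y, t)) x (e i)) = (\<lambda>i. if i = k then P else 0)"
      unfolding fe by (intro ext pe)
    have a4: "(\<lambda>i j. dderiv2 (\<lambda>y. F (y, t)) x (e i) (e j)) = FF"
      unfolding FF_def fe by (rule refl)
    have a5: "(\<lambda>i. dderiv f x (e i)) = (\<lambda>i. if i = k then P else 0)" using pe by auto
    have "((\<lambda>s. frame_speed (\<lambda>i. dderiv (\<lambda>y. F (y, s)) x (e i)) (\<lambda>i j. dderiv2 (\<lambda>y. F (y, s)) x (e i) (e j)))
     has_real_derivative speed_lin P k (\<lambda>i j. dderiv2 (\<lambda>y. F (y, t)) x (e i) (e j)) \<Phi>
      - \<mu> * (2 * N / (q\<^sup>2 * sqrt q) + frame_speed (\<lambda>i. dderiv (\<lambda>y. F (y, t)) x (e i)) (\<lambda>i j. dderiv2 (\<lambda>y. F (y, t)) x (e i) (e j)) * P\<^sup>2 / q)) (at t)"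
      by (rule frame_speed_has_derivative_adapted[where p = "\<lambda>s i. dderiv (\<lambda>y. F (y, s)) x (e i)" and
          F = "\<lambda>s i j. dderiv2 (\<lambda>y. F (y, s)) x (e i) (e j)", OF a1 a2 a3 q_def]) (simp add: N_def T_def c2_def FF_def fe)
    then show ?thesis unfolding a4 a3 using Gf unfolding a5 by simp
  qed
  have us: "((\<lambda>s. u (x, s)) has_real_derivative speed_lin P k FF \<Phi> - \<mu> * (2 * N / (q\<^sup>2 * sqrt q) + G * P\<^sup>2 / q)) (at t)"
  proof (rule has_field_derivative_transform_within_open[OF D1 tsV])
    fix s assume "s \<in> {s. (x, s) \<in> V}"
    then have s: "(x, s) \<in> V" by simp
    show "frame_speed (\<lambda>i. dderiv (\<lambda>y. F (y, s)) x (e i)) (\<lambda>i j. dderiv2 (\<lambda>y. F (y, s)) x (e i) (e j)) = u (x, s)"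
      using graph_speed_frame[OF twice_diff_on_slice(1)[OF twF, of s], of x e] on s pde[OF s] unfolding u_def by simp
  qed
  have gt: "((\<lambda>s. sqrt (2 * F (x, s))) has_real_derivative G / g) (at t)"
  proof -
    have "((\<lambda>s. F (x, s)) has_real_derivative G) (at t)"
      using time_slice_has_real_derivative[OF twice_diff_onD(2)[OF twF z0]] Gu unfolding u_def by simp
    from DERIV_chain2[OF DERIV_real_sqrt DERIV_cmult[OF this, of 2]]
    have "((\<lambda>s. sqrt (2 * F (x, s))) has_real_derivative inverse (sqrt (2 * F (x, t))) / 2 * (2 * G)) (at t)"
      using pos[OF z0] by simp
    moreover have "inverse g / 2 * (2 * G) = G / g" using g0 by (simp add: field_simps)
    ultimately show ?thesis unfolding gx by simp
  qed
  have bt: "((\<lambda>s. \<epsilon> * exp (- K * s) * barrier \<delta> (sqrt (2 * F (x, s)))) has_real_derivative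
      c * (\<phi>1 * (G / g) - K * (g * s\<^sup>2))) (at t)"
  proof -
    have 1: "((\<lambda>s. barrier \<delta> (sqrt (2 * F (x, s)))) has_real_derivative \<phi>1 * (G / g)) (at t)"
      using DERIV_chain2[OF barrier_derivatives(1)[of 1 \<delta>] gt] unfolding gx \<phi>1_def s_def by simp
    have 2: "((\<lambda>s. \<epsilon> * exp (- K * s)) has_real_derivative - (K * c)) (at t)"
      unfolding c_def by (auto intro!: derivative_eq_intros)
    have "((\<lambda>s. \<epsilon> * exp (- K * s) * barrier \<delta> (sqrt (2 * F (x, s)))) has_real_derivative
       - (K * c) * barrier \<delta> g + \<phi>1 * (G / g) * c) (at t)"
      using DERIV_mult[OF 2 1] unfolding gx c_def[symmetric] by simp
    then show ?thesis unfolding barrier_def s_def[symmetric] by (simp add: algebra_simps)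
  qed
  have "speed_lin P k FF \<Phi> - \<mu> * (2 * N / (q\<^sup>2 * sqrt q) + G * P\<^sup>2 / q) - c * (\<phi>1 * (G / g) - K * (g * s\<^sup>2)) \<le> 0"
    by (rule local_min_time_derivative[OF DERIV_diff[OF us bt] tsV]) (use minimum in \<open>auto simp: u_def\<close>)
  then have "c * (\<phi>1 * speed_lin P k FF g1 + \<phi>2 * speed_lin P k FF rk)
      - \<mu> * (2 * N / (q\<^sup>2 * sqrt q) + G * P\<^sup>2 / q) - c * (\<phi>1 * (G / g) - K * (g * s\<^sup>2)) \<le> 0"
    using mono unfolding sl by linarith
  \<comment> \<open>The positive factor g / c clears the denominator of \<mu> and brings the
    inequality into the form used by \<open>barrier_rate\<close>.\<close>
  then have "g / c * (c * (\<phi>1 * speed_lin P k FF g1 + \<phi>2 * speed_lin P k FF rk)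
      - \<mu> * (2 * N / (q\<^sup>2 * sqrt q) + G * P\<^sup>2 / q) - c * (\<phi>1 * (G / g) - K * (g * s\<^sup>2))) \<le> 0"
    using g0 cpos by (intro mult_nonneg_nonpos) auto
  moreover have "g / c * (c * (\<phi>1 * speed_lin P k FF g1 + \<phi>2 * speed_lin P k FF rk)
      - \<mu> * (2 * N / (q\<^sup>2 * sqrt q) + G * P\<^sup>2 / q) - c * (\<phi>1 * (G / g) - K * (g * s\<^sup>2))) =
      \<phi>1 * (g * speed_lin P k FF g1) + g * \<phi>2 * speed_lin P k FF rk
      - \<phi>1 * (2 * N / (q\<^sup>2 * sqrt q) + G * P\<^sup>2 / q) - (\<phi>1 * G - K * g * (g * s\<^sup>2))"
  proof -
    have "g / c * (c * (p1 * a + p2 * b) - (c * p1 / g) * m - c * (p1 * (G / g) - K * h)) =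
      p1 * (g * a) + g * p2 * b - p1 * m - (p1 * G - K * g * h)" for a b m p1 p2 h
    proof -
      have "g / c * (c * A - (c * p1 / g) * m - c * B) = g * A - p1 * m - g * B" for A B
        using g0 cpos by (simp add: right_diff_distrib)
      note this[of "p1 * a + p2 * b" "p1 * (G / g) - K * h"]
      moreover have "g * (p1 * (G / g) - K * h) = p1 * G - K * g * h"
        using g0 by (simp add: right_diff_distrib)
      moreover have "g * (p1 * a + p2 * b) = p1 * (g * a) + g * p2 * b" by (simp add: distrib_left)
      ultimately show ?thesis by linarith
    qed
    then show ?thesis unfolding \<mu>_def .
  qed
  ultimately show False using ineq unfolding g1v rkv by simp
qed

section \<open>The collar of the interface\<close>

lemma bilinear_unit_bound:
  fixes B :: "'a::real_normed_vector \<Rightarrow> 'a \<Rightarrow> real"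
  assumes B: "bilinear B" and b: "\<And>v w. norm v = 1 \<Longrightarrow> norm w = 1 \<Longrightarrow> \<bar>B v w\<bar> \<le> C"
  shows "\<bar>B v w\<bar> \<le> C * norm v * norm w"
proof (cases "v = 0 \<or> w = 0")
  case True
  then show ?thesis using bilinear_lzero[OF B] bilinear_rzero[OF B] by auto
next
  case False
  then have "norm (sgn v) = 1" "norm (sgn w) = 1" by (auto simp: norm_sgn)
  then have 1: "\<bar>B (sgn v) (sgn w)\<bar> \<le> C" by (rule b)
  have "B v w = B (norm v *\<^sub>R sgn v) (norm w *\<^sub>R sgn w)" using False by (simp add: sgn_div_norm)
  also have "\<dots> = norm v * norm w * B (sgn v) (sgn w)"
    by (simp add: bilinear_lmul[OF B] bilinear_rmul[OF B])
  finally have "\<bar>B v w\<bar> = norm v * norm w * \<bar>B (sgn v) (sgn w)\<bar>" by (simp add: abs_mult)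
  also have "\<dots> \<le> norm v * norm w * C" using 1 by (intro mult_left_mono) auto
  finally show ?thesis by (simp add: mult_ac)
qed

lemma at_within_atLeast_neq_bot:
  assumes "t \<ge> (0::real)"
  shows "at t within {0..} \<noteq> bot"
proof -
  have "t \<in> closure ({0..} - {t})"
    unfolding closure_approachable
  proof (intro allI impI)
    fix e :: real assume "0 < e"
    then show "\<exists>y\<in>{0..} - {t}. dist y t < e"
      using assms by (intro bexI[of _ "t + e / 2"]) (auto simp: dist_real_def)
  qed
  then show ?thesis using not_trivial_limit_within by blast
qed

lemma parabolic_holder_continuous:
  assumes h: "parabolic_holder_on \<beta> L A F" and b: "\<beta> > 0"
  shows "continuous_on A (\<lambda>(x, t). F x t)"
proof -
  have "((\<lambda>(x, t). F x t) \<longlongrightarrow> F x t) (at (x, t) within A)" if xt: "(x, t) \<in> A" for x t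
  proof -
    let ?d = "\<lambda>z. L * (dist (fst z) x + sqrt \<bar>snd z - t\<bar>) powr \<beta>"
    have "((\<lambda>z. dist (fst z) x + sqrt \<bar>snd z - t\<bar>) \<longlongrightarrow> dist (fst (x, t)) x + sqrt \<bar>snd (x, t) - t\<bar>) (at (x, t) within A)"
      by (intro tendsto_intros)
    then have "((\<lambda>z. dist (fst z) x + sqrt \<bar>snd z - t\<bar>) \<longlongrightarrow> 0) (at (x, t) within A)" by simp
    then have "((\<lambda>z. (dist (fst z) x + sqrt \<bar>snd z - t\<bar>) powr \<beta>) \<longlongrightarrow> 0) (at (x, t) within A)"
      using b by (intro tendsto_zero_powrI[OF _ tendsto_const]) (auto intro!: always_eventually)
    then have d0: "(?d \<longlongrightarrow> 0) (at (x, t) within A)" by (rule tendsto_mult_right_zero)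
    have "((\<lambda>z. (\<lambda>(x, t). F x t) z - F x t) \<longlongrightarrow> 0) (at (x, t) within A)"
    proof (rule Lim_null_comparison[OF _ d0])
      show "\<forall>\<^sub>F z in at (x, t) within A. norm ((\<lambda>(x, t). F x t) z - F x t) \<le> ?d z"
        using h xt unfolding parabolic_holder_on_def eventually_at_filter
        by (intro always_eventually) auto
    qed
    then show ?thesis using LIM_zero_iff by fastforce
  qed
  then show ?thesis unfolding continuous_on_def by auto
qed

lemma parabolic_holder_bounded:
  assumes h: "parabolic_holder_on \<beta> L A F" and b: "\<beta> > 0"
    and z: "(x, t) \<in> A" "(y, s) \<in> A" and d: "dist x y + sqrt \<bar>t - s\<bar> \<le> M"
  shows "\<bar>F x t\<bar> \<le> \<bar>F y s\<bar> + \<bar>L\<bar> * M powr \<beta>"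
proof -
  have "\<bar>F x t - F y s\<bar> \<le> L * (dist x y + sqrt \<bar>t - s\<bar>) powr \<beta>"
    using h z unfolding parabolic_holder_on_def by blast
  also have "\<dots> \<le> \<bar>L\<bar> * M powr \<beta>"
    using d b by (intro mult_mono powr_mono2) auto
  finally show ?thesis by linarith
qed

text \<open>\<open>S\<close> stands for the second elementary symmetric function of the tangential
  block; all later estimates know it only through 0 <= S <= T^2 / 2.\<close>

lemma graph_speed_adapted:
  fixes f :: "real^'n \<Rightarrow> real" and e :: "'n \<Rightarrow> real^'n" and k :: 'n
  assumes tw: "twice_diff_on f V" and x: "x \<in> V" and pos: "\<forall>y\<in>V. f y > 0"
    and e: "adapted_frame (\<lambda>y. sqrt (2 * f y)) x k e"
    and conv: "\<And>v. dderiv2 f x v v \<ge> 0"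
  defines "F \<equiv> \<lambda>i j. dderiv2 f x (e i) (e j)"
  defines "T \<equiv> (\<Sum>i\<in>UNIV-{k}. F i i)" and "c2 \<equiv> (\<Sum>i\<in>UNIV-{k}. (F i k)\<^sup>2)"
    and "q \<equiv> 1 + (sqrt (2 * f x) * norm (grad (\<lambda>y. sqrt (2 * f y)) x))\<^sup>2"
  obtains S where "0 \<le> S" "S \<le> T\<^sup>2 / 2" "graph_speed f x = (S + (F k k * T - c2) / q) / sqrt q"
proof -
  note PI = pressure_identities[OF tw pos]
  have on: "e i \<bullet> e j = of_bool (i = j)" for i j using e unfolding adapted_frame_def by blast
  have sym: "F i j = F j i" for i j unfolding F_def by (rule dderiv2_commute[OF tw x])
  have pe: "(\<lambda>i. dderiv f x (e i)) =
      (\<lambda>i. if i = k then sqrt (2 * f x) * norm (grad (\<lambda>y. sqrt (2 * f y)) x) else 0)"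
    unfolding PI(2)[OF x] adapted_frame_dderiv[OF e twice_diff_onD(3)[OF PI(1) x]] by auto
  define S where "S = (T\<^sup>2 - (\<Sum>i\<in>UNIV-{k}. \<Sum>j\<in>UNIV-{k}. (F i j)\<^sup>2)) / 2"
  note TH = tangential_hessian_bounds[OF bilinear_dderiv2[OF tw x] dderiv2_commute[OF tw x] conv,
    of e k]
  show ?thesis
  proof (rule that)
    show "0 \<le> S" "S \<le> T\<^sup>2 / 2" unfolding S_def T_def F_def using TH(4,5) by auto
    have "graph_speed f x = frame_speed (\<lambda>i. dderiv f x (e i)) F"
      unfolding F_def by (rule graph_speed_frame[OF tw x on])
    then show "graph_speed f x = (S + (F k k * T - c2) / q) / sqrt q"
      unfolding pe frame_speed_adapted[OF sym] S_def T_def c2_def q_def .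
  qed
qed

section \<open>The flow near its interface: regularity, gradient bounds and compactness\<close>

locale flat_graph_flow =
  fixes f :: "real^'n \<Rightarrow> real \<Rightarrow> real"
    and \<Omega> :: "real \<Rightarrow> (real^'n) set"
    and S :: "((real^'n) \<times> real) set"
    and X :: "(real^'n) \<times> real \<Rightarrow> real \<Rightarrow> (real^'n) \<times> real"
    and M :: "real \<Rightarrow> ((real^'n) \<times> real) set"
    and T Tc \<rho>0 R \<beta> :: real
  assumes initial: "initial_hypersurface S"
    and flow: "scalar_curvature_flow S Tc X M"
    and graph: "flow_graph M Tc \<Omega> f"
    and T: "0 < T" "T < Tc"
    and disk: "\<rho>0 > 0" "\<And>t. 0 \<le> t \<Longrightarrow> t \<le> T \<Longrightarrow> cball 0 \<rho>0 \<subseteq> flat_side \<Omega> f t"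
    and dom: "\<And>t. 0 \<le> t \<Longrightarrow> t \<le> T \<Longrightarrow> \<Omega> t \<subseteq> ball 0 R"
    and holder: "0 < \<beta>" "C2_holder_up_to_interface \<beta> T \<Omega> f"
begin

lemma graph_facts:
  assumes "0 \<le> t" "t < Tc"
  shows "convex_on (\<Omega> t) (\<lambda>x. f x t)" "x \<in> \<Omega> t \<Longrightarrow> f x t \<ge> 0"
    "flat_side \<Omega> f t = {x. (x, 0) \<in> M t}" "x \<in> \<Omega> t \<Longrightarrow> (\<lambda>y. f y t) differentiable (at x)"
  using graph assms unfolding flow_graph_def by auto

lemma spacetime_domain:
  obtains W where "open W" "{(x, t). 0 \<le> t \<and> t < Tc \<and> x \<in> \<Omega> t} = (UNIV \<times> {0..<Tc}) \<inter> W"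
  using graph unfolding flow_graph_def openin_open by blast

lemma f_continuous: "continuous_on {(x, t). 0 \<le> t \<and> t < Tc \<and> x \<in> \<Omega> t} (\<lambda>(x, t). f x t)"
  using graph unfolding flow_graph_def by blast

lemma open_domain:
  assumes "0 \<le> t" "t < Tc"
  shows "open (\<Omega> t)"
proof -
  obtain W where W: "open W" "{(x, t). 0 \<le> t \<and> t < Tc \<and> x \<in> \<Omega> t} = (UNIV \<times> {0..<Tc}) \<inter> W"
    using spacetime_domain .
  have "\<Omega> t = {x. (x, t) \<in> W}" using W(2) assms by (auto simp: set_eq_iff)
  then show ?thesis using open_slice[OF W(1)] by simp
qed

lemma f_slice_continuous:
  assumes "0 \<le> t" "t < Tc"
  shows "continuous_on (\<Omega> t) (\<lambda>x. f x t)"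
proof -
  have "continuous_on (\<Omega> t) (\<lambda>x. (\<lambda>(x, t). f x t) (x, t))"
    by (rule continuous_on_compose2[OF f_continuous]) (use assms in \<open>auto intro!: continuous_intros\<close>)
  then show ?thesis by simp
qed

lemma open_positive:
  assumes "0 \<le> t" "t < Tc"
  shows "open {x \<in> \<Omega> t. 0 < pressure f x t \<and> pressure f x t < d}"
proof -
  have "continuous_on (\<Omega> t) (\<lambda>x. pressure f x t)"
    unfolding pressure_def by (intro continuous_intros f_slice_continuous assms)
  from continuous_open_preimage[OF this open_domain[OF assms], of "{0<..<d}"]
  have "open (\<Omega> t \<inter> (\<lambda>x. pressure f x t) -` {0<..<d})" by simp
  moreover have "\<Omega> t \<inter> (\<lambda>x. pressure f x t) -` {0<..<d} = {x \<in> \<Omega> t. 0 < pressure f x t \<and> pressure f x t < d}"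
    by auto
  ultimately show ?thesis by simp
qed

lemma pressure_pos_iff: "0 < pressure f x t \<longleftrightarrow> 0 < f x t"
  unfolding pressure_def by simp

lemma pressure_square: "0 \<le> t \<Longrightarrow> t < Tc \<Longrightarrow> x \<in> \<Omega> t \<Longrightarrow> f x t = (pressure f x t)\<^sup>2 / 2"
  using graph_facts(2) unfolding pressure_def by simp

text \<open>The set where f > 0 is open and disjoint from the flat side, hence from its closure. So
  the smoothness and the equation assumed off the interface hold wherever f > 0.\<close>

lemma not_interface:
  assumes t: "0 \<le> t" "t < Tc" and x: "x \<in> \<Omega> t" "f x t > 0"
  shows "x \<notin> flat_interface \<Omega> f t"
proof -
  let ?V = "{y \<in> \<Omega> t. 0 < pressure f y t \<and> pressure f y t < pressure f x t + 1}"
  have "open ?V" "x \<in> ?V" using open_positive[OF t] x pressure_pos_iff by auto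
  moreover have "?V \<inter> flat_side \<Omega> f t = {}" unfolding flat_side_def pressure_def by auto
  ultimately have "x \<notin> closure (flat_side \<Omega> f t)" using open_Int_closure_eq_empty by blast
  then show ?thesis unfolding flat_interface_def frontier_def by simp
qed

lemma f_evolution:
  assumes t: "0 \<le> t" "t < Tc" and x: "x \<in> \<Omega> t" "f x t > 0"
  shows "((\<lambda>s. f x s) has_real_derivative graph_speed (\<lambda>y. f y t) x) (at t within {0..})"
proof -
  have "\<forall>t. 0 \<le> t \<and> t < Tc \<longrightarrow> (\<forall>x\<in>\<Omega> t - flat_interface \<Omega> f t.
       ((\<lambda>s. f x s) has_real_derivative graph_speed (\<lambda>y. f y t) x) (at t within {0..}))"
    using graph unfolding flow_graph_def by blast
  then show ?thesis using not_interface[OF t x] t x by blast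
qed

lemma open_spacetime_positive: "open {(x, t). 0 < t \<and> t < Tc \<and> x \<in> \<Omega> t \<and> f x t > 0}"
proof -
  obtain W where W: "open W" "{(x, t). 0 \<le> t \<and> t < Tc \<and> x \<in> \<Omega> t} = (UNIV \<times> {0..<Tc}) \<inter> W"
    using spacetime_domain .
  let ?O = "W \<inter> (UNIV \<times> {0<..<Tc})"
  have "(x, t) \<in> W \<longleftrightarrow> x \<in> \<Omega> t" if "0 \<le> t" "t < Tc" for x t
    using W(2) that by (auto simp: set_eq_iff)
  then have O: "?O = {(x, t). 0 < t \<and> t < Tc \<and> x \<in> \<Omega> t}" by auto
  have oO: "open ?O" using W(1) by (intro open_Int open_Times) auto
  have "continuous_on ?O (\<lambda>(x, t). f x t)"
    by (rule continuous_on_subset[OF f_continuous]) (auto simp: O)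
  from continuous_open_preimage[OF this oO open_greaterThan[of 0]]
  have "open (?O \<inter> (\<lambda>(x, t). f x t) -` {0<..})" .
  moreover have "?O \<inter> (\<lambda>(x, t). f x t) -` {0<..} = {(x, t). 0 < t \<and> t < Tc \<and> x \<in> \<Omega> t \<and> f x t > 0}"
    unfolding O by auto
  ultimately show ?thesis by simp
qed

lemma smooth_spacetime_positive:
  "Ck_upto k (\<lambda>(x, t). f x t) {(x, t). 0 < t \<and> t < Tc \<and> x \<in> \<Omega> t \<and> f x t > 0}
     {(x, t). 0 < t \<and> t < Tc \<and> x \<in> \<Omega> t \<and> f x t > 0}"
proof (rule Ck_upto_mono)
  show "Ck_upto k (\<lambda>(x, t). f x t)
      {(x, t). 0 < t \<and> t < Tc \<and> x \<in> \<Omega> t - flat_interface \<Omega> f t}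
      {(x, t). 0 \<le> t \<and> t < Tc \<and> x \<in> \<Omega> t - flat_interface \<Omega> f t}"
    using graph unfolding flow_graph_def smooth_upto_def by blast
qed (use not_interface in auto)

text \<open>One width is chosen from the existential assumption once and for all, so that the collar
  is a fixed set.\<close>

definition holder_width :: real
  where "holder_width = (SOME \<delta>. \<delta> > 0 \<and> C2_holder_on \<beta>
       {(x, t). 0 \<le> t \<and> t \<le> T \<and> x \<in> \<Omega> t \<and> 0 < pressure f x t \<and> pressure f x t < \<delta>} (pressure f))"

definition collar :: "((real^'n) \<times> real) set"
  where "collar = {(x, t). 0 \<le> t \<and> t \<le> T \<and> x \<in> \<Omega> t \<and> 0 < pressure f x t \<and> pressure f x t < holder_width}"

lemma holder_width: "holder_width > 0" "C2_holder_on \<beta> collar (pressure f)"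
proof -
  have "\<exists>\<delta>. \<delta> > 0 \<and> C2_holder_on \<beta>
       {(x, t). 0 \<le> t \<and> t \<le> T \<and> x \<in> \<Omega> t \<and> 0 < pressure f x t \<and> pressure f x t < \<delta>} (pressure f)"
    using holder(2) unfolding C2_holder_up_to_interface_def by blast
  from someI_ex[OF this] show "holder_width > 0" "C2_holder_on \<beta> collar (pressure f)"
    unfolding holder_width_def collar_def by auto
qed

definition collar_slice :: "real \<Rightarrow> (real^'n) set"
  where "collar_slice t = {x. (x, t) \<in> collar}"

lemma collar_slice_eq:
  "0 \<le> t \<Longrightarrow> t \<le> T \<Longrightarrow> collar_slice t = {x \<in> \<Omega> t. 0 < pressure f x t \<and> pressure f x t < holder_width}"
  unfolding collar_slice_def collar_def by auto

lemma pressure_twice_diff: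
  assumes "0 \<le> t" "t \<le> T"
  shows "twice_diff_on (\<lambda>y. pressure f y t) (collar_slice t)"
  unfolding twice_diff_on_def
proof (intro conjI ballI allI)
  show "open (collar_slice t)" unfolding collar_slice_eq[OF assms] using assms T by (intro open_positive) auto
  fix x v assume "x \<in> collar_slice t"
  then have "(x, t) \<in> collar" unfolding collar_slice_def by simp
  then show "(\<lambda>y. pressure f y t) differentiable (at x)" "(\<lambda>y. dderiv (\<lambda>y. pressure f y t) y v) differentiable (at x)"
    using holder_width(2) unfolding C2_holder_on_def by auto
qed

text \<open>Taken from the pressure, whose regularity class includes the times 0 and T;
  differentiability in the space-time smoothness of the flow is stated at positive times
  only.\<close>

lemma f_twice_diff:
  assumes "0 \<le> t" "t \<le> T"
  shows "twice_diff_on (\<lambda>y. f y t) (collar_slice t)"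
proof (rule twice_diff_on_cong)
  show "twice_diff_on (\<lambda>y. (pressure f y t)\<^sup>2 / 2) (collar_slice t)"
    by (rule twice_diff_on_compose(1)[OF pressure_twice_diff[OF assms], where \<phi> = "\<lambda>z. z\<^sup>2 / 2" and \<phi>' = "\<lambda>z. z" and \<phi>'' = "\<lambda>z. 1"])
       (auto intro!: derivative_eq_intros)
  show "f y t = (pressure f y t)\<^sup>2 / 2" if "y \<in> collar_slice t" for y
    using that assms T pressure_square unfolding collar_slice_eq[OF assms] by simp
qed

lemma collar_slice_pos: "0 \<le> t \<Longrightarrow> t \<le> T \<Longrightarrow> \<forall>y\<in>collar_slice t. f y t > 0"
  using pressure_pos_iff by (simp add: collar_slice_eq)

lemma f_hessian_nonneg:
  assumes "0 \<le> t" "t \<le> T" "x \<in> collar_slice t"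
  shows "dderiv2 (\<lambda>y. f y t) x v v \<ge> 0"
  using assms T
  by (intro convex_dderiv2_nonneg[OF graph_facts(1) open_domain _ f_twice_diff]) (auto simp: collar_slice_eq)

lemma R_pos: "R > 0"
  using dom[of 0] disk(1) disk(2)[of 0] T unfolding flat_side_def
  by (auto simp: subset_iff dest!: spec[of _ 0])

lemma zero_in_flat_side: "0 \<le> t \<Longrightarrow> t \<le> T \<Longrightarrow> 0 \<in> flat_side \<Omega> f t"
  using disk by (auto simp: subset_iff)

text \<open>The tangent plane of f at x lies below f(0) = 0 at the origin, so g^2 / 2 = f <= Df . x
  = g Dg . x <= g |Dg| R.\<close>

lemma pressure_gradient_lower:
  assumes t: "0 \<le> t" "t \<le> T" and x: "x \<in> collar_slice t"
  shows "1 / (2 * R) * pressure f x t \<le> norm (grad (\<lambda>y. pressure f y t) x)"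
proof -
  have tT: "t < Tc" using t T by simp
  have xO: "x \<in> \<Omega> t" and g0: "pressure f x t > 0" using x unfolding collar_slice_eq[OF t] by auto
  have z: "0 \<in> \<Omega> t" "f 0 t = 0" using zero_in_flat_side[OF t] unfolding flat_side_def by auto
  have fd: "(\<lambda>y. f y t) differentiable (at x)" using graph_facts(4)[OF t(1) tT xO] .
  have "f x t + dderiv (\<lambda>y. f y t) x (0 - x) \<le> f 0 t"
    by (rule convex_tangent[OF graph_facts(1)[OF t(1) tT] open_domain[OF t(1) tT] xO z(1) fd])
  then have "f x t \<le> - dderiv (\<lambda>y. f y t) x (- x)" using z by simp
  also have "\<dots> = dderiv (\<lambda>y. f y t) x x" by (simp add: linear_neg[OF linear_dderiv[OF fd]])
  also have "\<dots> = pressure f x t * dderiv (\<lambda>y. pressure f y t) x x"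
    using pressure_identities(2)[OF f_twice_diff[OF t] collar_slice_pos[OF t] x, of x] unfolding pressure_def by simp
  also have "dderiv (\<lambda>y. pressure f y t) x x = grad (\<lambda>y. pressure f y t) x \<bullet> x"
    by (rule dderiv_eq_grad_inner[OF twice_diff_onD(3)[OF pressure_twice_diff[OF t] x]])
  also have "\<dots> \<le> norm (grad (\<lambda>y. pressure f y t) x) * norm x" by (rule norm_cauchy_schwarz)
  also have "\<dots> \<le> norm (grad (\<lambda>y. pressure f y t) x) * R"
    using dom[OF t] xO by (intro mult_left_mono) (auto simp: subset_iff less_imp_le)
  finally have "pressure f x t * (pressure f x t / 2) \<le> pressure f x t * (norm (grad (\<lambda>y. pressure f y t) x) * R)"
    using g0 pressure_square[OF t(1) tT xO] by (simp add: power2_eq_square)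
  then have "pressure f x t / 2 \<le> norm (grad (\<lambda>y. pressure f y t) x) * R" using g0 by simp
  then show ?thesis using R_pos by (simp add: field_simps)
qed

text \<open>Every point is compared with one fixed collar point: the collar has finite parabolic
  diameter, so the Hoelder estimates bound the derivatives uniformly.\<close>

lemma collar_derivative_bounds:
  obtains C0 where "C0 > 0" and
    "\<And>x t. (x, t) \<in> collar \<Longrightarrow> norm (grad (\<lambda>y. pressure f y t) x) \<le> C0"
    "\<And>x t v w. (x, t) \<in> collar \<Longrightarrow> norm v = 1 \<Longrightarrow> norm w = 1 \<Longrightarrow>
      \<bar>dderiv2 (\<lambda>y. pressure f y t) x v w\<bar> \<le> C0"
proof (cases "collar = {}")
  case True
  then show ?thesis using that[of 1] by auto
next
  case False
  then obtain y s where ys: "(y, s) \<in> collar" by auto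
  obtain L where L1: "\<And>v. norm v = 1 \<Longrightarrow> parabolic_holder_on \<beta> L collar (\<lambda>x t. dderiv (\<lambda>y. pressure f y t) x v)"
    and L2: "\<And>v w. norm v = 1 \<Longrightarrow> norm w = 1 \<Longrightarrow>
      parabolic_holder_on \<beta> L collar (\<lambda>x t. dderiv2 (\<lambda>y. pressure f y t) x v w)"
    using holder_width(2) unfolding C2_holder_on_def by blast
  have in_slice: "0 \<le> t" "t \<le> T" "x \<in> collar_slice t" if "(x, t) \<in> collar" for x t
    using that unfolding collar_slice_def collar_def by auto
  \<comment> \<open>A bound for the parabolic diameter: the space slices lie in a ball of radius
    \<open>R\<close>, the times in [0, T].\<close>
  define m where "m = 2 * R + sqrt T"
  have dist: "dist x y + sqrt \<bar>t - s\<bar> \<le> m" if "(x, t) \<in> collar" for x t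
  proof -
    have "norm x < R" "norm y < R" using that ys dom[of t] dom[of s] unfolding collar_def by auto
    then have "dist x y \<le> 2 * R" using norm_triangle_ineq4[of x y] by (simp add: dist_norm)
    moreover have "sqrt \<bar>t - s\<bar> \<le> sqrt T" using that ys unfolding collar_def by auto
    ultimately show ?thesis unfolding m_def by linarith
  qed
  obtain b where b: "\<And>v w. norm (dderiv2 (\<lambda>y. pressure f y s) y v w) \<le> b * norm v * norm w"
    using bilinear_bounded[OF bilinear_dderiv2[OF pressure_twice_diff[OF in_slice(1,2)[OF ys]] in_slice(3)[OF ys]]] by blast
  define C where "C = norm (grad (\<lambda>y. pressure f y s) y) + \<bar>b\<bar> + \<bar>L\<bar> * m powr \<beta> + 1"
  have C: "C > 0" unfolding C_def by (simp add: add_nonneg_pos)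
  show ?thesis
  proof (rule that[OF C])
    fix x t and v w :: "real^'n" assume xt: "(x, t) \<in> collar"
    note p = in_slice[OF xt] and py = in_slice[OF ys]
    have D: "\<bar>dderiv (\<lambda>y. pressure f y t) x v\<bar> \<le> C" if v: "norm v = 1" for v
    proof -
      have "\<bar>dderiv (\<lambda>y. pressure f y t) x v\<bar> \<le> \<bar>dderiv (\<lambda>y. pressure f y s) y v\<bar> + \<bar>L\<bar> * m powr \<beta>"
        by (rule parabolic_holder_bounded[OF L1[OF v] holder(1) xt ys dist[OF xt]])
      moreover have "\<bar>dderiv (\<lambda>y. pressure f y s) y v\<bar> \<le> norm (grad (\<lambda>y. pressure f y s) y)"
        unfolding dderiv_eq_grad_inner[OF twice_diff_onD(3)[OF pressure_twice_diff[OF py(1,2)] py(3)]]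
        using Cauchy_Schwarz_ineq2[of _ v] v by simp
      ultimately show ?thesis unfolding C_def by linarith
    qed
    show "norm (grad (\<lambda>y. pressure f y t) x) \<le> C"
    proof (cases "grad (\<lambda>y. pressure f y t) x = 0")
      case False
      let ?G = "grad (\<lambda>y. pressure f y t) x"
      have "dderiv (\<lambda>y. pressure f y t) x (sgn ?G) = ?G \<bullet> sgn ?G"
        by (rule dderiv_eq_grad_inner[OF twice_diff_onD(3)[OF pressure_twice_diff[OF p(1,2)] p(3)]])
      also have "\<dots> = norm ?G" using False by (simp add: sgn_div_norm dot_square_norm power2_eq_square)
      finally show ?thesis using D[of "sgn ?G"] False by (simp add: norm_sgn)
    qed (use C in simp)
    assume v: "norm v = 1" "norm w = 1"
    have "\<bar>dderiv2 (\<lambda>y. pressure f y t) x v w\<bar> \<le> \<bar>dderiv2 (\<lambda>y. pressure f y s) y v w\<bar> + \<bar>L\<bar> * m powr \<beta>"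
      by (rule parabolic_holder_bounded[OF L2[OF v] holder(1) xt ys dist[OF xt]])
    moreover have "\<bar>dderiv2 (\<lambda>y. pressure f y s) y v w\<bar> \<le> \<bar>b\<bar>" using b[of v w] v by simp
    ultimately show "\<bar>dderiv2 (\<lambda>y. pressure f y t) x v w\<bar> \<le> C" unfolding C_def
      using norm_ge_zero[of "grad (\<lambda>y. pressure f y s) y"] by linarith
  qed
qed

text \<open>Time derivative of f = g^2 / 2, one-sided at t = 0. It expresses the speed by a quantity
  for which a Hoelder estimate is assumed.\<close>

lemma tderiv_pressure:
  assumes "(x, t) \<in> collar"
  shows "graph_speed (\<lambda>y. f y t) x = pressure f x t * tderiv (pressure f) x t"
proof -
  have t: "0 \<le> t" "t < Tc" and x: "x \<in> \<Omega> t" and g0: "pressure f x t > 0"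
    using assms T unfolding collar_def by auto
  have f0: "f x t > 0" using g0 pressure_pos_iff by simp
  have "((\<lambda>s. sqrt (2 * f x s)) has_real_derivative
      2 * graph_speed (\<lambda>y. f y t) x * (inverse (sqrt (2 * f x t)) / 2)) (at t within {0..})"
    using f0 by (auto intro!: derivative_eq_intros f_evolution[OF t x f0])
  moreover have "2 * a * (inverse b / 2) = a / b" for a b :: real by (cases "b = 0") (simp_all add: field_simps)
  ultimately have "((\<lambda>s. pressure f x s) has_vector_derivative graph_speed (\<lambda>y. f y t) x / pressure f x t) (at t within {0..})"
    unfolding pressure_def has_real_derivative_iff_has_vector_derivative[symmetric] by (simp only:)
  then have "tderiv (pressure f) x t = graph_speed (\<lambda>y. f y t) x / pressure f x t"
    unfolding tderiv_def using at_within_atLeast_neq_bot[OF t(1)] by (intro vector_derivative_within) auto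
  then show ?thesis using g0 by simp
qed

lemma pressure_continuous: "continuous_on {(x, t). 0 \<le> t \<and> t < Tc \<and> x \<in> \<Omega> t} (\<lambda>(x, t). pressure f x t)"
proof -
  have "continuous_on {(x, t). 0 \<le> t \<and> t < Tc \<and> x \<in> \<Omega> t} (\<lambda>z. sqrt (2 * (\<lambda>(x, t). f x t) z))"
    by (intro continuous_intros f_continuous)
  then show ?thesis unfolding pressure_def by (simp add: case_prod_beta')
qed

text \<open>Through u = g g_t, the Hoelder continuity of g_t gives continuity of the speed in
  space-time on the whole collar, including the initial time, as needed to attain a minimum.\<close>

lemma speed_continuous: "continuous_on collar (\<lambda>(x, t). graph_speed (\<lambda>y. f y t) x)"
proof -
  obtain L where "parabolic_holder_on \<beta> L collar (tderiv (pressure f))"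
    using holder_width(2) unfolding C2_holder_on_def by blast
  from parabolic_holder_continuous[OF this holder(1)]
  have 1: "continuous_on collar (\<lambda>(x, t). tderiv (pressure f) x t)" .
  have 2: "continuous_on collar (\<lambda>(x, t). pressure f x t)"
    by (rule continuous_on_subset[OF pressure_continuous]) (use T in \<open>auto simp: collar_def\<close>)
  have "continuous_on collar (\<lambda>z. (\<lambda>(x, t). pressure f x t) z * (\<lambda>(x, t). tderiv (pressure f) x t) z)"
    by (intro continuous_on_mult 1 2)
  then show ?thesis
    by (rule continuous_on_eq) (auto simp: tderiv_pressure)
qed

text \<open>The flat sides form the slice at height 0 of the compact space-time track of the flow,
  which gives closedness; boundedness comes from the ball of radius \<open>R\<close>.\<close>

lemma compact_flat_sides: "compact {(x, t). 0 \<le> t \<and> t \<le> T \<and> x \<in> flat_side \<Omega> f t}"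
proof -
  \<comment> \<open>The space-time track of the hypersurface, a continuous image of the compact set
    S x [0, T].\<close>
  define K where "K = (\<lambda>(p, t). (X p t, t)) ` (S \<times> {0..T})"
  have "compact S"
    using initial unfolding initial_hypersurface_def by (auto intro: compact_frontier)
  have "continuous_on (S \<times> {0..<Tc}) (\<lambda>(p, t). X p t)"
    using flow unfolding scalar_curvature_flow_def by blast
  then have "continuous_on (S \<times> {0..T}) (\<lambda>(p, t). X p t)"
    by (rule continuous_on_subset) (use T in auto)
  then have "continuous_on (S \<times> {0..T}) (\<lambda>z. ((\<lambda>(p, t). X p t) z, snd z))"
    by (intro continuous_on_Pair continuous_on_snd continuous_on_id)
  then have "continuous_on (S \<times> {0..T}) (\<lambda>(p, t). (X p t, t))" by (simp add: case_prod_beta')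
  then have "compact K" unfolding K_def
    using \<open>compact S\<close> by (intro compact_continuous_image compact_Times) auto
  then have cl: "closed ((\<lambda>z. ((fst z, 0), snd z)) -` K)"
    by (intro closed_vimage compact_imp_closed continuous_intros)
  have M: "M t = (\<lambda>p. X p t) ` S" if "0 \<le> t" "t \<le> T" for t
    using flow that T unfolding scalar_curvature_flow_def by auto
  have eq: "(\<lambda>z. ((fst z, 0), snd z)) -` K = {(x, t). 0 \<le> t \<and> t \<le> T \<and> x \<in> flat_side \<Omega> f t}"
  proof (intro set_eqI)
    fix z :: "(real^'n) \<times> real"
    obtain x t where z: "z = (x, t)" by (cases z)
    show "z \<in> (\<lambda>z. ((fst z, 0), snd z)) -` K \<longleftrightarrow> z \<in> {(x, t). 0 \<le> t \<and> t \<le> T \<and> x \<in> flat_side \<Omega> f t}"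
    proof (cases "0 \<le> t \<and> t \<le> T")
      case True
      then have "flat_side \<Omega> f t = {x. (x, 0) \<in> (\<lambda>p. X p t) ` S}"
        using graph_facts(3)[of t] M[of t] T by auto
      then show ?thesis unfolding z K_def using True by (auto simp: image_iff)
    next
      case False
      then show ?thesis unfolding z K_def by auto
    qed
  qed
  have "{(x, t). 0 \<le> t \<and> t \<le> T \<and> x \<in> flat_side \<Omega> f t} \<subseteq> ball 0 R \<times> {0..T}"
    using dom unfolding flat_side_def by auto
  moreover have "bounded (ball (0::real^'n) R \<times> {0..T})" by (intro bounded_Times) auto
  ultimately have "bounded {(x, t). 0 \<le> t \<and> t \<le> T \<and> x \<in> flat_side \<Omega> f t}" using bounded_subset by blast
  with cl eq show ?thesis by (simp add: compact_eq_bounded_closed)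
qed

text \<open>The domains are open and move, so sublevel sets could a priori reach their boundary. A
  closed tube around the compact flat sides stays in the domain and f >= m > 0 on its lateral
  boundary; by convexity along segments to the origin, f < m is then possible only inside the
  tube.\<close>

lemma sublevel_compact:
  obtains d where "d > 0" and
    "\<And>a b. b \<le> d \<Longrightarrow> compact {(x, t). 0 \<le> t \<and> t \<le> T \<and> x \<in> \<Omega> t \<and> a \<le> pressure f x t \<and> pressure f x t \<le> b}"
proof -
  define P where "P = {(x, t). 0 \<le> t \<and> t \<le> T \<and> x \<in> flat_side \<Omega> f t}"
  let ?O = "{(x, t). 0 \<le> t \<and> t < Tc \<and> x \<in> \<Omega> t}"
  have cP: "compact P" unfolding P_def by (rule compact_flat_sides)
  obtain W where W: "open W" "?O = (UNIV \<times> {0..<Tc}) \<inter> W" using spacetime_domain .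
  have "P \<subseteq> ?O" unfolding P_def flat_side_def using T by auto
  then have PW: "P \<subseteq> W" using W(2) by blast
  have "(0, 0) \<in> P" using zero_in_flat_side[of 0] T unfolding P_def by simp
  then have Pne: "P \<noteq> {}" by blast
  \<comment> \<open>The radius of the tube: its closed balls stay in the open set \<open>W\<close>
    that cuts out the space-time domain.\<close>
  obtain r where r: "r > 0" "(\<Union>p\<in>P. cball p r) \<subseteq> W"
    using compact_subset_open_imp_cball_epsilon_subset[OF cP W(1) PW] by blast
  define N where "N = {z. infdist z P \<le> r} \<inter> (UNIV \<times> {0..T})"
  have cN: "compact N" unfolding N_def
    using compact_infdist_le[OF Pne cP r(1)] by (intro compact_Int_closed closed_Times) auto
  have NO: "N \<subseteq> ?O"
  proof
    fix z assume z: "z \<in> N"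
    obtain p where p: "p \<in> P" "infdist z P = dist z p"
      using infdist_attains_inf[OF compact_imp_closed[OF cP] Pne, of z] by blast
    then have "z \<in> cball p r" using z unfolding N_def by (simp add: dist_commute)
    then have "z \<in> W" using r(2) p(1) by blast
    moreover have "z \<in> UNIV \<times> {0..<Tc}" using z T unfolding N_def by auto
    ultimately show "z \<in> ?O" unfolding W(2) by simp
  qed
  have cfN: "continuous_on N (\<lambda>(x, t). f x t)" using continuous_on_subset[OF f_continuous NO] .
  \<comment> \<open>The lateral boundary of the tube; f is positive there because the distance to
    all zeros of f is \<open>r\<close> > 0.\<close>
  define Y where "Y = N \<inter> {z. infdist z P = r}"
  have "closed {z. infdist z P = r}" by (intro closed_Collect_eq continuous_intros)
  then have cY: "compact Y" unfolding Y_def using cN by (intro compact_Int_closed)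
  have Ypos: "(\<lambda>(x, t). f x t) z > 0" if "z \<in> Y" for z
  proof -
    obtain x t where z: "z = (x, t)" by (cases z)
    have zN: "z \<in> N" and zr: "infdist z P = r" using that unfolding Y_def by auto
    have xt: "0 \<le> t" "t \<le> T" "x \<in> \<Omega> t" using zN NO z unfolding N_def by auto
    have "f x t \<noteq> 0"
    proof
      assume "f x t = 0"
      then have "z \<in> P" unfolding P_def flat_side_def z using xt by simp
      then show False using zr r(1) by simp
    qed
    then show ?thesis using graph_facts(2)[of t x] xt T z by simp
  qed
  obtain m where m: "m > 0" "\<And>z. z \<in> Y \<Longrightarrow> m \<le> (\<lambda>(x, t). f x t) z"
  proof (cases "Y = {}")
    case True
    then show ?thesis using that[of 1] by simp
  next
    case False
    have "continuous_on Y (\<lambda>(x, t). f x t)" by (rule continuous_on_subset[OF cfN]) (auto simp: Y_def)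
    from continuous_attains_inf[OF cY False this] Ypos show ?thesis using that by blast
  qed
  have inN: "(x, t) \<in> N" if t: "0 \<le> t" "t \<le> T" and x: "x \<in> \<Omega> t" and fx: "f x t < m" for x t
  proof (rule ccontr)
    assume "(x, t) \<notin> N"
    then have far: "infdist (x, t) P > r" unfolding N_def using t by auto
    have tT: "t < Tc" using t T by simp
    have z0: "0 \<in> \<Omega> t" "f 0 t = 0" "(0, t) \<in> P"
      using zero_in_flat_side[OF t] t unfolding P_def flat_side_def by auto
    \<comment> \<open>The segment from the origin, which lies in the flat side at the same time, to
      the point must cross \<open>Y\<close>; by convexity f <= f(x) < m there.\<close>
    define h where "h s = infdist (s *\<^sub>R x, t) P" for s
    have h0: "h 0 \<le> r" "r \<le> h 1" unfolding h_def using z0(3) far r(1) by auto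
    have "continuous_on {0..1} h" unfolding h_def by (intro continuous_intros)
    then obtain s where s: "0 \<le> s" "s \<le> 1" "h s = r" using IVT'[of h 0 r 1] h0 by auto
    have "(s *\<^sub>R x, t) \<in> Y" unfolding Y_def N_def using s t unfolding h_def by auto
    then have "m \<le> f (s *\<^sub>R x) t" using m(2) by force
    moreover have "f (s *\<^sub>R x) t \<le> (1 - s) * f 0 t + s * f x t"
      using convex_onD[OF graph_facts(1)[OF t(1) tT], of s 0 x] s z0 x by simp
    moreover have "s * f x t \<le> f x t" using s graph_facts(2)[OF t(1) tT x] by (simp add: mult_left_le_one_le)
    ultimately show False using fx z0 by simp
  qed
  show ?thesis
  proof (rule that[of "sqrt m"])
    show "sqrt m > 0" using m by simp
    fix a b assume b: "b \<le> sqrt m"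
    let ?Q = "{(x, t). 0 \<le> t \<and> t \<le> T \<and> x \<in> \<Omega> t \<and> a \<le> pressure f x t \<and> pressure f x t \<le> b}"
    have "?Q = N \<inter> (\<lambda>(x, t). pressure f x t) -` {a..b}"
    proof (intro set_eqI iffI)
      fix z assume "z \<in> ?Q"
      then obtain x t where z: "z = (x, t)" "0 \<le> t" "t \<le> T" "x \<in> \<Omega> t" "a \<le> pressure f x t" "pressure f x t \<le> b"
        by auto
      have "2 * f x t \<le> m" using z(6) b unfolding pressure_def by (meson order_trans real_sqrt_le_iff)
      then have "f x t < m" using m(1) by simp
      then show "z \<in> N \<inter> (\<lambda>(x, t). pressure f x t) -` {a..b}" using inN z by simp
    next
      fix z assume z: "z \<in> N \<inter> (\<lambda>(x, t). pressure f x t) -` {a..b}"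
      then have "z \<in> ?O" using NO by blast
      with z show "z \<in> ?Q" unfolding N_def by auto
    qed
    moreover have "closed (N \<inter> (\<lambda>(x, t). pressure f x t) -` {a..b})"
      using continuous_on_subset[OF pressure_continuous NO] compact_imp_closed[OF cN]
      by (intro continuous_closed_preimage) auto
    then have "compact (N \<inter> (N \<inter> (\<lambda>(x, t). pressure f x t) -` {a..b}))"
      using cN by (intro compact_Int_closed)
    ultimately show "compact ?Q" by (simp add: Int_absorb2 inf.left_idem)
  qed
qed

end

section \<open>Lower bound for the speed\<close>

lemma speed_scalar_nonneg:
  fixes q :: real
  assumes "0 \<le> S" "c2 \<le> F * T" "1 \<le> q"
  shows "0 \<le> (S + (F * T - c2) / q) / sqrt q"
  using assms by (intro divide_nonneg_nonneg add_nonneg_nonneg) auto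

text \<open>To leading order F >= (l / 2)^2 and T >= g l / 2, so F T >= g l^3 / 8; the corrections
  are O(g^2), and the smallness condition on \<open>g\<close> lets them consume at most half of
  this.\<close>

lemma speed_scalar_lower:
  fixes q :: real
  assumes S: "0 \<le> S" and q: "1 \<le> q" "q \<le> Q" and g: "0 \<le> g" "(C0 * l / 2 + C1) * g \<le> l ^ 3 / 16"
    and l: "0 < l" "l / 2 \<le> \<gamma>" and F: "F = g * g11 + \<gamma>\<^sup>2" "\<bar>g11\<bar> \<le> C0" and T: "g * (l / 2) \<le> T" "0 \<le> T"
    and c2: "c2 \<le> C1 * g\<^sup>2" "c2 \<le> F * T" and C0: "0 < C0" and C1: "0 < C1" and G: "G = (S + (F * T - c2) / q) / sqrt q"
  shows "l ^ 3 / 16 / (Q * sqrt Q) * g \<le> G"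
proof -
  have Q: "1 \<le> Q" "0 < Q" using q by auto
  have F': "(l\<^sup>2 / 4 - C0 * g) \<le> F"
  proof -
    have "(l / 2)\<^sup>2 \<le> \<gamma>\<^sup>2" using l by (intro power_mono) auto
    then have "l\<^sup>2 / 4 \<le> \<gamma>\<^sup>2" by (simp add: power_divide)
    moreover have "- (C0 * g) \<le> g * g11"
      using mult_left_mono[of "- C0" g11 g] F(2) g by (simp add: mult.commute abs_le_iff)
    ultimately show ?thesis unfolding F(1) by linarith
  qed
  have D: "l ^ 3 / 16 * g \<le> F * T - c2"
  proof (cases "l\<^sup>2 / 4 - C0 * g \<ge> 0")
    case True
    have "(l\<^sup>2 / 4 - C0 * g) * (g * (l / 2)) \<le> F * T"
      using F' T True g l by (intro mult_mono) auto
    moreover have "(l\<^sup>2 / 4 - C0 * g) * (g * (l / 2)) - C1 * g\<^sup>2 = g * (l ^ 3 / 8 - (C0 * l / 2 + C1) * g)"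
      by (simp add: field_simps power2_eq_square power3_eq_cube)
    moreover have "g * (l ^ 3 / 16) \<le> g * (l ^ 3 / 8 - (C0 * l / 2 + C1) * g)"
      using g by (intro mult_left_mono) linarith+
    ultimately show ?thesis using c2(1) by (simp add: mult.commute)
  next
    case False
    \<comment> \<open>This case contradicts the smallness of \<open>g\<close>: that condition gives
      8 y <= l^3, while a nonpositive lower bound for F gives l^3 <= 4 y.\<close>
    define y where "y = C0 * (g * l)"
    have "8 * y + 16 * (C1 * g) \<le> l ^ 3" using g(2) unfolding y_def by (simp add: algebra_simps)
    moreover have "l\<^sup>2 / 4 * (l / 2) \<le> C0 * g * (l / 2)" using False l by (intro mult_right_mono) auto
    then have "l ^ 3 \<le> 4 * y" unfolding y_def by (simp add: power2_eq_square power3_eq_cube algebra_simps)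
    moreover have "0 < l ^ 3" "0 \<le> C1 * g" using l C1 g by auto
    ultimately have False by linarith
    then show ?thesis ..
  qed
  then have D0: "0 \<le> F * T - c2" using c2 by simp
  have "(F * T - c2) / Q \<le> (F * T - c2) / q" using D0 q by (intro divide_left_mono) auto
  also have "\<dots> \<le> S + (F * T - c2) / q" using S by simp
  finally have 1: "(F * T - c2) / Q \<le> S + (F * T - c2) / q" .
  have "(F * T - c2) / Q / sqrt Q \<le> (S + (F * T - c2) / q) / sqrt q"
  proof (intro frac_le)
    show "0 \<le> S + (F * T - c2) / q" using S D0 q by (intro add_nonneg_nonneg divide_nonneg_nonneg) auto
  qed (use 1 q in auto)
  moreover have "l ^ 3 / 16 * g / (Q * sqrt Q) \<le> (F * T - c2) / (Q * sqrt Q)"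
    using D Q by (intro divide_right_mono) auto
  ultimately show ?thesis unfolding G by simp
qed

text \<open>From c g <= T (F + T / 2), an upper bound for either factor yields a lower bound for the
  other. The summand T / 2 is O(g), and g <= c / C1^2 keeps its contribution below c / 2.\<close>

lemma speed_scalar_consequences:
  fixes q :: real
  assumes S: "0 \<le> S" "S \<le> T\<^sup>2 / 2" and q: "1 \<le> q" and c2: "0 \<le> c2" "c2 \<le> F * T"
    and T: "0 \<le> T" "T \<le> C1 * g" and F: "F \<le> C2" and g: "0 < g" "g \<le> 1" and C: "0 < C1" "0 < C2" and c: "0 < c"
    and G: "G = (S + (F * T - c2) / q) / sqrt q" and low: "c * g \<le> G" and small: "g \<le> c / C1\<^sup>2"
  shows "c / (C2 + C1) * g \<le> T" "c / (2 * C1) \<le> F"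
proof -
  have "G \<le> S + (F * T - c2) / q"
  proof -
    have "0 \<le> S + (F * T - c2) / q" using S c2 q by auto
    then have "(S + (F * T - c2) / q) / sqrt q \<le> (S + (F * T - c2) / q) / 1" using q by (intro divide_left_mono) auto
    then show ?thesis unfolding G by simp
  qed
  also have "(F * T - c2) / q \<le> (F * T - c2) / 1" using c2 q by (intro divide_left_mono) auto
  finally have "G \<le> T\<^sup>2 / 2 + F * T" using S c2 by simp
  then have m: "c * g \<le> T * (F + T / 2)" using low by (simp add: algebra_simps power2_eq_square)
  have Tu: "T \<le> C1" using T(2) mult_left_mono[OF g(2), of C1] C by linarith
  have cg: "0 < c * g" using c g by simp
  then have FT: "0 < T * (F + T / 2)" using m by linarith
  then have pos: "0 < T" "0 < F + T / 2" using T(1) by (auto simp: zero_less_mult_iff)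
  have "c * g \<le> T * (C2 + C1)"
  proof -
    have "T * (F + T / 2) \<le> T * (C2 + C1)" using F Tu T(1) by (intro mult_left_mono) auto
    then show ?thesis using m by linarith
  qed
  then show "c / (C2 + C1) * g \<le> T" using C by (simp add: field_simps)
  have "T * (F + T / 2) \<le> (C1 * g) * (F + C1 * g / 2)" using T pos C g by (intro mult_mono) auto
  then have "g * c \<le> g * (C1 * (F + C1 * g / 2))" using m by (simp add: mult_ac)
  then have "c \<le> C1 * (F + C1 * g / 2)" using g by simp
  moreover have "C1 * (C1 * g / 2) \<le> c / 2"
  proof -
    have "g * C1\<^sup>2 \<le> c" using small C by (simp add: pos_le_divide_eq)
    then show ?thesis by (simp add: power2_eq_square mult_ac)
  qed
  ultimately have "c / 2 \<le> C1 * F" by (simp add: distrib_left)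
  then show "c / (2 * C1) \<le> F" using C by (simp add: field_simps)
qed

section \<open>The initial bound and its propagation by the minimum principle\<close>

context flat_graph_flow
begin

text \<open>Translates the geometry at one collar point into exactly the data that the scalar
  inequalities consume; \<open>A\<close> is the second elementary symmetric function of the
  tangential block.\<close>

lemma collar_point:
  assumes xt: "(x, t) \<in> collar" and e: "adapted_frame (\<lambda>y. pressure f y t) x k e"
    and b: "\<And>v w. norm v = 1 \<Longrightarrow> norm w = 1 \<Longrightarrow> \<bar>dderiv2 (\<lambda>y. pressure f y t) x v w\<bar> \<le> C0"
    and C1: "C1 = real CARD('n) * (C0 + C0\<^sup>2)"
  defines "F \<equiv> \<lambda>i j. dderiv2 (\<lambda>y. f y t) x (e i) (e j)" and "g \<equiv> pressure f x t"
    and "\<gamma> \<equiv> norm (grad (\<lambda>y. pressure f y t) x)" and "g1 \<equiv> \<lambda>i j. dderiv2 (\<lambda>y. pressure f y t) x (e i) (e j)"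
  defines "Tr \<equiv> (\<Sum>i\<in>UNIV-{k}. F i i)" and "c2 \<equiv> (\<Sum>i\<in>UNIV-{k}. (F i k)\<^sup>2)" and "q \<equiv> 1 + (g * \<gamma>)\<^sup>2"
  obtains A where "0 \<le> A" "A \<le> Tr\<^sup>2 / 2" "graph_speed (\<lambda>y. f y t) x = (A + (F k k * Tr - c2) / q) / sqrt q"
    "0 \<le> Tr" "Tr \<le> C1 * g" "0 \<le> c2" "c2 \<le> C1 * g\<^sup>2" "c2 \<le> F k k * Tr"
    "F k k = g * g1 k k + \<gamma>\<^sup>2" "\<bar>g1 k k\<bar> \<le> C0" "Tr = g * (\<Sum>i\<in>UNIV-{k}. g1 i i)"
proof -
  have t: "0 \<le> t" "t \<le> T" and g0: "g > 0" and x: "x \<in> collar_slice t"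
    using xt unfolding collar_def collar_slice_def g_def by auto
  have pr: "(\<lambda>y. sqrt (2 * f y t)) = (\<lambda>y. pressure f y t)" unfolding pressure_def by simp
  note tw = f_twice_diff[OF t] and pos = collar_slice_pos[OF t] and conv = f_hessian_nonneg[OF t x]
  note PI = pressure_identities[OF tw pos]
  have on: "e i \<bullet> e j = of_bool (i = j)" for i j using e unfolding adapted_frame_def by blast
  have ne: "norm (e i) = 1" for i using on[of i i] by (simp add: norm_eq_1)
  have De: "dderiv (\<lambda>y. pressure f y t) x (e i) = (if i = k then \<gamma> else 0)" for i
    unfolding \<gamma>_def by (rule adapted_frame_dderiv[OF e twice_diff_onD(3)[OF pressure_twice_diff[OF t] x]])
  have Fe: "F i j = g * g1 i j + (if i = k then \<gamma> else 0) * (if j = k then \<gamma> else 0)" for i j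
    using PI(3)[OF x, of "e i" "e j"] unfolding pr De F_def g1_def g_def pressure_def[symmetric] .
  have g1b: "\<bar>g1 i j\<bar> \<le> C0" for i j unfolding g1_def by (rule b[OF ne ne])
  note TH0 = tangential_hessian_bounds[OF bilinear_dderiv2[OF tw x] dderiv2_commute[OF tw x] conv, of e k]
  have TH: "0 \<le> Tr" "0 \<le> c2" "c2 \<le> F k k * Tr"
    unfolding Tr_def c2_def F_def by (rule TH0)+
  note PH = pressure_hessian_bounds[OF Fe g1b g0 C1, folded Tr_def c2_def]
  have Tr: "Tr = g * (\<Sum>i\<in>UNIV-{k}. g1 i i)"
    unfolding Tr_def sum_distrib_left by (intro sum.cong) (auto simp: Fe)
  obtain A where A: "0 \<le> A" "A \<le> Tr\<^sup>2 / 2"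
    "graph_speed (\<lambda>y. f y t) x = (A + (F k k * Tr - c2) / q) / sqrt q"
    using graph_speed_adapted[OF tw x pos, unfolded pr, OF e conv]
    unfolding F_def Tr_def c2_def q_def g_def \<gamma>_def pressure_def by blast
  show ?thesis by (rule that[OF A TH(1) PH(1) TH(2) PH(2) TH(3) PH(3) g1b Tr])
qed

text \<open>The assumption concerns limits at single interface points, whereas a uniform collar and
  frames adapted at nearby points are needed. Bad points with g tending to 0 would accumulate, by
  compactness of the sublevel sets, at an interface point, where the limits contradict them.\<close>

lemma initial_nondegeneracy:
  assumes l0: "l0 > 0" "initially_nondegenerate l0 \<Omega> f" and dim: "CARD('n) \<ge> 2"
  obtains d where "d > 0" and
    "\<forall>x k e. x \<in> \<Omega> 0 \<longrightarrow> 0 < pressure f x 0 \<longrightarrow> pressure f x 0 < d \<longrightarrow>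
       adapted_frame (\<lambda>y. pressure f y 0) x k e \<longrightarrow>
       l0 / 2 \<le> norm (grad (\<lambda>y. pressure f y 0) x) \<and>
       l0 / 2 \<le> (\<Sum>i\<in>UNIV-{k}. dderiv2 (\<lambda>y. pressure f y 0) x (e i) (e i))"
proof -
  define g where "g = (\<lambda>y. pressure f y 0)"
  define good where "good x \<longleftrightarrow> (\<forall>k e. adapted_frame g x k e \<longrightarrow> l0 / 2 \<le> norm (grad g x) \<and>
       l0 / 2 \<le> (\<Sum>i\<in>UNIV-{k}. dderiv2 g x (e i) (e i)))" for x
  have "\<exists>d>0. \<forall>x\<in>\<Omega> 0. 0 < g x \<and> g x < d \<longrightarrow> good x"
  proof (rule ccontr)
    assume neg: "\<not> ?thesis"
    obtain d0 where d0: "d0 > 0" and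
      Q: "\<And>a b. b \<le> d0 \<Longrightarrow> compact {(x, t). 0 \<le> t \<and> t \<le> T \<and> x \<in> \<Omega> t \<and> a \<le> pressure f x t \<and> pressure f x t \<le> b}"
      using sublevel_compact by blast
    obtain C0 where C0: "C0 > 0" and
      C0': "\<And>x t v w. (x, t) \<in> collar \<Longrightarrow> norm v = 1 \<Longrightarrow> norm w = 1 \<Longrightarrow>
        \<bar>dderiv2 (\<lambda>y. pressure f y t) x v w\<bar> \<le> C0"
      using collar_derivative_bounds by metis
    have "\<exists>x. x \<in> \<Omega> 0 \<and> 0 < g x \<and> g x < min (min d0 holder_width) (1 / real (Suc n)) \<and> \<not> good x" for n
      using neg d0 holder_width(1) by (auto simp del: of_nat_Suc dest!: spec[of _ "min (min d0 holder_width) (1 / real (Suc n))"])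
    then obtain X where X: "\<And>n. X n \<in> \<Omega> 0" "\<And>n. 0 < g (X n)" "\<And>n. g (X n) < min (min d0 holder_width) (1 / real (Suc n))"
      "\<And>n. \<not> good (X n)"
      by metis
    let ?Q = "{(x, t). 0 \<le> t \<and> t \<le> T \<and> x \<in> \<Omega> t \<and> 0 \<le> pressure f x t \<and> pressure f x t \<le> d0}"
    have XQ: "\<forall>n. (X n, 0) \<in> ?Q" using X(1-3) T unfolding g_def by (auto simp: less_imp_le)
    have sc: "seq_compact ?Q" using Q[OF order_refl, of 0] compact_eq_seq_compact_metric by blast
    obtain z r where z: "z \<in> ?Q" "strict_mono r" "((\<lambda>n. (X n, 0)) \<circ> r) \<longlonglongrightarrow> z"
      by (rule seq_compactE[OF sc XQ])
    obtain x s where zx: "z = (x, s)" by (cases z)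
    have limx: "(\<lambda>n. X (r n)) \<longlonglongrightarrow> x" using tendsto_fst[OF z(3)] zx by (simp add: o_def)
    have "s = 0" using tendsto_snd[OF z(3)] zx by (simp add: o_def LIMSEQ_const_iff)
    then have x: "x \<in> \<Omega> 0" using z(1) zx by simp
    have gc: "continuous_on (\<Omega> 0) g"
      unfolding g_def pressure_def using T by (intro continuous_intros f_slice_continuous) auto
    have "(\<lambda>n. g (X (r n))) \<longlonglongrightarrow> g x"
      by (rule continuous_on_tendsto_compose[OF gc limx x]) (use X(1) in simp)
    moreover have "(\<lambda>n. g (X (r n))) \<longlonglongrightarrow> 0"
    proof (rule tendsto_sandwich[OF _ _ tendsto_const])
      have "(\<lambda>n. 1 / real (Suc n)) \<longlonglongrightarrow> 0" by (rule LIMSEQ_Suc[OF lim_1_over_n])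
      then show "(\<lambda>n. 1 / real (Suc (r n))) \<longlonglongrightarrow> 0"
        using LIMSEQ_subseq_LIMSEQ[OF _ z(2)] by (force simp: o_def)
    qed (use X(2,3) in \<open>auto intro!: always_eventually simp: less_imp_le simp del: of_nat_Suc\<close>)
    ultimately have "g x = 0" by (rule LIMSEQ_unique)
    then have fx: "f x 0 = 0" unfolding g_def pressure_def by simp
    have Xf: "f (X n) 0 > 0" for n using X(2)[of n] pressure_pos_iff unfolding g_def by simp
    \<comment> \<open>f vanishes at the limit point, but the points that converge to it have f > 0,
      so it is not interior to the flat side.\<close>
    have "x \<in> flat_interface \<Omega> f 0"
    proof -
      have "x \<in> flat_side \<Omega> f 0" unfolding flat_side_def using x fx by simp
      moreover have "x \<notin> interior (flat_side \<Omega> f 0)"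
      proof
        assume "x \<in> interior (flat_side \<Omega> f 0)"
        then have "eventually (\<lambda>n. X (r n) \<in> interior (flat_side \<Omega> f 0)) sequentially"
          using topological_tendstoD[OF limx open_interior] by blast
        then obtain n where "X (r n) \<in> interior (flat_side \<Omega> f 0)"
          using eventually_happens'[OF sequentially_bot] by metis
        then have "X (r n) \<in> flat_side \<Omega> f 0" using interior_subset by (rule rev_subsetD)
        then show False using Xf[of "r n"] unfolding flat_side_def by simp
      qed
      ultimately show ?thesis unfolding flat_interface_def frontier_def using closure_subset by blast
    qed
    define FF where "FF = at x within {y \<in> \<Omega> 0. f y 0 > 0}"
    have fl: "filterlim (\<lambda>n. X (r n)) FF sequentially"
    proof -
      have "X (r n) \<noteq> x" for n using Xf[of "r n"] fx by auto
      then have "\<forall>\<^sub>F n in sequentially. X (r n) \<in> {y \<in> \<Omega> 0. f y 0 > 0} \<and> X (r n) \<noteq> x"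
        using X(1) Xf by (intro always_eventually) simp
      then show ?thesis unfolding FF_def filterlim_at using limx by blast
    qed
    have "\<exists>G. (grad g \<longlongrightarrow> G) FF \<and> norm G \<ge> l0 \<and>
        (\<forall>\<tau>. norm \<tau> = 1 \<and> \<tau> \<bullet> G = 0 \<longrightarrow> (\<exists>l. ((\<lambda>y. dderiv2 g y \<tau> \<tau>) \<longlongrightarrow> l) FF \<and> l \<ge> l0))"
      unfolding g_def FF_def
      by (rule bspec[OF l0(2)[unfolded initially_nondegenerate_def Let_def] \<open>x \<in> flat_interface \<Omega> f 0\<close>])
    then obtain G where G: "(grad g \<longlongrightarrow> G) FF" "norm G \<ge> l0" and
      Gt: "\<And>\<tau>. norm \<tau> = 1 \<Longrightarrow> \<tau> \<bullet> G = 0 \<Longrightarrow> \<exists>l. ((\<lambda>y. dderiv2 g y \<tau> \<tau>) \<longlongrightarrow> l) FF \<and> l \<ge> l0"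
      by blast
    have G0: "G \<noteq> 0" using G(2) l0 by auto
    fix k0 :: 'n
    have "norm (sgn G) = 1" using G0 by (simp add: norm_sgn)
    then obtain e0 :: "'n \<Rightarrow> real^'n" where e0: "\<And>i j. e0 i \<bullet> e0 j = of_bool (i = j)" "e0 k0 = sgn G"
      using orthonormal_frame_exists[of "sgn G" k0] by blast
    have e0n: "norm (e0 i) = 1" for i using e0(1)[of i i] by (simp add: norm_eq_1)
    have limG: "(\<lambda>n. grad g (X (r n))) \<longlonglongrightarrow> G" by (rule filterlim_compose[OF G(1) fl])
    have ev1: "eventually (\<lambda>n. l0 / 2 < norm (grad g (X (r n)))) sequentially"
      by (rule order_tendstoD(1)[OF tendsto_norm[OF limG]]) (use G(2) l0 in simp)
    \<comment> \<open>The constant 3/4 leaves room for two errors of size l0 / 8 when the normal is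
      replaced.\<close>
    have ev2: "eventually (\<lambda>n. \<forall>i\<in>UNIV-{k0}. 3 / 4 * l0 < dderiv2 g (X (r n)) (e0 i) (e0 i)) sequentially"
    proof (rule eventually_ball_finite)
      show "\<forall>i\<in>UNIV-{k0}. eventually (\<lambda>n. 3 / 4 * l0 < dderiv2 g (X (r n)) (e0 i) (e0 i)) sequentially"
      proof
        fix i assume "i \<in> UNIV - {k0}"
        then have "e0 i \<bullet> sgn G = 0" using e0(1)[of i k0] e0(2) by simp
        then have "e0 i \<bullet> G = 0" using G0 by (simp add: sgn_div_norm)
        then obtain l where l: "((\<lambda>y. dderiv2 g y (e0 i) (e0 i)) \<longlongrightarrow> l) FF" "l \<ge> l0" using Gt[OF e0n] by blast
        show "eventually (\<lambda>n. 3 / 4 * l0 < dderiv2 g (X (r n)) (e0 i) (e0 i)) sequentially"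
          by (rule order_tendstoD(1)[OF filterlim_compose[OF l(1) fl]]) (use l(2) l0 in simp)
      qed
    qed simp
    have "(\<lambda>n. norm (sgn (grad g (X (r n))) - sgn G)) \<longlonglongrightarrow> 0"
      using tendsto_norm[OF tendsto_diff[OF tendsto_sgn[OF limG G0] tendsto_const[of "sgn G"]]] by simp
    \<comment> \<open>Since the Hessian of g is bounded by \<open>C0\<close>, changing one argument
      by this amount costs at most l0 / 8.\<close>
    then have ev3: "eventually (\<lambda>n. norm (sgn (grad g (X (r n))) - sgn G) < l0 / (8 * C0)) sequentially"
      by (rule order_tendstoD(2)) (use l0 C0 in simp)
    obtain n where n1: "l0 / 2 < norm (grad g (X (r n)))"
      and n2: "\<And>i. i \<noteq> k0 \<Longrightarrow> 3 / 4 * l0 < dderiv2 g (X (r n)) (e0 i) (e0 i)"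
      and n3: "norm (sgn (grad g (X (r n))) - sgn G) < l0 / (8 * C0)"
      using eventually_happens'[OF sequentially_bot eventually_conj[OF ev1 eventually_conj[OF ev2 ev3]]] by blast
    define y where "y = X (r n)"
    have yc: "(y, 0) \<in> collar" using X(1,2,3)[of "r n"] T unfolding collar_def y_def g_def by auto
    then have ys: "y \<in> collar_slice 0" unfolding collar_slice_def by simp
    have B: "bilinear (dderiv2 g y)"
      unfolding g_def by (rule bilinear_dderiv2[OF pressure_twice_diff ys]) (use T in auto)
    have Bb: "\<bar>dderiv2 g y v w\<bar> \<le> C0 * norm v * norm w" for v w
      by (rule bilinear_unit_bound[OF B]) (use C0'[OF yc] in \<open>simp add: g_def\<close>)
    have "good y" unfolding good_def
    proof (intro allI impI conjI)
      fix k and e :: "'n \<Rightarrow> real^'n" assume e: "adapted_frame g y k e"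
      show "l0 / 2 \<le> norm (grad g y)" using n1 unfolding y_def by simp
      have on: "e i \<bullet> e j = of_bool (i = j)" for i j using e unfolding adapted_frame_def by blast
      define \<nu> where "\<nu> = sgn (grad g y)"
      have ek: "e k = \<nu>" using e unfolding adapted_frame_def \<nu>_def by simp
      have nk: "norm \<nu> = 1" using on[of k k] unfolding ek by (simp add: norm_eq_1)
      have split: "(\<Sum>i\<in>UNIV. a i) = a k + (\<Sum>i\<in>UNIV-{k}. a i)" for a :: "'n \<Rightarrow> real" and k
        by (rule sum.remove) auto
      \<comment> \<open>The full trace does not depend on the frame, so the two tangential traces
        differ only by the normal entries. Hence only the normals have to be close; the tangential
        frames need not converge.\<close>
      have tr: "(\<Sum>i\<in>UNIV. dderiv2 g y (e i) (e i)) = (\<Sum>i\<in>UNIV. dderiv2 g y (e0 i) (e0 i))"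
        using bilinear_trace_frame[OF on B] bilinear_trace_frame[OF e0(1) B] by simp
      have "dderiv2 g y (e0 k0) (e0 k0) - dderiv2 g y \<nu> \<nu> =
          dderiv2 g y (e0 k0 - \<nu>) (e0 k0) + dderiv2 g y \<nu> (e0 k0 - \<nu>)"
        by (simp add: bilinear_lsub[OF B] bilinear_rsub[OF B])
      moreover have "\<bar>dderiv2 g y (e0 k0 - \<nu>) (e0 k0)\<bar> \<le> l0 / 8" "\<bar>dderiv2 g y \<nu> (e0 k0 - \<nu>)\<bar> \<le> l0 / 8"
      proof -
        have "C0 * norm (e0 k0 - \<nu>) \<le> C0 * (l0 / (8 * C0))"
          using n3 C0 unfolding y_def[symmetric] \<nu>_def[symmetric] e0(2)
          by (intro mult_left_mono) (auto simp: norm_minus_commute less_imp_le)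
        also have "\<dots> = l0 / 8" using C0 by simp
        finally have "C0 * norm (e0 k0 - \<nu>) \<le> l0 / 8" .
        then show "\<bar>dderiv2 g y (e0 k0 - \<nu>) (e0 k0)\<bar> \<le> l0 / 8" "\<bar>dderiv2 g y \<nu> (e0 k0 - \<nu>)\<bar> \<le> l0 / 8"
          using Bb[of "e0 k0 - \<nu>" "e0 k0"] Bb[of \<nu> "e0 k0 - \<nu>"] e0n[of k0] nk by auto
      qed
      ultimately have df: "dderiv2 g y (e0 k0) (e0 k0) - dderiv2 g y \<nu> \<nu> \<ge> - (l0 / 4)" by linarith
      \<comment> \<open>There is at least one tangential direction, because the dimension is at
        least two.\<close>
      have "3 / 4 * l0 \<le> (\<Sum>i\<in>UNIV-{k0}. 3 / 4 * l0)"
      proof -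
        have "1 \<le> card (UNIV - {k0})" using dim by (simp add: card_Diff_singleton)
        then have "1 * (3 / 4 * l0) \<le> real (card (UNIV - {k0})) * (3 / 4 * l0)"
          using l0 by (intro mult_right_mono) auto
        then show ?thesis by simp
      qed
      also have "\<dots> \<le> (\<Sum>i\<in>UNIV-{k0}. dderiv2 g y (e0 i) (e0 i))"
        using n2 unfolding y_def by (intro sum_mono) (auto simp: less_imp_le)
      finally have "3 / 4 * l0 \<le> (\<Sum>i\<in>UNIV-{k0}. dderiv2 g y (e0 i) (e0 i))" .
      then show "l0 / 2 \<le> (\<Sum>i\<in>UNIV-{k}. dderiv2 g y (e i) (e i))"
        using df tr split[of "\<lambda>i. dderiv2 g y (e i) (e i)" k] split[of "\<lambda>i. dderiv2 g y (e0 i) (e0 i)" k0]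
        unfolding ek by linarith
    qed
    then show False using X(4)[of "r n"] unfolding y_def by simp
  qed
  then show thesis using that unfolding good_def g_def by blast
qed

text \<open>A negative value of \<open>w0\<close>, the speed minus the barrier, would force a
  minimum on a compact part of the collar. Initial time and both lateral boundaries are excluded by
  separate bounds, and \<open>no_barrier_contact\<close> excludes the rest, including points at the
  final time T.\<close>

lemma speed_lower_bound:
  assumes l0: "l0 > 0" "initially_nondegenerate l0 \<Omega> f" and dim: "CARD('n) \<ge> 2"
  obtains c d where "c > 0" "d > 0" "d < holder_width" "d \<le> 1"
    "\<forall>x t. (x, t) \<in> collar \<longrightarrow> pressure f x t < d \<longrightarrow> c * pressure f x t \<le> graph_speed (\<lambda>y. f y t) x"
proof -
  obtain C0 where C0: "C0 > 0" and
    Cg: "\<And>x t. (x, t) \<in> collar \<Longrightarrow> norm (grad (\<lambda>y. pressure f y t) x) \<le> C0" and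
    Ch: "\<And>x t v w. (x, t) \<in> collar \<Longrightarrow> norm v = 1 \<Longrightarrow> norm w = 1 \<Longrightarrow>
        \<bar>dderiv2 (\<lambda>y. pressure f y t) x v w\<bar> \<le> C0"
    using collar_derivative_bounds by metis
  define C1 where "C1 = real CARD('n) * (C0 + C0\<^sup>2)"
  have C1: "C1 > 0" unfolding C1_def using C0 by (simp add: add_pos_pos)
  obtain d0 where d0: "d0 > 0" and
    Q: "\<And>a b. b \<le> d0 \<Longrightarrow> compact {(x, t). 0 \<le> t \<and> t \<le> T \<and> x \<in> \<Omega> t \<and> a \<le> pressure f x t \<and> pressure f x t \<le> b}"
    using sublevel_compact by blast
  obtain d1 where d1: "d1 > 0" and
    init: "\<forall>x k e. x \<in> \<Omega> 0 \<longrightarrow> 0 < pressure f x 0 \<longrightarrow> pressure f x 0 < d1 \<longrightarrow>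
       adapted_frame (\<lambda>y. pressure f y 0) x k e \<longrightarrow>
       l0 / 2 \<le> norm (grad (\<lambda>y. pressure f y 0) x) \<and>
       l0 / 2 \<le> (\<Sum>i\<in>UNIV-{k}. dderiv2 (\<lambda>y. pressure f y 0) x (e i) (e i))"
    using initial_nondegeneracy[OF l0 dim] by blast
  define \<omega> where "\<omega> = 1 / (2 * R)"
  have w: "\<omega> > 0" unfolding \<omega>_def using R_pos by simp
  have lower: "\<omega> * pressure f x t \<le> norm (grad (\<lambda>y. pressure f y t) x)" if "(x, t) \<in> collar" for x t
    unfolding \<omega>_def using that by (intro pressure_gradient_lower) (auto simp: collar_slice_def collar_def)
  have frame: "\<exists>e. adapted_frame (\<lambda>y. pressure f y t) x k e" if "(x, t) \<in> collar" for x t k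
  proof -
    have "0 < \<omega> * pressure f x t" using w that unfolding collar_def by auto
    then have "grad (\<lambda>y. pressure f y t) x \<noteq> 0" using lower[OF that] by auto
    then show ?thesis using adapted_frame_exists by blast
  qed
  fix k :: 'n
  have nonneg: "0 \<le> graph_speed (\<lambda>y. f y t) x" if xt: "(x, t) \<in> collar" for x t
  proof -
    obtain e where e: "adapted_frame (\<lambda>y. pressure f y t) x k e" using frame[OF xt] by blast
    show ?thesis
      apply (rule collar_point[OF xt e _ C1_def])
       apply (erule (1) Ch[OF xt])
      subgoal premises P
        unfolding P(3) by (rule speed_scalar_nonneg[OF P(1,8)]) simp
      done
  qed
  \<comment> \<open>The entries keep g <= \<delta> inside the collar, make the sublevel sets
    compact, meet the requirement \<delta> <= 1 of the barrier, reach the initial nondegeneracy and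
    satisfy the smallness condition of \<open>speed_scalar_lower\<close>.\<close>
  define \<delta> where "\<delta> = min (min (holder_width / 2) d0) (min (min 1 d1) (l0 ^ 3 / 16 / (C0 * l0 / 2 + C1)))"
  have den: "C0 * l0 / 2 + C1 > 0" using C0 C1 l0 by (simp add: add_pos_pos)
  have \<delta>: "0 < \<delta>" "\<delta> < holder_width" "\<delta> \<le> d0" "\<delta> \<le> 1" "\<delta> \<le> d1" "\<delta> \<le> l0 ^ 3 / 16 / (C0 * l0 / 2 + C1)"
    unfolding \<delta>_def using holder_width(1) d0 d1 den l0 by auto
  define q where "q = 1 + C0\<^sup>2"
  \<comment> \<open>The constant of \<open>speed_scalar_lower\<close> at t = 0 with l = l0;
    \<open>q\<close> bounds 1 + |Df|^2 because g <= 1.\<close>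
  define \<epsilon> where "\<epsilon> = l0 ^ 3 / 16 / (q * sqrt q)"
  have q0: "q > 0" unfolding q_def by (simp add: add_pos_nonneg)
  have eps: "\<epsilon> > 0" unfolding \<epsilon>_def using l0 q0 by simp
  have start: "\<epsilon> * pressure f x 0 \<le> graph_speed (\<lambda>y. f y 0) x"
    if xt: "(x, 0) \<in> collar" and small: "pressure f x 0 < \<delta>" for x
  proof -
    obtain e where e: "adapted_frame (\<lambda>y. pressure f y 0) x k e" using frame[OF xt] by blast
    have x: "x \<in> \<Omega> 0" "0 < pressure f x 0" using xt unfolding collar_def by auto
    have g: "pressure f x 0 < d1" "pressure f x 0 \<le> 1" using small \<delta> by auto
    note in0 = init[rule_format, OF x g(1) e]
    have qq: "1 + (pressure f x 0 * norm (grad (\<lambda>y. pressure f y 0) x))\<^sup>2 \<le> q"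
      unfolding q_def using x g Cg[OF xt] C0
      by (auto intro!: power_mono mult_mono[of _ 1 _ C0, simplified])
    have sm: "(C0 * l0 / 2 + C1) * pressure f x 0 \<le> l0 ^ 3 / 16"
    proof -
      have "pressure f x 0 \<le> l0 ^ 3 / 16 / (C0 * l0 / 2 + C1)" using small \<delta>(6) by linarith
      then have "pressure f x 0 * (C0 * l0 / 2 + C1) \<le> l0 ^ 3 / 16" using pos_le_divide_eq[OF den] by blast
      then show ?thesis by (simp only: mult.commute)
    qed
    show ?thesis
      apply (rule collar_point[OF xt e _ C1_def])
       apply (erule (1) Ch[OF xt])
      subgoal premises P
        unfolding \<epsilon>_def
      proof (rule speed_scalar_lower[OF P(1) _ qq _ sm l0(1) _ P(9,10) _ P(4,7,8) C0 C1 P(3)])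
        show "pressure f x 0 * (l0 / 2) \<le> (\<Sum>i\<in>UNIV-{k}. dderiv2 (\<lambda>y. f y 0) x (e i) (e i))"
          unfolding P(11) using in0 x by (intro mult_left_mono) auto
      qed (use in0 x in auto)
      done
  qed
  obtain K where K: "K > 0" and barr: "barrier_rate C0 C1 \<omega> \<delta> K"
    using barrier_rate_exists[OF C0 C1 w \<delta>(1) \<delta>(4)] by blast
  define w0 where "w0 x t = graph_speed (\<lambda>y. f y t) x - \<epsilon> * exp (- K * t) * barrier \<delta> (pressure f x t)" for x t
  \<comment> \<open>As \<delta> <= 1, the barrier lies below \<epsilon> g: hence below the initial
    speed, and below \<epsilon> \<eta> on the level g = \<eta>.\<close>
  have bar_le: "\<epsilon> * exp (- K * t) * barrier \<delta> z \<le> \<epsilon> * z" if "0 \<le> t" "0 \<le> z" "z \<le> \<delta>" for t z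
  proof -
    have "(\<delta> - z)\<^sup>2 \<le> 1" using that \<delta>(4) by (intro power_le_one) auto
    then have "barrier \<delta> z \<le> z" unfolding barrier_def using that by (simp add: mult_left_le)
    moreover have "exp (- K * t) \<le> 1" using K that by simp
    moreover have "0 \<le> barrier \<delta> z" unfolding barrier_def using that by simp
    ultimately have "exp (- K * t) * barrier \<delta> z \<le> 1 * z" by (intro mult_mono) auto
    then show ?thesis using eps by (simp add: mult.assoc)
  qed
  have main: "0 \<le> w0 x t" if xt: "(x, t) \<in> collar" and small: "pressure f x t < \<delta>" for x t
  proof (rule ccontr)
    assume "\<not> 0 \<le> w0 x t"
    then have neg: "w0 x t < 0" by simp
    \<comment> \<open>Cutting at g >= \<eta> gives a compact subset of the collar, away from the
      interface. The first entry keeps the offending point in it; by the second, \<open>w0\<close>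
      >= - \<epsilon> \<eta> on g = \<eta> is still larger than the offending value.\<close>
    define \<eta> where "\<eta> = min (pressure f x t) (- w0 x t / (2 * \<epsilon>))"
    have eta: "0 < \<eta>" "\<eta> \<le> pressure f x t" "\<epsilon> * \<eta> < - w0 x t"
    proof -
      have "w0 x t / (2 * \<epsilon>) < 0" using neg eps by (intro divide_neg_pos) auto
      then show "0 < \<eta>" unfolding \<eta>_def using xt unfolding collar_def by auto
      show "\<eta> \<le> pressure f x t" unfolding \<eta>_def by simp
      have "\<eta> \<le> - w0 x t / (2 * \<epsilon>)" unfolding \<eta>_def by simp
      then have "\<eta> * (2 * \<epsilon>) \<le> - w0 x t" using eps by (simp only: pos_le_divide_eq mult_pos_pos zero_less_numeral)
      moreover have "\<eta> * (2 * \<epsilon>) = 2 * (\<epsilon> * \<eta>)" by simp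
      ultimately show "\<epsilon> * \<eta> < - w0 x t" using neg by linarith
    qed
    let ?Q = "{(x, t). 0 \<le> t \<and> t \<le> T \<and> x \<in> \<Omega> t \<and> \<eta> \<le> pressure f x t \<and> pressure f x t \<le> \<delta>}"
    have Qc: "compact ?Q" by (rule Q[OF \<delta>(3)])
    have Qcol: "?Q \<subseteq> collar" unfolding collar_def using eta(1) \<delta>(2) by auto
    have Qx: "(x, t) \<in> ?Q" using xt small eta unfolding collar_def by auto
    have cont: "continuous_on ?Q (\<lambda>z. w0 (fst z) (snd z))"
    proof -
      have 1: "continuous_on ?Q (\<lambda>z. graph_speed (\<lambda>y. f y (snd z)) (fst z))"
        using continuous_on_subset[OF speed_continuous Qcol] by (simp add: case_prod_beta')
      have "continuous_on ?Q (\<lambda>(x, t). pressure f x t)"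
        by (rule continuous_on_subset[OF pressure_continuous]) (use T in auto)
      then have 2: "continuous_on ?Q (\<lambda>z. pressure f (fst z) (snd z))" by (simp add: case_prod_beta')
      show ?thesis unfolding w0_def barrier_def by (intro continuous_intros 1 2)
    qed
    obtain z where z: "z \<in> ?Q" "\<And>z'. z' \<in> ?Q \<Longrightarrow> w0 (fst z) (snd z) \<le> w0 (fst z') (snd z')"
      using continuous_attains_inf[OF Qc _ cont] Qx by blast
    obtain x0 t0 where zx: "z = (x0, t0)" by (cases z)
    have z0: "0 \<le> t0" "t0 \<le> T" "x0 \<in> \<Omega> t0" "\<eta> \<le> pressure f x0 t0" "pressure f x0 t0 \<le> \<delta>"
      using z(1) zx by auto
    have zc: "(x0, t0) \<in> collar" using Qcol z(1) zx by blast
    have le: "w0 x0 t0 \<le> w0 x t" using z(2)[OF Qx] zx by simp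
    \<comment> \<open>On g = \<delta> the barrier is 0 and the speed is nonnegative, so
      \<open>w0\<close> cannot be negative there.\<close>
    have g_ne: "pressure f x0 t0 \<noteq> \<delta>"
      using le neg nonneg[OF zc] unfolding w0_def barrier_def by auto
    have t_ne: "t0 \<noteq> 0"
    proof
      assume t0: "t0 = 0"
      have "\<epsilon> * pressure f x0 0 \<le> graph_speed (\<lambda>y. f y 0) x0"
        by (rule start) (use zc z0 g_ne t0 in auto)
      then have "0 \<le> w0 x0 0" using bar_le[of 0 "pressure f x0 0"] z0 eta t0 unfolding w0_def by simp
      then show False using le neg t0 by simp
    qed
    have g_ne': "pressure f x0 t0 \<noteq> \<eta>"
    proof
      assume g: "pressure f x0 t0 = \<eta>"
      have "- (\<epsilon> * \<eta>) \<le> w0 x0 t0"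
        using bar_le[of t0 \<eta>] z0 eta(1) nonneg[OF zc] g unfolding w0_def by simp
      then show False using le eta(3) by simp
    qed
    define V where "V = {(x, t). 0 < t \<and> t < Tc \<and> x \<in> \<Omega> t \<and> f x t > 0 \<and> \<eta> < pressure f x t \<and> pressure f x t < \<delta>}"
    let ?U = "{(x, t). 0 < t \<and> t < Tc \<and> x \<in> \<Omega> t \<and> f x t > 0}"
    let ?F = "\<lambda>(x, t). f x t"
    have V: "open V"
    proof -
      have "continuous_on ?U (\<lambda>(x, t). pressure f x t)"
        by (rule continuous_on_subset[OF pressure_continuous]) auto
      from continuous_open_preimage[OF this open_spacetime_positive open_greaterThanLessThan[of \<eta> \<delta>]]
      have "open (?U \<inter> (\<lambda>(x, t). pressure f x t) -` {\<eta><..<\<delta>})" .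
      moreover have "?U \<inter> (\<lambda>(x, t). pressure f x t) -` {\<eta><..<\<delta>} = V" unfolding V_def by auto
      ultimately show ?thesis by simp
    qed
    have VU: "V \<subseteq> ?U" unfolding V_def by auto
    have CV: "Ck_upto 4 ?F V V" by (rule Ck_upto_mono[OF smooth_spacetime_positive VU VU])
    have zV: "(x0, t0) \<in> V"
      unfolding V_def using z0 g_ne g_ne' t_ne T eta(1) pressure_pos_iff[of x0 t0] by auto
    have pde: "dderiv ?F (y, s) (0, 1) = graph_speed (\<lambda>y. ?F (y, s)) y" if ys: "(y, s) \<in> V" for y s
    proof -
      have s: "0 < s" "s < Tc" "y \<in> \<Omega> s" "f y s > 0" using ys unfolding V_def by auto
      have "?F differentiable (at (y, s))" using CV ys by (simp add: eval_nat_numeral)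
      from time_slice_has_real_derivative[OF dderiv_has_derivative[OF this]]
      have 1: "((\<lambda>r. f y r) has_real_derivative dderiv ?F (y, s) (0, 1)) (at s)" by simp
      have "at s within {0..} = at s" using s(1) by (intro at_within_interior) simp
      then have "((\<lambda>r. f y r) has_real_derivative graph_speed (\<lambda>y. f y s) y) (at s)"
        using f_evolution[of s y] s by simp
      from DERIV_unique[OF 1 this] show ?thesis by simp
    qed
    have pr: "sqrt (2 * ?F (y, s)) = pressure f y s" for y s by (simp add: pressure_def)
    have pr': "(\<lambda>y. sqrt (2 * ?F (y, s))) = (\<lambda>y. pressure f y s)" for s by (simp add: pressure_def)
    show False
    proof (rule no_barrier_contact[OF V CV zV, where \<delta> = \<delta> and \<omega> = \<omega> and ?C0.0 = C0 and ?C1.0 = C1 and K = K and \<epsilon> = \<epsilon>])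
      show "\<And>z. z \<in> V \<Longrightarrow> ?F z > 0" unfolding V_def by auto
      show "dderiv2 (\<lambda>y. ?F (y, t0)) x0 v v \<ge> 0" for v
        using f_hessian_nonneg[of t0 x0 v] z0 zc by (simp add: collar_slice_def)
      show "sqrt (2 * ?F (x0, t0)) < \<delta>" unfolding pr using z0 g_ne by simp
      show "\<omega> * sqrt (2 * ?F (x0, t0)) \<le> norm (grad (\<lambda>y. sqrt (2 * ?F (y, t0))) x0)"
        unfolding pr pr' by (rule lower[OF zc])
      show "norm (grad (\<lambda>y. sqrt (2 * ?F (y, t0))) x0) \<le> C0" unfolding pr' by (rule Cg[OF zc])
      show "\<bar>dderiv2 (\<lambda>y. sqrt (2 * ?F (y, t0))) x0 v w\<bar> \<le> C0" if "norm v = 1" "norm w = 1" for v w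
        unfolding pr' by (rule Ch[OF zc that])
      show "dderiv ?F (x0, t0) (0, 1) - \<epsilon> * exp (- K * t0) * barrier \<delta> (sqrt (2 * ?F (x0, t0)))
        \<le> dderiv ?F (y, s) (0, 1) - \<epsilon> * exp (- K * s) * barrier \<delta> (sqrt (2 * ?F (y, s)))"
        if ys: "(y, s) \<in> V" "s \<le> t0" for y s
      proof -
        have "(y, s) \<in> ?Q" using ys z0(2) unfolding V_def by auto
        from z(2)[OF this] show ?thesis
          unfolding pde[OF zV] pde[OF ys(1)] pr zx by (simp add: w0_def)
      qed
    qed (rule pde barr C1_def w eps; assumption)+
  qed
  show thesis
  \<comment> \<open>On g < \<delta> / 2 the barrier is at least g (\<delta> / 2)^2, and its decaying
    time factor is smallest at T.\<close>
  proof (rule that[of "\<epsilon> * exp (- K * T) * (\<delta> / 2)\<^sup>2" "\<delta> / 2"]; (intro allI impI)?)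
    show "0 < \<epsilon> * exp (- K * T) * (\<delta> / 2)\<^sup>2" using eps \<delta> by simp
    show "0 < \<delta> / 2" "\<delta> / 2 < holder_width" "\<delta> / 2 \<le> 1" using \<delta> by auto
    fix x t assume xt: "(x, t) \<in> collar" and small: "pressure f x t < \<delta> / 2"
    have t: "0 \<le> t" "t \<le> T" and g: "0 < pressure f x t" using xt unfolding collar_def by auto
    have "exp (- K * T) * (\<delta> / 2)\<^sup>2 \<le> exp (- K * t) * (\<delta> - pressure f x t)\<^sup>2"
      using K t small \<delta>(1) by (intro mult_mono power_mono) auto
    then have "\<epsilon> * pressure f x t * (exp (- K * T) * (\<delta> / 2)\<^sup>2)
        \<le> \<epsilon> * pressure f x t * (exp (- K * t) * (\<delta> - pressure f x t)\<^sup>2)"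
      using eps g by (intro mult_left_mono) auto
    then have "\<epsilon> * exp (- K * T) * (\<delta> / 2)\<^sup>2 * pressure f x t
        \<le> \<epsilon> * exp (- K * t) * barrier \<delta> (pressure f x t)"
      unfolding barrier_def by (simp only: mult_ac)
    also have "\<dots> \<le> graph_speed (\<lambda>y. f y t) x"
      using main[OF xt] small \<delta>(1) unfolding w0_def by simp
    finally show "\<epsilon> * exp (- K * T) * (\<delta> / 2)\<^sup>2 * pressure f x t \<le> graph_speed (\<lambda>y. f y t) x" .
  qed
qed

end

section \<open>From the speed bound to the two-sided estimates\<close>

theorem corollary3p6p2:
  fixes f :: "real^'n \<Rightarrow> real \<Rightarrow> real"
    and \<Omega> :: "real \<Rightarrow> (real^'n) set"
    and S :: "((real^'n) \<times> real) set"
    and X :: "(real^'n) \<times> real \<Rightarrow> real \<Rightarrow> (real^'n) \<times> real"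
    and M :: "real \<Rightarrow> ((real^'n) \<times> real) set"
    and T Tc l0 \<rho>0 R \<beta> :: real
  assumes dim: "CARD('n) \<ge> 3"
    and initial: "initial_hypersurface S"
    and flow: "scalar_curvature_flow S Tc X M"
    and graph: "flow_graph M Tc \<Omega> f"
    and Tc: "flat_side_vanishing_time Tc \<Omega> f"
    and T: "0 < T" "T < Tc"
    and disk: "\<rho>0 > 0" "\<And>t. 0 \<le> t \<Longrightarrow> t \<le> T \<Longrightarrow> cball 0 \<rho>0 \<subseteq> flat_side \<Omega> f t"
    and dom: "\<And>t. 0 \<le> t \<Longrightarrow> t \<le> T \<Longrightarrow> \<Omega> t \<subseteq> ball 0 R"
    and nondeg: "l0 > 0" "initially_nondegenerate l0 \<Omega> f"
    and smooth: "\<exists>T0. 0 < T0 \<and> T0 < Tc \<and> smooth_up_to_interface T0 \<Omega> f"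
    and holder: "0 < \<beta>" "\<beta> < 1" "C2_holder_up_to_interface \<beta> T \<Omega> f"
    and height: "\<And>t. 0 \<le> t \<Longrightarrow> t \<le> T \<Longrightarrow> (SUP x\<in>\<Omega> t. f x t) \<ge> 2"
  shows "\<exists>C>0. \<exists>\<delta>>0. \<forall>t x k e.
    0 \<le> t \<and> t \<le> T \<and> x \<in> \<Omega> t \<and> 0 < pressure f x t \<and> pressure f x t < \<delta> \<and>
    adapted_frame (\<lambda>y. pressure f y t) x k e \<longrightarrow>
      (let F = (\<lambda>i j. dderiv2 (\<lambda>y. f y t) x (e i) (e j)); g = pressure f x t
       in C \<le> F k k \<and> F k k \<le> inverse C \<and>
          C \<le> (1 / g) * (\<Sum>i\<in>UNIV - {k}. F i i) \<and>
          (1 / g) * (\<Sum>i\<in>UNIV - {k}. F i i) \<le> inverse C \<and>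
          sqrt ((1 / g) * (\<Sum>i\<in>UNIV - {k}. (F i k)\<^sup>2)) \<le> inverse C)"
proof -
  interpret flat_graph_flow f \<Omega> S X M T Tc \<rho>0 R \<beta>
    using initial flow graph T disk dom holder by unfold_locales auto
  obtain C0 where C0: "C0 > 0" and
    Cg: "\<And>x t. (x, t) \<in> collar \<Longrightarrow> norm (grad (\<lambda>y. pressure f y t) x) \<le> C0" and
    Ch: "\<And>x t v w. (x, t) \<in> collar \<Longrightarrow> norm v = 1 \<Longrightarrow> norm w = 1 \<Longrightarrow>
        \<bar>dderiv2 (\<lambda>y. pressure f y t) x v w\<bar> \<le> C0"
    using collar_derivative_bounds by metis
  define C1 where "C1 = real CARD('n) * (C0 + C0\<^sup>2)"
  define C2 where "C2 = C0 + C0\<^sup>2"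
  have C1: "C1 > 0" unfolding C1_def using C0 by (simp add: add_pos_pos)
  have C2: "C2 > 0" unfolding C2_def using C0 by (simp add: add_pos_pos)
  have dim2: "CARD('n) \<ge> 2" using dim by simp
  obtain c d where c: "c > 0" and d: "d > 0" "d < holder_width" "d \<le> 1" and
    low: "\<forall>x t. (x, t) \<in> collar \<longrightarrow> pressure f x t < d \<longrightarrow> c * pressure f x t \<le> graph_speed (\<lambda>y. f y t) x"
    using speed_lower_bound[OF nondeg dim2] by blast
  \<comment> \<open>\<open>d\<close> is the range of the speed bound; the other entry is the
    smallness condition of \<open>speed_scalar_consequences\<close>.\<close>
  define \<delta> where "\<delta> = min d (c / C1\<^sup>2)"
  \<comment> \<open>The first two entries are the lower bounds from
    \<open>speed_scalar_consequences\<close>; the third makes \<open>inverse C\<close> exceed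
    \<open>C2\<close>, \<open>C1\<close> and C1 + 1, which are the three upper bounds.\<close>
  define C where "C = min (min (c / (2 * C1)) (c / (C2 + C1))) (inverse (C1 + C2 + 1))"
  have Cpos: "C > 0" unfolding C_def using c C1 C2 by (auto simp: add_pos_pos)
  have Cinv: "C1 + C2 + 1 \<le> inverse C"
  proof -
    have "C \<le> inverse (C1 + C2 + 1)" unfolding C_def by simp
    from le_imp_inverse_le[OF this Cpos] show ?thesis by simp
  qed
  have \<delta>: "\<delta> > 0" unfolding \<delta>_def using d c C1 by simp
  show ?thesis
  proof (rule exI[of _ C], rule conjI[OF Cpos], rule exI[of _ \<delta>], rule conjI[OF \<delta>], intro allI impI)
    fix t x k and e :: "'n \<Rightarrow> real^'n"
    assume H: "0 \<le> t \<and> t \<le> T \<and> x \<in> \<Omega> t \<and> 0 < pressure f x t \<and> pressure f x t < \<delta> \<and>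
      adapted_frame (\<lambda>y. pressure f y t) x k e"
    define g where "g = pressure f x t"
    have xt: "(x, t) \<in> collar" using H d unfolding collar_def \<delta>_def by auto
    have e: "adapted_frame (\<lambda>y. pressure f y t) x k e" using H by simp
    have g: "0 < g" "g \<le> 1" "g \<le> c / C1\<^sup>2" "g < d" using H d unfolding \<delta>_def g_def by auto
    define F where "F = (\<lambda>i j. dderiv2 (\<lambda>y. f y t) x (e i) (e j))"
    show "let F = (\<lambda>i j. dderiv2 (\<lambda>y. f y t) x (e i) (e j)); g = pressure f x t
       in C \<le> F k k \<and> F k k \<le> inverse C \<and>
          C \<le> (1 / g) * (\<Sum>i\<in>UNIV - {k}. F i i) \<and>
          (1 / g) * (\<Sum>i\<in>UNIV - {k}. F i i) \<le> inverse C \<and>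
          sqrt ((1 / g) * (\<Sum>i\<in>UNIV - {k}. (F i k)\<^sup>2)) \<le> inverse C"
      unfolding Let_def F_def[symmetric] g_def[symmetric]
      apply (rule collar_point[OF xt e _ C1_def])
       apply (erule (1) Ch[OF xt])
      subgoal premises P0
      proof -
      have Fe: "dderiv2 (\<lambda>y. f y t) x (e i) (e j) = F i j" for i j unfolding F_def ..
      define Tr where "Tr = (\<Sum>i\<in>UNIV - {k}. F i i)"
      define c2 where "c2 = (\<Sum>i\<in>UNIV - {k}. (F i k)\<^sup>2)"
      note P = P0[unfolded Fe g_def[symmetric], folded Tr_def c2_def]
      have Fu: "F k k \<le> C2"
      proof -
        let ?g1 = "dderiv2 (\<lambda>y. pressure f y t) x (e k) (e k)"
        have "g * ?g1 \<le> g * C0" using P(10) g by (intro mult_left_mono) auto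
        also have "\<dots> \<le> C0" using g C0 by simp
        finally have "g * ?g1 \<le> C0" .
        moreover have "(norm (grad (\<lambda>y. pressure f y t) x))\<^sup>2 \<le> C0\<^sup>2" using Cg[OF xt] by (intro power_mono) auto
        ultimately show ?thesis unfolding P(9) C2_def by linarith
      qed
      have low': "c * g \<le> graph_speed (\<lambda>y. f y t) x" using low xt g unfolding g_def by simp
      note SC = speed_scalar_consequences[OF P(1,2) _ P(6,8,4,5) Fu g(1,2) C1 C2 c P(3) low' g(3)]
      have T1: "c / (C2 + C1) * g \<le> Tr" and F1: "c / (2 * C1) \<le> F k k" using SC by simp_all
      have "C \<le> F k k" using F1 unfolding C_def by simp
      moreover have "F k k \<le> inverse C" using Fu Cinv C1 by simp
      moreover have "C \<le> 1 / g * Tr"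
      proof -
        have "c / (C2 + C1) \<le> Tr / g" using T1 g by (simp only: pos_le_divide_eq)
        then show ?thesis unfolding C_def by simp
      qed
      moreover have "1 / g * Tr \<le> inverse C"
      proof -
        have "Tr / g \<le> C1" using P(5) g by (simp only: pos_divide_le_eq)
        then show ?thesis using Cinv C2 by simp
      qed
      \<comment> \<open>The mixed sum is O(g^2), so the quotient is even O(g); (C1 + 1)^2 >= C1
        turns this into a bound free of square roots.\<close>
      moreover have "sqrt (1 / g * c2) \<le> inverse C"
      proof -
        have "c2 / g \<le> C1 * g" using P(7) g by (simp add: pos_divide_le_eq power2_eq_square mult.assoc)
        also have "\<dots> \<le> C1" using g C1 by simp
        also have "\<dots> \<le> (C1 + 1)\<^sup>2" using C1 by (simp add: power2_eq_square algebra_simps)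
        finally have "1 / g * c2 \<le> (C1 + 1)\<^sup>2" by simp
        then have "sqrt (1 / g * c2) \<le> C1 + 1" using C1 by (intro real_le_lsqrt) auto
        then show ?thesis using Cinv C2 by simp
      qed
      ultimately show ?thesis unfolding Tr_def c2_def by blast
      qed
      done
  qed
qed

end
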